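(* Let $\mathcal{T}=(T(t))_{t\ge0}$ be a bounded $C_0$-semigroup on a Banach space $X$ with infinitesimal generator $A$. Then $$\sigma_{uPF}(A)=\sigma(A)\cap i\mathbb{R}.$$
   Context: Vector-valued distributions: for a Banach space $Z$ and an open set $I\subseteq\mathbb{R}$, $\mathcal{D}'(I;Z)$ is the space of continuous linear maps $\mathcal{D}(I)=C_c^\infty(I)\to Z$, and $\mathcal{S}'(\mathbb{R};Z)$ is the space of continuous linear maps $\mathcal{S}(\mathbb{R})\to Z$ (Schwartz space). The Fourier transform is $\widehat{\varphi}(\xi)=\int_{-\infty}^{\infty}e^{-i\xi t}\varphi(t)\,dt$ on $\mathcal{S}(\mathbb{R})$, extended to $\mathcal{S}'(\mathbb{R};Z)$ by $\langle\widehat f,\varphi\rangle=\langle f,\widehat\varphi\rangle$. $C_0(\mathbb{R};Z)$ is the space of continuous $Z$-valued functions vanishing at infinity, and $PF(\mathbb{R};Z)=\{\widehat g: g\in C_0(\mathbb{R};Z)\}$. A distribution $f\in\mathcal{D}'(I;Z)$ is a local pseudofunction on $I$ if each $\xi_0\in I$ has an open neighborhood $I'\subseteq I$ on which $f$ coincides with an element of $PF(\mathbb{R};Z)$. For $f\in\mathcal{D}'(\mathbb{R};Z)$, $\operatorname{sing\,supp}_{PF}f$ is the complement in $\mathbb{R}$ of the largest open set on which $f$ is a local pseudofunction. Semigroups: $\mathcal{T}$ is bounded if $\sup_{t\ge0}\|T(t)\|_{L(X)}<\infty$; $R(\lambda,A)=(\lambda-A)^{-1}$ is the resolvent and $\sigma(A)$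 the spectrum. For bounded $\mathcal{T}$ the resolvent, as an $L(X)$-valued holomorphic function on $\{\operatorname{Re}\lambda>0\}$ ($L(X)$ with the operator norm), has a distributional boundary value $R(i\,\cdot,A)\in\mathcal{S}'(\mathbb{R};L(X))$, $\langle R(i\xi,A),\varphi(\xi)\rangle=\lim_{\alpha\to0^+}\int_{-\infty}^\infty\varphi(\xi)R(\alpha+i\xi,A)\,d\xi$. The uniform pseudofunction spectrum is $\sigma_{uPF}(A)=i\operatorname{sing\,supp}_{PF}R(i\,\cdot,A)$, with $Z=L(X)$. *)

theory Defs
  imports "HOL-Analysis.Analysis"
begin

section \<open>Complex Banach spaces\<close>

class complex_normed_vector = real_normed_vector +
  fixes scaleC :: "complex \<Rightarrow> 'a \<Rightarrow> 'a"  (infixr "*\<^sub>C" 75)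
  assumes scaleC_add_right: "a *\<^sub>C (x + y) = a *\<^sub>C x + a *\<^sub>C y"
    and scaleC_add_left: "(a + b) *\<^sub>C x = a *\<^sub>C x + b *\<^sub>C x"
    and scaleC_scaleC: "a *\<^sub>C b *\<^sub>C x = (a * b) *\<^sub>C x"
    and scaleR_scaleC: "r *\<^sub>R x = complex_of_real r *\<^sub>C x"
    and norm_scaleC: "norm (a *\<^sub>C x) = cmod a * norm x"

class complex_banach = complex_normed_vector + banach

lemma bounded_linear_scaleC: "bounded_linear (\<lambda>x::'a::complex_normed_vector. c *\<^sub>C x)"
proof (rule bounded_linear_intro[where K = "cmod c"])
  fix x y :: 'a and r :: real
  show "c *\<^sub>C (x + y) = c *\<^sub>C x + c *\<^sub>C y"
    by (rule scaleC_add_right)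
  show "c *\<^sub>C r *\<^sub>R x = r *\<^sub>R c *\<^sub>C x"
    by (simp only: scaleR_scaleC scaleC_scaleC mult.commute)
  show "norm (c *\<^sub>C x) \<le> norm x * cmod c"
    by (simp add: norm_scaleC)
qed

lemma scaleC_zero_right: "c *\<^sub>C (0::'a::complex_normed_vector) = 0"
  using linear_0[OF bounded_linear.linear[OF bounded_linear_scaleC]] .

lemma scaleC_minus_right: "c *\<^sub>C (- x) = - (c *\<^sub>C (x::'a::complex_normed_vector))"
  using linear_neg[OF bounded_linear.linear[OF bounded_linear_scaleC]] .

lemma scaleC_diff_right: "c *\<^sub>C (x - y) = c *\<^sub>C x - c *\<^sub>C (y::'a::complex_normed_vector)"
  using linear_diff[OF bounded_linear.linear[OF bounded_linear_scaleC]] .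

definition bounded_clinear ::
  "('a::complex_normed_vector \<Rightarrow> 'b::complex_normed_vector) \<Rightarrow> bool" where
  "bounded_clinear f \<longleftrightarrow> bounded_linear f \<and> (\<forall>c x. f (c *\<^sub>C x) = c *\<^sub>C f x)"

lemma bounded_clinear_imp_bounded_linear: "bounded_clinear f \<Longrightarrow> bounded_linear f"
  by (simp add: bounded_clinear_def)

typedef (overloaded) ('a, 'b) cblinfun =
  "{f :: 'a::complex_normed_vector \<Rightarrow> 'b::complex_normed_vector. bounded_clinear f}"
  morphisms cblinfun_apply CBlinfun
  by (rule exI[of _ "\<lambda>x. 0"])
    (simp add: bounded_clinear_def scaleC_zero_right)

setup_lifting type_definition_cblinfun

instantiation cblinfun :: (complex_normed_vector, complex_normed_vector) complex_normed_vector
begin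

lift_definition norm_cblinfun :: "('a, 'b) cblinfun \<Rightarrow> real" is onorm .

lift_definition minus_cblinfun :: "('a, 'b) cblinfun \<Rightarrow> ('a, 'b) cblinfun \<Rightarrow> ('a, 'b) cblinfun"
  is "\<lambda>f g x. f x - g x"
  by (simp add: bounded_clinear_def bounded_linear_sub scaleC_diff_right)

definition dist_cblinfun :: "('a, 'b) cblinfun \<Rightarrow> ('a, 'b) cblinfun \<Rightarrow> real"
  where "dist_cblinfun a b = norm (a - b)"

definition
  "(uniformity :: (('a, 'b) cblinfun \<times> ('a, 'b) cblinfun) filter) =
     (INF e\<in>{0 <..}. principal {(x, y). dist x y < e})"

definition open_cblinfun :: "('a, 'b) cblinfun set \<Rightarrow> bool"
  where "open_cblinfun S = (\<forall>x\<in>S. \<forall>\<^sub>F (x', y) in uniformity. x' = x \<longrightarrow> y \<in> S)"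

lift_definition uminus_cblinfun :: "('a, 'b) cblinfun \<Rightarrow> ('a, 'b) cblinfun" is "\<lambda>f x. - f x"
  by (simp add: bounded_clinear_def bounded_linear_minus scaleC_minus_right)

lift_definition zero_cblinfun :: "('a, 'b) cblinfun" is "\<lambda>x. 0"
  by (simp add: bounded_clinear_def scaleC_zero_right)

lift_definition plus_cblinfun :: "('a, 'b) cblinfun \<Rightarrow> ('a, 'b) cblinfun \<Rightarrow> ('a, 'b) cblinfun"
  is "\<lambda>f g x. f x + g x"
  by (simp add: bounded_clinear_def bounded_linear_add scaleC_add_right)

lift_definition scaleC_cblinfun :: "complex \<Rightarrow> ('a, 'b) cblinfun \<Rightarrow> ('a, 'b) cblinfun"
  is "\<lambda>c f x. c *\<^sub>C f x"
  by (simp add: bounded_clinear_def bounded_linear_compose[OF bounded_linear_scaleC]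
      scaleC_scaleC mult.commute)

lift_definition scaleR_cblinfun :: "real \<Rightarrow> ('a, 'b) cblinfun \<Rightarrow> ('a, 'b) cblinfun"
  is "\<lambda>r f x. r *\<^sub>R f x"
  by (simp add: bounded_clinear_def scaleR_scaleC scaleC_scaleC mult.commute
      bounded_linear_compose[OF bounded_linear_scaleC])

definition sgn_cblinfun :: "('a, 'b) cblinfun \<Rightarrow> ('a, 'b) cblinfun"
  where "sgn_cblinfun x = scaleR (inverse (norm x)) x"

instance
proof
  fix f g h :: "('a, 'b) cblinfun" and a b :: real and c d :: complex and U :: "('a, 'b) cblinfun set"
  show "dist f g = norm (f - g)" by (rule dist_cblinfun_def)
  show "sgn f = inverse (norm f) *\<^sub>R f" by (rule sgn_cblinfun_def)
  show "(uniformity :: (('a, 'b) cblinfun \<times> ('a, 'b) cblinfun) filter) =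
     (INF e\<in>{0 <..}. principal {(x, y). dist x y < e})"
    by (rule uniformity_cblinfun_def)
  show "open U = (\<forall>x\<in>U. \<forall>\<^sub>F (x', y) in uniformity. x' = x \<longrightarrow> y \<in> U)"
    by (rule open_cblinfun_def)
  show "f + g + h = f + (g + h)" by transfer (simp add: add.assoc)
  show "f + g = g + f" by transfer (simp add: add.commute)
  show "0 + f = f" by transfer simp
  show "- f + f = 0" by transfer simp
  show "f - g = f + - g" by transfer simp
  show "a *\<^sub>R (f + g) = a *\<^sub>R f + a *\<^sub>R g"
    by transfer (simp add: scaleR_add_right)
  show "(a + b) *\<^sub>R f = a *\<^sub>R f + b *\<^sub>R f"
    by transfer (simp add: scaleR_add_left)
  show "a *\<^sub>R b *\<^sub>R f = (a * b) *\<^sub>R f"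
    by transfer simp
  show "1 *\<^sub>R f = f"
    by transfer simp
  show "(norm f = 0) = (f = 0)"
    by transfer (simp add: onorm_eq_0 bounded_clinear_imp_bounded_linear fun_eq_iff)
  show "norm (f + g) \<le> norm f + norm g"
    by transfer (simp add: onorm_triangle bounded_clinear_imp_bounded_linear)
  have *: "onorm (\<lambda>x. c *\<^sub>C F x) = cmod c * onorm F" if "bounded_clinear F"
    for F :: "'a \<Rightarrow> 'b" and c
  proof (rule antisym)
    note bl = bounded_clinear_imp_bounded_linear[OF that]
    note blc = bounded_linear_compose[OF bounded_linear_scaleC bl]
    show "onorm (\<lambda>x. c *\<^sub>C F x) \<le> cmod c * onorm F"
      by (rule onorm_bound)
        (auto simp: norm_scaleC mult.assoc onorm_pos_le[OF bl] intro!: mult_left_mono onorm[OF bl])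
    show "cmod c * onorm F \<le> onorm (\<lambda>x. c *\<^sub>C F x)"
    proof (cases "c = 0")
      case True
      then show ?thesis using onorm_pos_le[OF blc[of c]] by simp
    next
      case False
      have "norm (F x) \<le> onorm (\<lambda>x. c *\<^sub>C F x) / cmod c * norm x" for x
        using onorm[OF blc[of c], of x] False by (simp add: norm_scaleC field_simps)
      then have "onorm F \<le> onorm (\<lambda>x. c *\<^sub>C F x) / cmod c"
        by (intro onorm_bound) (simp_all add: onorm_pos_le[OF blc[of c]])
      then show ?thesis using False by (simp add: pos_le_divide_eq mult.commute)
    qed
  qed
  show nC: "norm (c *\<^sub>C f) = cmod c * norm f"
    by transfer (rule *)
  show "norm (a *\<^sub>R f) = \<bar>a\<bar> * norm f"
    by transfer (simp add: onorm_scaleR bounded_clinear_imp_bounded_linear)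
  show "c *\<^sub>C (f + g) = c *\<^sub>C f + c *\<^sub>C g" by transfer (simp add: scaleC_add_right)
  show "(c + d) *\<^sub>C f = c *\<^sub>C f + d *\<^sub>C f" by transfer (simp add: scaleC_add_left)
  show "c *\<^sub>C d *\<^sub>C f = (c * d) *\<^sub>C f" by transfer (simp add: scaleC_scaleC)
  show "a *\<^sub>R f = complex_of_real a *\<^sub>C f"
    by transfer (simp add: scaleR_scaleC)
qed

end

instance cblinfun :: (complex_normed_vector, complex_banach) complex_banach
proof
  fix X :: "nat \<Rightarrow> ('a, 'b) cblinfun"
  assume X: "Cauchy X"
  define Y where "Y n = Blinfun (cblinfun_apply (X n))" for n
  have bl: "bounded_linear (cblinfun_apply f)" for f :: "('a, 'b) cblinfun"
    using cblinfun_apply[of f] by (simp add: bounded_clinear_def)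
  have Yap: "blinfun_apply (Y n) = cblinfun_apply (X n)" for n
    by (simp add: Y_def bounded_linear_Blinfun_apply bl)
  have dY: "norm (Y m - Y n) = norm (X m - X n)" for m n
    by (simp add: norm_blinfun.rep_eq norm_cblinfun.rep_eq minus_blinfun.rep_eq
        minus_cblinfun.rep_eq Yap)
  have "Cauchy Y"
    using X by (simp add: Cauchy_def dist_norm dY)
  then obtain L where L: "Y \<longlonglongrightarrow> L"
    using Cauchy_convergent_iff convergent_def by blast
  have pt: "(\<lambda>n. blinfun_apply (Y n) x) \<longlonglongrightarrow> blinfun_apply L x" for x
    by (intro bounded_linear.tendsto[OF blinfun.bounded_linear_left] L)
  have "blinfun_apply L (c *\<^sub>C x) = c *\<^sub>C blinfun_apply L x" for c x
  proof (rule LIMSEQ_unique[OF pt[of "c *\<^sub>C x"]])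
    have "blinfun_apply (Y n) (c *\<^sub>C x) = c *\<^sub>C blinfun_apply (Y n) x" for n
      using cblinfun_apply[of "X n"] by (simp add: Yap bounded_clinear_def)
    then show "(\<lambda>n. blinfun_apply (Y n) (c *\<^sub>C x)) \<longlonglongrightarrow> c *\<^sub>C blinfun_apply L x"
      by (simp add: bounded_linear.tendsto[OF bounded_linear_scaleC pt])
  qed
  then have Lc: "cblinfun_apply (CBlinfun (blinfun_apply L)) = blinfun_apply L"
    by (intro CBlinfun_inverse)
      (simp add: bounded_clinear_def blinfun.bounded_linear_right)
  have "norm (X n - CBlinfun (blinfun_apply L)) = norm (Y n - L)" for n
    by (simp add: norm_blinfun.rep_eq norm_cblinfun.rep_eq minus_blinfun.rep_eq
        minus_cblinfun.rep_eq Yap Lc)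
  then have "X \<longlonglongrightarrow> CBlinfun (blinfun_apply L)"
    using L by (simp add: LIMSEQ_iff)
  then show "convergent X" by (auto simp: convergent_def)
qed


section \<open>Vector-valued distributions on the real line\<close>

text \<open>
  Distributions are represented as functions on all of \<^typ>\<open>real \<Rightarrow> complex\<close>; only their values on
  the test functions under consideration are meaningful, so restriction to a smaller open set
  leaves the representing function unchanged.  Tempered distributions (Fourier transforms of
  \<open>C\<^sub>0\<close> functions, boundary values of the resolvent) enter the notions below only through their
  restriction to \<open>\<D>(\<real>)\<close>; they are given by their defining formulas, which make sense on every
  Schwartz function, so the Schwartz space itself is not introduced.
\<close>

primrec iter_vderiv :: "nat \<Rightarrow> (real \<Rightarrow> 'a::real_normed_vector) \<Rightarrow> real \<Rightarrow> 'a" where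
  "iter_vderiv 0 \<phi> = \<phi>"
| "iter_vderiv (Suc n) \<phi> = (\<lambda>t. vector_derivative (iter_vderiv n \<phi>) (at t))"

definition smooth_fun :: "(real \<Rightarrow> 'a::real_normed_vector) \<Rightarrow> bool" where
  "smooth_fun \<phi> \<longleftrightarrow> (\<forall>n t. iter_vderiv n \<phi> differentiable (at t))"

definition fsupport :: "(real \<Rightarrow> complex) \<Rightarrow> real set" where
  "fsupport \<phi> = closure {t. \<phi> t \<noteq> 0}"

definition test_funs :: "real set \<Rightarrow> (real \<Rightarrow> complex) set" where
  "test_funs I = {\<phi>. smooth_fun \<phi> \<and> compact (fsupport \<phi>) \<and> fsupport \<phi> \<subseteq> I}"

text \<open>
  The Frechet topology on the smooth functions supported in a fixed compact set \<open>K\<close>, given by the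
  seminorms \<open>\<phi> \<mapsto> sup \<bar>\<phi>\<^sup>(\<^sup>n\<^sup>)\<bar>\<close>.
\<close>

definition test_funs_on_topology :: "real set \<Rightarrow> (real \<Rightarrow> complex) topology" where
  "test_funs_on_topology K = topology_generated_by
     {{\<psi> \<in> test_funs K. (SUP t. cmod (iter_vderiv n (\<lambda>s. \<psi> s - \<phi> s) t)) < \<epsilon>} |
        n \<phi> \<epsilon>. \<phi> \<in> test_funs K \<and> 0 < \<epsilon>}"

text \<open>
  The inductive limit topology of \<open>\<D>(I)\<close>: a base of it consists of the translates of the convex
  balanced sets whose trace on every compactly supported piece is open.
\<close>

definition test_nbhds :: "real set \<Rightarrow> (real \<Rightarrow> complex) set set" where
  "test_nbhds I = {W. W \<subseteq> test_funs I \<and>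
     (\<forall>\<phi>\<in>W. \<forall>\<psi>\<in>W. \<forall>u::real. 0 \<le> u \<and> u \<le> 1 \<longrightarrow> (\<lambda>t. (1 - u) * \<phi> t + u * \<psi> t) \<in> W) \<and>
     (\<forall>\<phi>\<in>W. \<forall>c. cmod c \<le> 1 \<longrightarrow> (\<lambda>t. c * \<phi> t) \<in> W) \<and>
     (\<forall>K. compact K \<and> K \<subseteq> I \<longrightarrow> openin (test_funs_on_topology K) (W \<inter> test_funs K))}"

definition test_topology :: "real set \<Rightarrow> (real \<Rightarrow> complex) topology" where
  "test_topology I = topology_generated_by
     {(\<lambda>\<psi> t. \<phi> t + \<psi> t) ` W | \<phi> W. \<phi> \<in> test_funs I \<and> W \<in> test_nbhds I}"

definition distributions :: "real set \<Rightarrow> ((real \<Rightarrow> complex) \<Rightarrow> 'z::complex_banach) set" where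
  "distributions I = {f.
     (\<forall>\<phi>\<in>test_funs I. \<forall>\<psi>\<in>test_funs I. f (\<lambda>t. \<phi> t + \<psi> t) = f \<phi> + f \<psi>) \<and>
     (\<forall>\<phi>\<in>test_funs I. \<forall>c. f (\<lambda>t. c * \<phi> t) = c *\<^sub>C f \<phi>) \<and>
     continuous_map (test_topology I) euclidean f}"


section \<open>Fourier transform and pseudofunctions\<close>

text \<open>
  All integrals are Henstock--Kurzweil integrals: the Bochner integral of the library requires a
  separable range space, which spaces of operators do not have.  For continuous absolutely
  integrable integrands, the only ones that matter here, the two notions agree.
\<close>

definition fourier :: "(real \<Rightarrow> complex) \<Rightarrow> real \<Rightarrow> complex" where
  "fourier \<phi> \<xi> = integral UNIV (\<lambda>t. exp (- \<i> * of_real \<xi> * of_real t) * \<phi> t)"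

definition regular_distr :: "(real \<Rightarrow> 'z::complex_banach) \<Rightarrow> (real \<Rightarrow> complex) \<Rightarrow> 'z" where
  "regular_distr g \<phi> = integral UNIV (\<lambda>t. \<phi> t *\<^sub>C g t)"

definition fourier_distr :: "((real \<Rightarrow> complex) \<Rightarrow> 'z) \<Rightarrow> (real \<Rightarrow> complex) \<Rightarrow> 'z" where
  "fourier_distr f \<phi> = f (fourier \<phi>)"

definition C0_funs :: "(real \<Rightarrow> 'z::complex_banach) set" where
  "C0_funs = {g. continuous_on UNIV g \<and> (g \<longlongrightarrow> 0) at_infinity}"

definition pseudofunctions :: "((real \<Rightarrow> complex) \<Rightarrow> 'z::complex_banach) set" where
  "pseudofunctions = (\<lambda>g. fourier_distr (regular_distr g)) ` C0_funs"

definition local_pseudofunction ::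
  "real set \<Rightarrow> ((real \<Rightarrow> complex) \<Rightarrow> 'z::complex_banach) \<Rightarrow> bool" where
  "local_pseudofunction I f \<longleftrightarrow> f \<in> distributions I \<and>
     (\<forall>\<xi>\<in>I. \<exists>I'. open I' \<and> \<xi> \<in> I' \<and> I' \<subseteq> I \<and>
        (\<exists>F\<in>pseudofunctions. \<forall>\<phi>\<in>test_funs I'. f \<phi> = F \<phi>))"

text \<open>
  Being a local pseudofunction is a local property, so for \<open>f \<in> distributions UNIV\<close> the union below
  is the largest open set on which \<open>f\<close> is a local pseudofunction.
\<close>

definition pf_singsupp :: "((real \<Rightarrow> complex) \<Rightarrow> 'z::complex_banach) \<Rightarrow> real set" where
  "pf_singsupp f = - \<Union>{I. open I \<and> local_pseudofunction I f}"


section \<open>Unbounded operators and semigroups\<close>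

text \<open>
  An operator with domain \<open>dom A\<close> is a partial map \<open>A\<close>.
\<close>

definition shifted_op :: "complex \<Rightarrow> ('a::complex_banach \<rightharpoonup> 'a) \<Rightarrow> 'a \<Rightarrow> 'a" where
  "shifted_op z A x = z *\<^sub>C x - the (A x)"

definition resolvent_set :: "('a::complex_banach \<rightharpoonup> 'a) \<Rightarrow> complex set" where
  "resolvent_set A = {z. bij_betw (shifted_op z A) (dom A) UNIV \<and>
     bounded_clinear (inv_into (dom A) (shifted_op z A))}"

definition spectrum :: "('a::complex_banach \<rightharpoonup> 'a) \<Rightarrow> complex set" where
  "spectrum A = - resolvent_set A"

definition resolvent :: "complex \<Rightarrow> ('a::complex_banach \<rightharpoonup> 'a) \<Rightarrow> ('a, 'a) cblinfun" where
  "resolvent z A = CBlinfun (inv_into (dom A) (shifted_op z A))"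

definition C0_semigroup :: "(real \<Rightarrow> ('a::complex_banach, 'a) cblinfun) \<Rightarrow> bool" where
  "C0_semigroup T \<longleftrightarrow>
     (\<forall>x. cblinfun_apply (T 0) x = x) \<and>
     (\<forall>s\<ge>0. \<forall>t\<ge>0. \<forall>x. cblinfun_apply (T (s + t)) x = cblinfun_apply (T s) (cblinfun_apply (T t) x)) \<and>
     (\<forall>x. ((\<lambda>t. cblinfun_apply (T t) x) \<longlongrightarrow> x) (at_right 0))"

definition bounded_semigroup :: "(real \<Rightarrow> ('a::complex_banach, 'a) cblinfun) \<Rightarrow> bool" where
  "bounded_semigroup T \<longleftrightarrow> bounded (T ` {0..})"

definition generator :: "(real \<Rightarrow> ('a::complex_banach, 'a) cblinfun) \<Rightarrow> ('a \<rightharpoonup> 'a)" where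
  "generator T x =
     (let q = \<lambda>h. (cblinfun_apply (T h) x - x) /\<^sub>R h
      in if \<exists>y. (q \<longlongrightarrow> y) (at_right 0) then Some (Lim (at_right 0) q) else None)"


section \<open>The uniform pseudofunction spectrum\<close>

definition resolvent_bv ::
  "('a::complex_banach \<rightharpoonup> 'a) \<Rightarrow> (real \<Rightarrow> complex) \<Rightarrow> ('a, 'a) cblinfun" where
  "resolvent_bv A \<phi> =
     Lim (at_right 0) (\<lambda>\<alpha>. integral UNIV (\<lambda>\<xi>. \<phi> \<xi> *\<^sub>C resolvent (of_real \<alpha> + \<i> * of_real \<xi>) A))"

definition uPF_spectrum :: "('a::complex_banach \<rightharpoonup> 'a) \<Rightarrow> complex set" where
  "uPF_spectrum A = (\<lambda>\<xi>. \<i> * of_real \<xi>) ` pf_singsupp (resolvent_bv A)"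

end

theory Submission
  imports Defs "HOL-Probability.Sinc_Integral" "HOL-Real_Asymp.Real_Asymp"
    "HOL-Computational_Algebra.Polynomial"
begin

text \<open>
  The claim is that for every real \<open>\<xi>\<^sub>0\<close> the point \<open>i \<xi>\<^sub>0\<close> lies in the resolvent set of \<open>A\<close> if and
  only if the boundary value of the resolvent is a local pseudofunction near \<open>\<xi>\<^sub>0\<close>.  The semigroup
  enters only through the half plane \<open>Re \<lambda> > 0\<close>, which it places in the resolvent set with
  \<open>\<parallel>R(\<lambda>)\<parallel> \<le> M / Re \<lambda>\<close> (\<open>half_plane_resolvent\<close>).  For a test function \<open>\<phi>\<close> let
  \<open>J(\<beta>, \<phi>) = \<integral> \<phi>(\<xi>) R(\<beta> + i \<xi>) d\<xi>\<close>.  Since \<open>dJ(\<beta>, \<phi>)/d\<beta> = i J(\<beta>, \<phi>')\<close>, two integrations turn the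
  bound \<open>O(1/\<beta>)\<close> into convergence in operator norm as \<open>\<beta> \<rightarrow> 0\<close>, so the boundary value really is
  the limit of \<open>J(\<beta>, \<phi>)\<close> (\<open>approx_bv_tendsto\<close>).

  Suppose the boundary value is the Fourier transform of some \<open>g \<in> C\<^sub>0\<close> near \<open>\<xi>\<^sub>0\<close>.  Take a test
  function \<open>\<phi> \<ge> 0\<close> that exceeds \<open>c > 0\<close> near \<open>0\<close>, and squeeze it to \<open>\<phi>\<^sub>a(\<xi>) = \<phi>((\<xi> - \<xi>\<^sub>0) / a)\<close>.  The
  Fourier transforms of the \<open>\<phi>\<^sub>a\<close> have bounded \<open>L\<^sup>1\<close> norm and spread out over the line, so the pairing
  with \<open>g\<close> tends to zero (\<open>regular_distr_rescale_tendsto_0\<close>).  On the other hand the resolvent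
  identity gives, with \<open>\<lambda> = \<delta> + i \<xi>\<^sub>0\<close>,
  \<open>J(\<beta>, \<phi>\<^sub>a) R(\<lambda>) = \<kappa> R(\<lambda>) - \<integral> \<phi>\<^sub>a(\<xi>) R(\<beta> + i \<xi>) / (\<beta> - \<delta> + i (\<xi> - \<xi>\<^sub>0)) d\<xi>\<close>,
  where \<open>\<kappa> = \<integral> \<phi>\<^sub>a(\<xi>) / (\<beta> - \<delta> + i (\<xi> - \<xi>\<^sub>0)) d\<xi>\<close> has real part at least \<open>c\<close>: it is a Poisson integral.
  Once \<open>J(\<beta>, \<phi>\<^sub>a)\<close> is smaller than \<open>c / 2\<close>, this bounds \<open>R(\<delta> + i \<xi>\<^sub>0)\<close> uniformly as \<open>\<delta> \<rightarrow> 0\<close>, and a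
  resolvent that stays bounded on approach to \<open>i \<xi>\<^sub>0\<close> extends to \<open>i \<xi>\<^sub>0\<close>.

  Conversely, if \<open>i \<xi>\<^sub>0\<close> is in the resolvent set, then on a small interval \<open>[a, b]\<close> around \<open>\<xi>\<^sub>0\<close> the
  boundary value is the continuously differentiable function \<open>F(\<xi>) = R(i \<xi>)\<close>.  Truncating \<open>F\<close>
  sharply to \<open>[a, b]\<close> still leaves the function \<open>g(t) = (2 \<pi>)\<^bsup>-1\<^esup> \<integral>\<^sub>a\<^sup>b exp (i \<eta> t) F(\<eta>) d\<eta>\<close> in \<open>C\<^sub>0\<close>
  (\<open>oscillatory_integral_C0\<close>), and Fourier inversion for scalar test functions shows that its
  Fourier transform is \<open>F\<close> on \<open>(a, b)\<close> (\<open>regular_distr_inverse_fourier\<close>).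
\<close>


section \<open>Complex scalars and composition of operators\<close>

lemma scaleC_one [simp]: "1 *\<^sub>C x = (x::'a::complex_normed_vector)"
  using scaleR_scaleC[of 1 x] by simp

lemma scaleC_zero_left [simp]: "0 *\<^sub>C x = (0::'a::complex_normed_vector)"
  using scaleR_scaleC[of 0 x] by simp

lemma scaleC_minus_left: "(- a) *\<^sub>C x = - (a *\<^sub>C (x::'a::complex_normed_vector))"
  using scaleC_add_left[of "- a" a x] by (simp add: eq_neg_iff_add_eq_0)

lemma scaleC_diff_left: "(a - b) *\<^sub>C x = a *\<^sub>C x - b *\<^sub>C (x::'a::complex_normed_vector)"
  using scaleC_add_left[of a "- b" x] by (simp add: scaleC_minus_left)

declare scaleC_zero_right [simp] norm_scaleC [simp]

lemma bounded_bilinear_scaleC: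
  "bounded_bilinear (\<lambda>c x. c *\<^sub>C (x::'a::complex_normed_vector))"
proof
  show "\<exists>K. \<forall>a (b::'a). norm (a *\<^sub>C b) \<le> norm a * norm b * K"
    by (rule exI[of _ 1]) simp
qed (simp_all add: scaleC_add_left scaleC_add_right scaleR_scaleC scaleC_scaleC scaleR_conv_of_real
      mult.commute)

lemmas tendsto_scaleC [tendsto_intros] = bounded_bilinear.tendsto[OF bounded_bilinear_scaleC]
lemmas continuous_on_scaleC [continuous_intros] =
  bounded_bilinear.continuous_on[OF bounded_bilinear_scaleC]

lemma bounded_linear_cblinfun_apply: "bounded_linear (cblinfun_apply f)"
  using cblinfun_apply[of f] by (simp add: bounded_clinear_def)

lemma cblinfun_apply_scaleC: "cblinfun_apply f (c *\<^sub>C x) = c *\<^sub>C cblinfun_apply f x"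
  using cblinfun_apply[of f] by (simp add: bounded_clinear_def)

lemma norm_cblinfun_apply: "norm (cblinfun_apply f x) \<le> norm f * norm x"
  unfolding norm_cblinfun.rep_eq by (rule onorm[OF bounded_linear_cblinfun_apply])

lemma norm_cblinfun_bound:
  assumes "0 \<le> C" "\<And>x. norm (cblinfun_apply f x) \<le> C * norm x"
  shows "norm f \<le> C"
  unfolding norm_cblinfun.rep_eq by (rule onorm_bound) (use assms in auto)

lift_definition cblinfun_comp ::
  "('b::complex_normed_vector, 'c::complex_normed_vector) cblinfun \<Rightarrow>
   ('a::complex_normed_vector, 'b) cblinfun \<Rightarrow> ('a, 'c) cblinfun" (infixl "o\<^sub>C" 67)
  is "\<lambda>f g x. f (g x)"
  by (simp add: bounded_clinear_def bounded_linear_compose)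

lemma bounded_bilinear_cblinfun_comp:
  "bounded_bilinear ((o\<^sub>C) :: ('b::complex_normed_vector, 'c::complex_normed_vector) cblinfun \<Rightarrow>
    ('a::complex_normed_vector, 'b) cblinfun \<Rightarrow> ('a, 'c) cblinfun)"
proof
  show "\<exists>K. \<forall>(a::('b, 'c) cblinfun) (b::('a, 'b) cblinfun). norm (a o\<^sub>C b) \<le> norm a * norm b * K"
  proof (intro exI[of _ 1] allI)
    fix a :: "('b, 'c) cblinfun" and b :: "('a, 'b) cblinfun"
    have "norm (cblinfun_apply (a o\<^sub>C b) x) \<le> norm a * norm b * norm x" for x
    proof -
      have "norm (cblinfun_apply (a o\<^sub>C b) x) \<le> norm a * norm (cblinfun_apply b x)"
        by (simp add: cblinfun_comp.rep_eq norm_cblinfun_apply)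
      also have "\<dots> \<le> norm a * (norm b * norm x)"
        by (intro mult_left_mono norm_cblinfun_apply) simp
      finally show ?thesis by (simp add: mult.assoc)
    qed
    then show "norm (a o\<^sub>C b) \<le> norm a * norm b * 1"
      by (simp add: norm_cblinfun_bound)
  qed
next
  fix a a' :: "('b, 'c) cblinfun" and b b' :: "('a, 'b) cblinfun" and r :: real
  show "(a + a') o\<^sub>C b = a o\<^sub>C b + a' o\<^sub>C b" by transfer simp
  show "a o\<^sub>C (b + b') = a o\<^sub>C b + a o\<^sub>C b'"
    by transfer (simp add: bounded_clinear_def linear_add bounded_linear.linear)
  show "(r *\<^sub>R a) o\<^sub>C b = r *\<^sub>R (a o\<^sub>C b)" by transfer simp
  show "a o\<^sub>C (r *\<^sub>R b) = r *\<^sub>R (a o\<^sub>C b)"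
    by transfer (simp add: bounded_clinear_def linear_scale bounded_linear.linear)
qed

lemmas continuous_on_cblinfun_comp [continuous_intros] =
  bounded_bilinear.continuous_on[OF bounded_bilinear_cblinfun_comp]

lemma norm_cblinfun_comp: "norm (f o\<^sub>C g) \<le> norm f * norm g"
proof (rule norm_cblinfun_bound)
  fix x
  have "norm (cblinfun_apply (f o\<^sub>C g) x) \<le> norm f * norm (cblinfun_apply g x)"
    by (simp add: cblinfun_comp.rep_eq norm_cblinfun_apply)
  also have "\<dots> \<le> norm f * (norm g * norm x)"
    by (intro mult_left_mono norm_cblinfun_apply) simp
  finally show "norm (cblinfun_apply (f o\<^sub>C g) x) \<le> norm f * norm g * norm x"
    by (simp add: mult.assoc)
qed simp

lemma scaleC_cblinfun_comp: "(c *\<^sub>C f) o\<^sub>C g = c *\<^sub>C (f o\<^sub>C g)"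
  by transfer simp

lemma fixpoint_contraction:
  fixes E :: "'a::banach \<Rightarrow> 'a"
  assumes "linear E" "q < 1" "\<And>x. norm (E x) \<le> q * norm x"
  obtains x where "x = y + E x"
proof -
  have "0 \<le> max q 0" "max q 0 < 1" using assms by auto
  moreover have "\<forall>x z. dist (y + E x) (y + E z) \<le> max q 0 * dist x z"
  proof (intro allI)
    fix x z
    have "dist (y + E x) (y + E z) = norm (E (x - z))"
      by (simp add: dist_norm linear_diff[OF assms(1)])
    also have "\<dots> \<le> q * norm (x - z)" by (rule assms)
    also have "\<dots> \<le> max q 0 * norm (x - z)" by (intro mult_right_mono) auto
    finally show "dist (y + E x) (y + E z) \<le> max q 0 * dist x z" by (simp add: dist_norm)
  qed
  ultimately have "\<exists>!x. y + E x = x" by (rule banach_fix_type)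
  then show ?thesis using that by metis
qed

section \<open>Resolvents of linear partial operators\<close>

definition clinear_op :: "('a::complex_banach \<rightharpoonup> 'a) \<Rightarrow> bool" where
  "clinear_op A \<longleftrightarrow>
     (\<forall>x\<in>dom A. \<forall>y\<in>dom A. x + y \<in> dom A \<and> the (A (x + y)) = the (A x) + the (A y)) \<and>
     (\<forall>x\<in>dom A. \<forall>c. c *\<^sub>C x \<in> dom A \<and> the (A (c *\<^sub>C x)) = c *\<^sub>C the (A x))"

lemma clinear_op_shifted:
  assumes "clinear_op A" "x \<in> dom A"
  shows "y \<in> dom A \<Longrightarrow> x + y \<in> dom A"
    and "y \<in> dom A \<Longrightarrow> shifted_op z A (x + y) = shifted_op z A x + shifted_op z A y"
    and "c *\<^sub>C x \<in> dom A"
    and "shifted_op z A (c *\<^sub>C x) = c *\<^sub>C shifted_op z A x"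
    and "shifted_op w A x = shifted_op z A x + (w - z) *\<^sub>C x"
  using assms unfolding clinear_op_def shifted_op_def
  by (auto simp: scaleC_add_right scaleC_diff_right scaleC_diff_left scaleC_scaleC mult.commute
      domIff)

lemma resolvent_set_surj:
  assumes "z \<in> resolvent_set A"
  shows "cblinfun_apply (resolvent z A) y \<in> dom A"
    and "shifted_op z A (cblinfun_apply (resolvent z A) y) = y"
proof -
  have *: "bij_betw (shifted_op z A) (dom A) UNIV"
    and b: "bounded_clinear (inv_into (dom A) (shifted_op z A))"
    using assms by (auto simp: resolvent_set_def)
  have r: "cblinfun_apply (resolvent z A) = inv_into (dom A) (shifted_op z A)"
    unfolding resolvent_def using b by (simp add: CBlinfun_inverse)
  have y: "y \<in> shifted_op z A ` dom A" using * by (simp add: bij_betw_def)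
  show "cblinfun_apply (resolvent z A) y \<in> dom A"
    unfolding r using y by (rule inv_into_into)
  show "shifted_op z A (cblinfun_apply (resolvent z A) y) = y"
    unfolding r using y by (rule f_inv_into_f)
qed

lemma resolvent_set_inj:
  assumes "z \<in> resolvent_set A" "x \<in> dom A"
  shows "cblinfun_apply (resolvent z A) (shifted_op z A x) = x"
  using assms resolvent_set_surj[OF assms(1), of "shifted_op z A x"]
  by (auto simp: resolvent_set_def bij_betw_def dest: inj_onD)

lemma resolvent_set_bound:
  assumes "z \<in> resolvent_set A" "x \<in> dom A"
  shows "norm x \<le> norm (resolvent z A) * norm (shifted_op z A x)"
  by (metis resolvent_set_inj[OF assms] norm_cblinfun_apply)

lemma resolvent_setI:
  assumes A: "clinear_op A" and C: "0 \<le> C"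
    and below: "\<And>x. x \<in> dom A \<Longrightarrow> norm x \<le> C * norm (shifted_op z A x)"
    and surj: "\<And>y. \<exists>x\<in>dom A. shifted_op z A x = y"
  shows "z \<in> resolvent_set A" "norm (resolvent z A) \<le> C"
proof -
  let ?S = "shifted_op z A" and ?G = "inv_into (dom A) (shifted_op z A)"
  have inj: "inj_on ?S (dom A)"
  proof (rule inj_onI)
    fix x y assume xy: "x \<in> dom A" "y \<in> dom A" "?S x = ?S y"
    have my: "(-1) *\<^sub>C y \<in> dom A" using clinear_op_shifted(3)[OF A xy(2)] .
    have "?S (x + (-1) *\<^sub>C y) = ?S x + (-1) *\<^sub>C ?S y"
      by (simp only: clinear_op_shifted(2)[OF A xy(1) my] clinear_op_shifted(4)[OF A xy(2)])
    then have "?S (x + (-1) *\<^sub>C y) = 0" using xy(3) by (simp add: scaleC_minus_left)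
    then have "norm (x + (-1) *\<^sub>C y) \<le> 0"
      using below[OF clinear_op_shifted(1)[OF A xy(1) my]] by simp
    then show "x = y" by (simp add: scaleC_minus_left)
  qed
  have im: "?S ` dom A = UNIV" using surj by (metis UNIV_eq_I imageI)
  have Gd: "?G y \<in> dom A" and SG: "?S (?G y) = y" for y
    using im by (metis UNIV_I inv_into_into, metis UNIV_I f_inv_into_f)
  have GI: "?G y = x" if "x \<in> dom A" "?S x = y" for x y
    using that inj inv_into_f_f by metis
  have Gc: "?G (c *\<^sub>C x) = c *\<^sub>C ?G x" for c x
    using clinear_op_shifted(3,4)[OF A Gd[of x]] SG by (intro GI) auto
  have bd: "norm (?G y) \<le> C * norm y" for y
    using below[OF Gd[of y]] SG[of y] by simp
  have "bounded_clinear ?G"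
    unfolding bounded_clinear_def
  proof (intro conjI allI Gc bounded_linear_intro)
    show "?G (x + y) = ?G x + ?G y" for x y
      using clinear_op_shifted(1,2)[OF A Gd[of x] Gd[of y]] SG by (intro GI) auto
    show "?G (r *\<^sub>R x) = r *\<^sub>R ?G x" for r x
      by (simp add: scaleR_scaleC Gc)
    show "norm (?G x) \<le> norm x * C" for x using bd[of x] by (simp add: mult.commute)
  qed
  then show z: "z \<in> resolvent_set A"
    unfolding resolvent_set_def bij_betw_def using inj im by simp
  show "norm (resolvent z A) \<le> C"
    using C bd \<open>bounded_clinear ?G\<close>
    by (intro norm_cblinfun_bound) (auto simp: resolvent_def CBlinfun_inverse)
qed

lemma resolvent_identity:
  assumes A: "clinear_op A" and z: "z \<in> resolvent_set A" and w: "w \<in> resolvent_set A"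
  shows "resolvent z A - resolvent w A = (w - z) *\<^sub>C (resolvent z A o\<^sub>C resolvent w A)"
proof -
  have "cblinfun_apply (resolvent z A - resolvent w A) y =
      cblinfun_apply ((w - z) *\<^sub>C (resolvent z A o\<^sub>C resolvent w A)) y" for y
  proof -
    let ?x = "cblinfun_apply (resolvent w A) y"
    have x: "?x \<in> dom A" "shifted_op w A ?x = y" using resolvent_set_surj[OF w] by auto
    have "?x = cblinfun_apply (resolvent z A) (shifted_op z A ?x)"
      using resolvent_set_inj[OF z x(1)] by simp
    also have "shifted_op z A ?x = y + (z - w) *\<^sub>C ?x"
      using clinear_op_shifted(5)[OF A x(1), of z w] x(2) by simp
    also have "cblinfun_apply (resolvent z A) (y + (z - w) *\<^sub>C ?x)
        = cblinfun_apply (resolvent z A) y + (z - w) *\<^sub>C cblinfun_apply (resolvent z A) ?x"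
      by (simp add: linear_add[OF bounded_linear.linear[OF bounded_linear_cblinfun_apply]]
          cblinfun_apply_scaleC)
    finally have "cblinfun_apply (resolvent z A) y =
        ?x - (z - w) *\<^sub>C cblinfun_apply (resolvent z A) ?x"
      by (metis eq_diff_eq)
    then have "cblinfun_apply (resolvent z A) y - ?x
        = (w - z) *\<^sub>C cblinfun_apply (resolvent z A) ?x"
      using scaleC_minus_left[of "z - w" "cblinfun_apply (resolvent z A) ?x"] by simp
    then show ?thesis
      by (simp only: minus_cblinfun.rep_eq scaleC_cblinfun.rep_eq cblinfun_comp.rep_eq)
  qed
  then show ?thesis by (intro cblinfun_apply_inject[THEN iffD1] ext)
qed

text \<open>
  The equation \<open>(w - A) x = y\<close> is the fixed point equation \<open>x = R(z) y + (z - w) R(z) x\<close>, which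
  is a contraction as long as \<open>w\<close> is closer to \<open>z\<close> than the inverse of the norm of \<open>R(z)\<close>.
\<close>

lemma resolvent_set_near:
  assumes A: "clinear_op A" and z: "z \<in> resolvent_set A"
    and q: "cmod (w - z) * norm (resolvent z A) < 1"
  shows "w \<in> resolvent_set A"
    and "norm (resolvent w A) \<le> norm (resolvent z A) / (1 - cmod (w - z) * norm (resolvent z A))"
proof -
  let ?R = "resolvent z A" and ?q = "cmod (w - z) * norm (resolvent z A)"
  have below: "norm x \<le> norm ?R / (1 - ?q) * norm (shifted_op w A x)" if x: "x \<in> dom A" for x
  proof -
    have "norm (shifted_op z A x) \<le> norm (shifted_op w A x) + cmod (w - z) * norm x"
      using clinear_op_shifted(5)[OF A x, of z w] norm_triangle_ineq[of "shifted_op w A x" "(z - w) *\<^sub>C x"]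
      by (simp add: norm_minus_commute)
    then have "norm ?R * norm (shifted_op z A x) \<le>
        norm ?R * (norm (shifted_op w A x) + cmod (w - z) * norm x)"
      by (intro mult_left_mono) auto
    then have "norm x \<le> norm ?R * norm (shifted_op w A x) + ?q * norm x"
      using resolvent_set_bound[OF z x] by (simp add: algebra_simps)
    then have "norm x * (1 - ?q) \<le> norm ?R * norm (shifted_op w A x)"
      by (simp add: algebra_simps)
    then show ?thesis using q by (simp add: pos_le_divide_eq)
  qed
  have surj: "\<exists>x\<in>dom A. shifted_op w A x = y" for y
  proof -
    let ?E = "\<lambda>x. (z - w) *\<^sub>C cblinfun_apply ?R x"
    have "linear ?E"
      by (intro bounded_linear.linear bounded_linear_compose[OF bounded_linear_scaleC]
          bounded_linear_cblinfun_apply)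
    moreover have "norm (?E x) \<le> ?q * norm x" for x
      using mult_left_mono[OF norm_cblinfun_apply[of ?R x], of "cmod (w - z)"]
      by (simp add: norm_minus_commute mult.assoc)
    ultimately obtain x where x: "x = cblinfun_apply ?R y + ?E x"
      using fixpoint_contraction q by blast
    have x': "x = cblinfun_apply ?R (y + (z - w) *\<^sub>C x)"
      using x by (simp add: linear_add[OF bounded_linear.linear[OF bounded_linear_cblinfun_apply]]
          cblinfun_apply_scaleC)
    have d: "x \<in> dom A" and "shifted_op z A x = y + (z - w) *\<^sub>C x"
      using resolvent_set_surj[OF z, of "y + (z - w) *\<^sub>C x"] by (simp_all flip: x')
    then have "shifted_op w A x = y"
      using clinear_op_shifted(5)[OF A d, of w z] by (simp add: scaleC_diff_left)
    with d show ?thesis by blast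
  qed
  note * = resolvent_setI[OF A _ below surj]
  show "w \<in> resolvent_set A" "norm (resolvent w A) \<le> norm ?R / (1 - ?q)"
    using q * by auto
qed

lemma open_resolvent_set:
  assumes A: "clinear_op A"
  shows "open (resolvent_set A)"
  unfolding open_contains_ball
proof
  fix z assume z: "z \<in> resolvent_set A"
  let ?d = "1 / (norm (resolvent z A) + 1)"
  have "w \<in> resolvent_set A" if "w \<in> ball z ?d" for w
  proof (rule resolvent_set_near(1)[OF A z])
    have "cmod (w - z) < 1 / (norm (resolvent z A) + 1)"
      using that by (simp add: dist_norm norm_minus_commute)
    then have "cmod (w - z) * (norm (resolvent z A) + 1) < 1"
      by (simp add: pos_less_divide_eq add_nonneg_pos)
    moreover have "cmod (w - z) * norm (resolvent z A) \<le> cmod (w - z) * (norm (resolvent z A) + 1)"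
      by (intro mult_left_mono) auto
    ultimately show "cmod (w - z) * norm (resolvent z A) < 1" by linarith
  qed
  moreover have "?d > 0" by (simp add: add_nonneg_pos)
  ultimately show "\<exists>e>0. ball z e \<subseteq> resolvent_set A" by blast
qed

lemma continuous_on_resolvent:
  assumes A: "clinear_op A"
  shows "continuous_on (resolvent_set A) (\<lambda>z. resolvent z A)"
  unfolding continuous_on_def
proof
  fix z assume z: "z \<in> resolvent_set A"
  let ?B = "norm (resolvent z A)"
  have "((\<lambda>w. ?B / (1 - cmod (w - z) * ?B) * (cmod (w - z) * ?B)) \<longlongrightarrow> ?B / (1 - 0 * ?B) * (0 * ?B))
      (at z within resolvent_set A)"
    by (intro tendsto_intros) (auto intro!: tendsto_eq_intros)
  then have lim: "((\<lambda>w. ?B / (1 - cmod (w - z) * ?B) * (cmod (w - z) * ?B)) \<longlongrightarrow> 0)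
      (at z within resolvent_set A)" by simp
  have "((\<lambda>w. cmod (w - z) * ?B) \<longlongrightarrow> 0) (at z within resolvent_set A)"
    by (auto intro!: tendsto_eq_intros)
  then have ev: "\<forall>\<^sub>F w in at z within resolvent_set A. cmod (w - z) * ?B < 1"
    by (rule order_tendstoD) simp
  have "\<forall>\<^sub>F w in at z within resolvent_set A.
      norm (resolvent w A - resolvent z A) \<le> ?B / (1 - cmod (w - z) * ?B) * (cmod (w - z) * ?B)"
    using ev
  proof eventually_elim
    case (elim w)
    note r = resolvent_set_near[OF A z elim]
    have "norm (resolvent w A - resolvent z A) \<le> cmod (z - w) * (norm (resolvent w A) * ?B)"
      unfolding resolvent_identity[OF A r(1) z] norm_scaleC
      by (intro mult_left_mono norm_cblinfun_comp) simp
    also have "\<dots> \<le> cmod (z - w) * (?B / (1 - cmod (w - z) * ?B) * ?B)"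
      using r(2) by (intro mult_left_mono mult_right_mono) auto
    finally show ?case by (simp add: norm_minus_commute mult_ac)
  qed
  then have "((\<lambda>w. resolvent w A - resolvent z A) \<longlongrightarrow> 0) (at z within resolvent_set A)"
    by (rule Lim_null_comparison) (rule lim)
  then show "((\<lambda>w. resolvent w A) \<longlongrightarrow> resolvent z A) (at z within resolvent_set A)"
    by (rule LIM_zero_cancel)
qed

lemma continuous_on_resolvent_comp:
  assumes "clinear_op A" "continuous_on S f" "\<And>x. x \<in> S \<Longrightarrow> f x \<in> resolvent_set A"
  shows "continuous_on S (\<lambda>x. resolvent (f x) A)"
  by (rule continuous_on_compose2[OF continuous_on_resolvent[OF assms(1)] assms(2)])
    (use assms(3) in blast)



lemma has_vector_derivative_quotient:
  fixes f :: "real \<Rightarrow> 'a::real_normed_vector"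
  shows "(f has_vector_derivative D) (at x within S) \<longleftrightarrow>
    ((\<lambda>y. (f y - f x) /\<^sub>R (y - x)) \<longlongrightarrow> D) (at x within S)"
proof -
  have "(f has_vector_derivative D) (at x within S) \<longleftrightarrow>
      ((\<lambda>y. norm ((f y - f x - (y - x) *\<^sub>R D) /\<^sub>R norm (y - x))) \<longlongrightarrow> 0) (at x within S)"
    unfolding has_vector_derivative_def has_derivative_at_within tendsto_norm_zero_iff
    by (simp add: bounded_linear_scaleR_left)
  also have "\<dots> \<longleftrightarrow> ((\<lambda>y. norm ((f y - f x) /\<^sub>R (y - x) - D)) \<longlongrightarrow> 0) (at x within S)"
  proof (rule filterlim_cong[OF refl refl])
    show "\<forall>\<^sub>F y in at x within S. norm ((f y - f x - (y - x) *\<^sub>R D) /\<^sub>R norm (y - x))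
        = norm ((f y - f x) /\<^sub>R (y - x) - D)"
      using eventually_neq_at_within[of x]
    proof eventually_elim
      case (elim y)
      then have "(f y - f x) /\<^sub>R (y - x) - D = (f y - f x - (y - x) *\<^sub>R D) /\<^sub>R (y - x)"
        by (simp add: scaleR_diff_right)
      then show ?case by simp
    qed
  qed
  also have "\<dots> \<longleftrightarrow> ((\<lambda>y. (f y - f x) /\<^sub>R (y - x)) \<longlongrightarrow> D) (at x within S)"
    by (simp only: tendsto_norm_zero_iff LIM_zero_iff)
  finally show ?thesis .
qed

text \<open>
  The resolvent is holomorphic with derivative \<open>- R\<^sup>2\<close>; only its restrictions to vertical and
  horizontal lines are used, so the statement is about real derivatives along a line with
  direction \<open>v\<close>.
\<close>

lemma resolvent_line_derivative:
  assumes A: "clinear_op A" and z: "z + of_real t * v \<in> resolvent_set A"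
  shows "((\<lambda>s. resolvent (z + of_real s * v) A) has_vector_derivative
    (- v) *\<^sub>C (resolvent (z + of_real t * v) A o\<^sub>C resolvent (z + of_real t * v) A)) (at t)"
proof -
  let ?p = "\<lambda>s::real. z + of_real s * v"
  let ?R = "\<lambda>s. resolvent (?p s) A"
  have cp: "continuous_on S ?p" for S by (intro continuous_intros)
  have op: "open (?p -` resolvent_set A)"
    by (rule open_vimage[OF open_resolvent_set[OF A] cp])
  have ev: "\<forall>\<^sub>F s in at t. ?p s \<in> resolvent_set A"
    using eventually_at_in_open'[OF op, of t] z by simp
  have c: "(?R \<longlongrightarrow> ?R t) (at t)"
  proof -
    have "continuous_on (?p -` resolvent_set A) ?R"
      by (rule continuous_on_resolvent_comp[OF A cp]) simp
    moreover have "t \<in> ?p -` resolvent_set A" using z by simp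
    ultimately have "isCont ?R t" using op by (metis continuous_on_eq_continuous_at)
    then show ?thesis by (simp add: isCont_def)
  qed
  have "((\<lambda>s. (- v) *\<^sub>C (?R s o\<^sub>C ?R t)) \<longlongrightarrow> (- v) *\<^sub>C (?R t o\<^sub>C ?R t)) (at t)"
    by (intro tendsto_scaleC tendsto_const bounded_bilinear.tendsto[OF bounded_bilinear_cblinfun_comp] c)
  then have "((\<lambda>s. (?R s - ?R t) /\<^sub>R (s - t)) \<longlongrightarrow> (- v) *\<^sub>C (?R t o\<^sub>C ?R t)) (at t)"
  proof (rule Lim_transform_eventually)
    show "\<forall>\<^sub>F s in at t. (- v) *\<^sub>C (?R s o\<^sub>C ?R t) = (?R s - ?R t) /\<^sub>R (s - t)"
      using ev eventually_neq_at_within[of t]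
    proof eventually_elim
      case (elim s)
      have e: "?p t - ?p s = of_real (s - t) * (- v)" by (simp add: algebra_simps)
      have "?R s - ?R t = (s - t) *\<^sub>R (- v) *\<^sub>C (?R s o\<^sub>C ?R t)"
        unfolding resolvent_identity[OF A elim(1) z] e scaleR_scaleC scaleC_scaleC ..
      then show ?case using elim(2) by simp
    qed
  qed
  then show ?thesis by (simp only: has_vector_derivative_quotient)
qed

lemma resolvent_derivative_Re:
  assumes "clinear_op A" "of_real \<beta> + \<i> * of_real \<xi> \<in> resolvent_set A"
  shows "((\<lambda>s. resolvent (of_real s + \<i> * of_real \<xi>) A) has_vector_derivative
    - (resolvent (of_real \<beta> + \<i> * of_real \<xi>) A o\<^sub>C resolvent (of_real \<beta> + \<i> * of_real \<xi>) A)) (at \<beta>)"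
  using resolvent_line_derivative[of A "\<i> * of_real \<xi>" \<beta> 1] assms
  by (simp add: add.commute scaleC_minus_left)

lemma resolvent_derivative_Im:
  assumes "clinear_op A" "of_real \<beta> + \<i> * of_real \<xi> \<in> resolvent_set A"
  shows "((\<lambda>s. resolvent (of_real \<beta> + \<i> * of_real s) A) has_vector_derivative (- \<i>) *\<^sub>C
    (resolvent (of_real \<beta> + \<i> * of_real \<xi>) A o\<^sub>C resolvent (of_real \<beta> + \<i> * of_real \<xi>) A)) (at \<xi>)"
  using resolvent_line_derivative[of A "of_real \<beta>" \<xi> \<i>] assms
  by (simp add: mult.commute)

section \<open>The resolvent of the generator of a bounded semigroup\<close>

locale bounded_C0_semigroup =
  fixes T :: "real \<Rightarrow> ('a::complex_banach, 'a) cblinfun" and M :: real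
  assumes C0: "C0_semigroup T"
    and bound: "\<And>t. 0 \<le> t \<Longrightarrow> norm (T t) \<le> M"
begin

abbreviation S :: "real \<Rightarrow> 'a \<Rightarrow> 'a" where "S t \<equiv> cblinfun_apply (T t)"

lemma S_0 [simp]: "S 0 x = x"
  and S_add: "0 \<le> s \<Longrightarrow> 0 \<le> t \<Longrightarrow> S (s + t) x = S s (S t x)"
  and S_right: "((\<lambda>t. S t x) \<longlongrightarrow> x) (at_right 0)"
  using C0 unfolding C0_semigroup_def by auto

lemma M_nonneg: "0 \<le> M"
  using bound[of 0] norm_ge_zero[of "T 0"] by linarith

lemma S_bound: "0 \<le> t \<Longrightarrow> norm (S t x) \<le> M * norm x"
  by (rule order_trans[OF norm_cblinfun_apply mult_right_mono[OF bound]]) auto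

lemma S_linear: "linear (S t)"
  by (rule bounded_linear.linear[OF bounded_linear_cblinfun_apply])

lemma S_increment:
  assumes "0 \<le> s" "s \<le> t"
  shows "norm (S t x - S s x) \<le> M * norm (S (t - s) x - x)"
proof -
  have "S t x - S s x = S s (S (t - s) x - x)"
    using S_add[of s "t - s" x] assms by (simp add: linear_diff[OF S_linear])
  then show ?thesis using S_bound assms by simp
qed

text \<open>
  Right continuity at \<open>0\<close> and boundedness give uniform continuity, because
  \<open>S(t) x - S(s) x = S(s) (S(t - s) x - x)\<close> for \<open>s \<le> t\<close>.
\<close>

lemma continuous_on_orbit: "continuous_on {0..} (\<lambda>t. S t x)"
  unfolding continuous_on_iff
proof (intro ballI allI impI)
  fix t e :: real assume t: "t \<in> {0..}" and e: "0 < e"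
  have "0 < e / (M + 1)" using e M_nonneg by simp
  then have "\<forall>\<^sub>F h in at_right 0. dist (S h x) x < e / (M + 1)"
    using S_right tendstoD by blast
  then obtain d where d: "d > 0" "\<And>h. 0 < h \<Longrightarrow> h < d \<Longrightarrow> norm (S h x - x) < e / (M + 1)"
    unfolding eventually_at_right_field by (auto simp: dist_norm)
  have inc: "norm (S u x - S s x) < e" if "0 \<le> s" "s \<le> u" "u - s < d" for s u
  proof (cases "s = u")
    case False
    have "norm (S u x - S s x) \<le> M * norm (S (u - s) x - x)" by (rule S_increment[OF that(1,2)])
    also have "\<dots> \<le> M * (e / (M + 1))"
      using d(2)[of "u - s"] False that M_nonneg by (intro mult_left_mono) auto
    also have "\<dots> < e" using e M_nonneg by (simp add: field_simps)
    finally show ?thesis .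
  qed (use e in simp)
  show "\<exists>d>0. \<forall>s\<in>{0..}. dist s t < d \<longrightarrow> dist (S s x) (S t x) < e"
  proof (intro exI[of _ d] conjI ballI impI)
    fix s assume "s \<in> {0..}" "dist s t < d"
    then show "dist (S s x) (S t x) < e"
      using inc[of s t] inc[of t s] t
      by (cases "s \<le> t") (auto simp: dist_norm norm_minus_commute)
  qed (rule d)
qed

lemma generator_tendsto:
  assumes "x \<in> dom (generator T)"
  shows "((\<lambda>h. (S h x - x) /\<^sub>R h) \<longlongrightarrow> the (generator T x)) (at_right 0)"
proof -
  have ex: "\<exists>y. ((\<lambda>h. (S h x - x) /\<^sub>R h) \<longlongrightarrow> y) (at_right 0)"
    using assms unfolding generator_def Let_def dom_def by (auto split: if_splits)
  then obtain y where y: "((\<lambda>h. (S h x - x) /\<^sub>R h) \<longlongrightarrow> y) (at_right 0)" by blast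
  have "the (generator T x) = y"
    unfolding generator_def Let_def using ex tendsto_Lim[OF _ y] by simp
  with y show ?thesis by simp
qed

lemma generatorI:
  assumes "((\<lambda>h. (S h x - x) /\<^sub>R h) \<longlongrightarrow> y) (at_right 0)"
  shows "x \<in> dom (generator T)" "the (generator T x) = y"
  unfolding generator_def Let_def dom_def using assms tendsto_Lim[OF _ assms] by auto

lemma clinear_op_generator: "clinear_op (generator T)"
  unfolding clinear_op_def
proof (intro conjI ballI allI)
  fix x y assume xy: "x \<in> dom (generator T)" "y \<in> dom (generator T)"
  have "((\<lambda>h. (S h (x + y) - (x + y)) /\<^sub>R h) \<longlongrightarrow> the (generator T x) + the (generator T y)) (at_right 0)"
    using tendsto_add[OF generator_tendsto[OF xy(1)] generator_tendsto[OF xy(2)]]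
    by (simp add: linear_add[OF S_linear] scaleR_add_right scaleR_diff_right algebra_simps)
  then show "x + y \<in> dom (generator T)" "the (generator T (x + y)) = the (generator T x) + the (generator T y)"
    by (rule generatorI)+
next
  fix x c assume x: "x \<in> dom (generator T)"
  have "((\<lambda>h. c *\<^sub>C ((S h x - x) /\<^sub>R h)) \<longlongrightarrow> c *\<^sub>C the (generator T x)) (at_right 0)"
    by (rule tendsto_scaleC[OF tendsto_const generator_tendsto[OF x]])
  then have "((\<lambda>h. (S h (c *\<^sub>C x) - c *\<^sub>C x) /\<^sub>R h) \<longlongrightarrow> c *\<^sub>C the (generator T x)) (at_right 0)"
    by (simp add: cblinfun_apply_scaleC scaleR_scaleC scaleC_scaleC scaleC_diff_right mult.commute)
  then show "c *\<^sub>C x \<in> dom (generator T)" "the (generator T (c *\<^sub>C x)) = c *\<^sub>C the (generator T x)"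
    by (rule generatorI)+
qed

definition laplace :: "complex \<Rightarrow> real \<Rightarrow> 'a \<Rightarrow> 'a" where
  "laplace z N y = integral {0..N} (\<lambda>t. exp (- (z * of_real t)) *\<^sub>C S t y)"

lemma continuous_on_laplace_integrand:
  "I \<subseteq> {0..} \<Longrightarrow> continuous_on I (\<lambda>t. exp (- (z * of_real t)) *\<^sub>C S t y)"
  by (intro continuous_intros continuous_on_subset[OF continuous_on_orbit])

lemma laplace_integrable:
  "0 \<le> a \<Longrightarrow> (\<lambda>t. exp (- (z * of_real t)) *\<^sub>C S t y) integrable_on {a..N}"
  by (intro integrable_continuous_interval continuous_on_laplace_integrand) auto

lemma laplace_linear:
  "laplace z N (x + y) = laplace z N x + laplace z N y"
  "laplace z N (c *\<^sub>C x) = c *\<^sub>C laplace z N x"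
proof -
  show "laplace z N (x + y) = laplace z N x + laplace z N y"
    unfolding laplace_def using integral_add[OF laplace_integrable[of 0 z x N] laplace_integrable[of 0 z y N]]
    by (simp add: linear_add[OF S_linear] scaleC_add_right)
  show "laplace z N (c *\<^sub>C x) = c *\<^sub>C laplace z N x"
    unfolding laplace_def
    using integral_linear[OF laplace_integrable[of 0 z x N] bounded_linear_scaleC[of c]]
    by (simp add: o_def cblinfun_apply_scaleC scaleC_scaleC mult.commute)
qed

lemma laplace_bound:
  assumes z: "0 < Re z" and N: "0 \<le> N"
  shows "norm (laplace z N y) \<le> M / Re z * norm y"
proof -
  have fund: "((\<lambda>t. exp (- (Re z * t)) * (M * norm y)) has_integral
      (- exp (- (Re z * N)) / Re z * (M * norm y) - - exp (- (Re z * 0)) / Re z * (M * norm y))) {0..N}"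
    using z by (intro fundamental_theorem_of_calculus N)
      (auto simp flip: has_real_derivative_iff_has_vector_derivative intro!: derivative_eq_intros)
  have "norm (laplace z N y) \<le> integral {0..N} (\<lambda>t. exp (- (Re z * t)) * (M * norm y))"
    unfolding laplace_def using fund
    by (intro integral_norm_bound_integral laplace_integrable)
      (auto intro!: mult_left_mono S_bound)
  also have "\<dots> = (1 - exp (- (Re z * N))) / Re z * (M * norm y)"
    using integral_unique[OF fund] z by (simp add: field_simps)
  also have "\<dots> \<le> 1 / Re z * (M * norm y)"
    using z M_nonneg by (intro mult_right_mono divide_right_mono) auto
  finally show ?thesis by simp
qed

lemma laplace_bounded_linear:
  assumes "0 < Re z" "0 \<le> N"
  shows "bounded_linear (laplace z N)"
  by (rule bounded_linear_intro[where K = "M / Re z"])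
    (use laplace_bound[OF assms] in \<open>auto simp: laplace_linear scaleR_scaleC mult.commute\<close>)

lemma laplace_commute:
  assumes "0 \<le> h"
  shows "S h (laplace z N y) = laplace z N (S h y)"
proof -
  have "S h (laplace z N y) = integral {0..N} (S h \<circ> (\<lambda>t. exp (- (z * of_real t)) *\<^sub>C S t y))"
    unfolding laplace_def
    by (rule integral_linear[OF laplace_integrable bounded_linear_cblinfun_apply, symmetric]) simp
  also have "\<dots> = laplace z N (S h y)"
    unfolding laplace_def
    by (rule integral_cong)
      (use S_add assms in \<open>auto simp: cblinfun_apply_scaleC simp flip: S_add, simp add: add.commute\<close>)
  finally show ?thesis .
qed

lemma laplace_shift:
  assumes h: "0 \<le> h" and N: "0 \<le> N"
  shows "S h (laplace z N y) = exp (z * of_real h) *\<^sub>C (laplace z (N + h) y - laplace z h y)"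
proof -
  let ?u = "\<lambda>t. exp (- (z * of_real t)) *\<^sub>C S t y"
  have "S h (laplace z N y) = integral {0..N} (S h \<circ> ?u)"
    unfolding laplace_def
    by (rule integral_linear[OF laplace_integrable bounded_linear_cblinfun_apply, symmetric]) simp
  also have "\<dots> = integral {0..N} (\<lambda>t. exp (z * of_real h) *\<^sub>C (?u \<circ> (+) h) t)"
  proof (rule integral_cong)
    fix t assume "t \<in> {0..N}"
    then show "(S h \<circ> ?u) t = exp (z * of_real h) *\<^sub>C (?u \<circ> (+) h) t"
      using S_add[OF h, of t y]
      by (simp add: cblinfun_apply_scaleC scaleC_scaleC ring_distribs flip: exp_add)
  qed
  also have "\<dots> = integral {0..N} ((\<lambda>x. exp (z * of_real h) *\<^sub>C x) \<circ> (?u \<circ> (+) h))"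
    by (simp add: o_def)
  also have "\<dots> = exp (z * of_real h) *\<^sub>C integral {0..N} (?u \<circ> (+) h)"
  proof (rule integral_linear[OF _ bounded_linear_scaleC])
    show "(?u \<circ> (+) h) integrable_on {0..N}"
      using laplace_integrable[OF h, of z y "N + h"] has_integral_shift_Icc_real[of ?u h _ 0 N]
      unfolding integrable_on_def by simp
  qed
  also have "integral {0..N} (?u \<circ> (+) h) = integral {h..N + h} ?u"
    using integral_shift_Icc_real[of 0 N ?u h] by simp
  also have "\<dots> = laplace z (N + h) y - laplace z h y"
    unfolding laplace_def
    using Henstock_Kurzweil_Integration.integral_combine[of 0 h "N + h" ?u] h N laplace_integrable[of 0 z y "N + h"]
    by (simp add: algebra_simps)
  finally show ?thesis .
qed

text \<open>
  Truncating the Laplace transform of the orbits at time \<open>N\<close> inverts \<open>z - A\<close> up to the error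
  \<open>exp (- z N) T(N)\<close>, whose norm is small for large \<open>N\<close>.
\<close>

lemma laplace_generator:
  assumes N: "0 \<le> N"
  shows "laplace z N y \<in> dom (generator T)"
    and "shifted_op z (generator T) (laplace z N y) = y - exp (- (z * of_real N)) *\<^sub>C S N y"
proof -
  let ?u = "\<lambda>t. exp (- (z * of_real t)) *\<^sub>C S t y"
  let ?U = "\<lambda>t. laplace z t y"
  let ?V = "\<lambda>h. ?U (N + h) - ?U h"
  let ?W = "\<lambda>h. exp (z * of_real h) *\<^sub>C ?V h"
  have dU: "(?U has_vector_derivative ?u t) (at t within {0..N + 1})" if "t \<in> {0..N + 1}" for t
    unfolding laplace_def
    by (rule integral_has_vector_derivative[OF continuous_on_laplace_integrand that]) auto
  have d0: "(?U has_vector_derivative y) (at 0 within {0..1})"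
    using has_vector_derivative_within_subset[OF dU[of 0], of "{0..1}"] N by simp
  have "(?U has_vector_derivative ?u N) (at (N + 0) within (+) N ` {0..1})"
    using has_vector_derivative_within_subset[OF dU[of N], of "{N..N + 1}"] N
    by (simp add: add.commute)
  moreover have "((+) N has_vector_derivative 1) (at 0 within {0..1})"
    by (auto intro!: derivative_eq_intros)
  ultimately have dN: "((\<lambda>h. ?U (N + h)) has_vector_derivative ?u N) (at 0 within {0..1})"
    using vector_diff_chain_within[of "(+) N" 1 0 "{0..1}" ?U "?u N"] by (simp add: o_def)
  have "((\<lambda>h. exp (z * of_real h)) has_vector_derivative z) (at 0 within {0..1})"
    by (rule has_vector_derivative_real_field) (auto intro!: derivative_eq_intros)
  then have "(?W has_vector_derivative exp (z * of_real 0) *\<^sub>C (?u N - y) + z *\<^sub>C ?V 0) (at 0 within {0..1})"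
    by (rule bounded_bilinear.has_vector_derivative[OF bounded_bilinear_scaleC])
      (rule has_vector_derivative_diff[OF dN d0])
  then have W: "((\<lambda>h. (?W h - ?W 0) /\<^sub>R (h - 0)) \<longlongrightarrow> ?u N - y + z *\<^sub>C ?U N) (at_right 0)"
    unfolding has_vector_derivative_quotient
    by (simp add: at_within_Icc_at_right laplace_def)
  have "((\<lambda>h. (S h (?U N) - ?U N) /\<^sub>R h) \<longlongrightarrow> ?u N - y + z *\<^sub>C ?U N) (at_right 0)"
  proof (rule Lim_transform_eventually[OF W])
    show "\<forall>\<^sub>F h in at_right 0. (?W h - ?W 0) /\<^sub>R (h - 0) = (S h (?U N) - ?U N) /\<^sub>R h"
      using eventually_at_right_less[of 0]
      by eventually_elim (use N in \<open>simp add: laplace_shift, simp add: laplace_def\<close>)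
  qed
  note g = generatorI[OF this]
  show "laplace z N y \<in> dom (generator T)"
    and "shifted_op z (generator T) (laplace z N y) = y - exp (- (z * of_real N)) *\<^sub>C S N y"
    using g by (auto simp: shifted_op_def)
qed

text \<open>
  The truncated Laplace transform is bounded and commutes with the semigroup, so it commutes with
  the difference quotients defining the generator and hence with the generator itself.
\<close>

lemma laplace_shifted_op:
  assumes z: "0 < Re z" and N: "0 \<le> N" and x: "x \<in> dom (generator T)"
  shows "laplace z N (shifted_op z (generator T) x) = x - exp (- (z * of_real N)) *\<^sub>C S N x"
proof -
  let ?A = "generator T" and ?L = "laplace z N"
  note bl = laplace_bounded_linear[OF z N]
  have "((\<lambda>h. ?L ((S h x - x) /\<^sub>R h)) \<longlongrightarrow> ?L (the (?A x))) (at_right 0)"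
    by (rule bounded_linear.tendsto[OF bl generator_tendsto[OF x]])
  then have "((\<lambda>h. (S h (?L x) - ?L x) /\<^sub>R h) \<longlongrightarrow> ?L (the (?A x))) (at_right 0)"
  proof (rule Lim_transform_eventually)
    show "\<forall>\<^sub>F h in at_right 0. ?L ((S h x - x) /\<^sub>R h) = (S h (?L x) - ?L x) /\<^sub>R h"
      using eventually_at_right_less[of 0]
      by eventually_elim (simp add: laplace_commute linear_scale[OF bounded_linear.linear[OF bl]]
          linear_diff[OF bounded_linear.linear[OF bl]])
  qed
  then have "the (?A (?L x)) = ?L (the (?A x))" by (rule generatorI)
  then have "?L (shifted_op z ?A x) = shifted_op z ?A (?L x)"
    by (simp add: shifted_op_def linear_diff[OF bounded_linear.linear[OF bl]] laplace_linear)
  then show ?thesis using laplace_generator(2)[OF N] by simp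
qed

lemma exp_semigroup_bound:
  assumes "0 \<le> N"
  shows "norm (exp (- (z * of_real N)) *\<^sub>C S N x) \<le> exp (- (Re z * N)) * M * norm x"
  using mult_left_mono[OF S_bound[OF assms, of x], of "exp (- (Re z * N))"] by (simp add: mult.assoc)

lemma exp_semigroup_small:
  assumes "0 < Re z"
  shows "((\<lambda>N. exp (- (Re z * N)) * M) \<longlongrightarrow> 0) at_top"
  using assms by real_asymp

text \<open>
  Letting \<open>N \<rightarrow> \<infinity>\<close> in the truncated identities bounds \<open>z - A\<close> from below by \<open>Re z / M\<close>.  For
  surjectivity a single \<open>N\<close> suffices: as soon as \<open>exp (- N Re z) M < 1\<close>, the error term is a
  contraction and can be inverted.
\<close>

lemma half_plane_resolvent:
  assumes z: "0 < Re z"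
  shows "z \<in> resolvent_set (generator T)"
    and "norm (resolvent z (generator T)) \<le> M / Re z"
proof -
  let ?A = "generator T"
  have below: "norm x \<le> M / Re z * norm (shifted_op z ?A x)" if x: "x \<in> dom ?A" for x
  proof (rule tendsto_lowerbound)
    show "((\<lambda>N. M / Re z * norm (shifted_op z ?A x) + exp (- (Re z * N)) * M * norm x)
        \<longlongrightarrow> M / Re z * norm (shifted_op z ?A x)) at_top"
      using tendsto_add[OF tendsto_const tendsto_mult_right[OF exp_semigroup_small[OF z]]]
      by (simp add: mult.assoc)
    show "\<forall>\<^sub>F N in at_top. norm x \<le> M / Re z * norm (shifted_op z ?A x) + exp (- (Re z * N)) * M * norm x"
      using eventually_ge_at_top[of 0]
    proof eventually_elim
      case (elim N)
      have "x = laplace z N (shifted_op z ?A x) + exp (- (z * of_real N)) *\<^sub>C S N x"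
        using laplace_shifted_op[OF z elim x] by simp
      then have "norm x \<le> norm (laplace z N (shifted_op z ?A x)) + norm (exp (- (z * of_real N)) *\<^sub>C S N x)"
        by (metis norm_triangle_ineq)
      then show ?case
        using laplace_bound[OF z elim, of "shifted_op z ?A x"] exp_semigroup_bound[OF elim, of z x]
        by linarith
    qed
  qed simp
  have surj: "\<exists>x\<in>dom ?A. shifted_op z ?A x = y" for y
  proof -
    have "\<forall>\<^sub>F N in at_top. exp (- (Re z * N)) * M < 1"
      using exp_semigroup_small[OF z] by (rule order_tendstoD) simp
    then obtain N where N: "0 \<le> N" "exp (- (Re z * N)) * M < 1"
      by (metis eventually_at_top_linorder linorder_linear)
    have "linear (\<lambda>x. exp (- (z * of_real N)) *\<^sub>C S N x)"
      by (intro bounded_linear.linear bounded_linear_compose[OF bounded_linear_scaleC]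
          bounded_linear_cblinfun_apply)
    then obtain w where w: "w = y + exp (- (z * of_real N)) *\<^sub>C S N w"
      by (rule fixpoint_contraction[OF _ N(2) exp_semigroup_bound[OF N(1)]])
    then have "w - exp (- (z * of_real N)) *\<^sub>C S N w = y" by (metis add_diff_cancel_right')
    then show ?thesis using laplace_generator[OF N(1), of z w] by auto
  qed
  have "0 \<le> M / Re z" using M_nonneg z by simp
  note * = resolvent_setI[OF clinear_op_generator this below surj]
  show "z \<in> resolvent_set ?A" "norm (resolvent z ?A) \<le> M / Re z" using * by auto
qed

end

section \<open>Test functions\<close>

text \<open>
  Smoothness is established by exhibiting a candidate \<open>F n\<close> for the derivative of every order.
\<close>

lemma smooth_funI:
  assumes "\<And>n t. (F n has_vector_derivative F (Suc n) t) (at t)"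
  shows "smooth_fun (F 0)" "iter_vderiv n (F 0) = F n"
proof -
  have *: "iter_vderiv n (F 0) = F n" for n
    by (induction n) (simp_all add: vector_derivative_at[OF assms])
  show "smooth_fun (F 0)"
    unfolding smooth_fun_def * using assms differentiableI_vector by blast
  show "iter_vderiv n (F 0) = F n" by (rule *)
qed

lemma iter_vderiv_has_vector_derivative:
  assumes "smooth_fun \<phi>"
  shows "(iter_vderiv n \<phi> has_vector_derivative iter_vderiv (Suc n) \<phi> t) (at t)"
  using assms vector_derivative_works[of "iter_vderiv n \<phi>" "at t"] by (simp add: smooth_fun_def)

lemma continuous_on_iter_vderiv:
  assumes "smooth_fun \<phi>"
  shows "continuous_on I (iter_vderiv n \<phi>)"
  using iter_vderiv_has_vector_derivative[OF assms]
  by (meson continuous_at_imp_continuous_on has_vector_derivative_continuous)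

lemma smooth_fun_iter_vderiv:
  assumes "smooth_fun \<phi>"
  shows "smooth_fun (iter_vderiv k \<phi>)" "iter_vderiv n (iter_vderiv k \<phi>) = iter_vderiv (n + k) \<phi>"
proof -
  let ?F = "\<lambda>n. iter_vderiv (n + k) \<phi>"
  have "(?F n has_vector_derivative ?F (Suc n) t) (at t)" for n t
    using iter_vderiv_has_vector_derivative[OF assms, of "n + k" t] by simp
  from smooth_funI[of ?F, OF this]
  show "smooth_fun (iter_vderiv k \<phi>)" "iter_vderiv n (iter_vderiv k \<phi>) = iter_vderiv (n + k) \<phi>"
    by simp_all
qed

lemma smooth_fun_lincomb:
  fixes \<phi> \<psi> :: "real \<Rightarrow> complex"
  assumes "smooth_fun \<phi>" "smooth_fun \<psi>"
  shows "smooth_fun (\<lambda>t. a * \<phi> t + b * \<psi> t)"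
proof -
  let ?F = "\<lambda>n t. a * iter_vderiv n \<phi> t + b * iter_vderiv n \<psi> t"
  have "(?F n has_vector_derivative ?F (Suc n) t) (at t)" for n t
    by (intro has_vector_derivative_add has_vector_derivative_mult_right
        iter_vderiv_has_vector_derivative assms)
  from smooth_funI(1)[of ?F, OF this] show ?thesis by simp
qed

lemma smooth_fun_rescale:
  assumes "smooth_fun \<phi>"
  shows "smooth_fun (\<lambda>t. \<phi> ((t - c) / a))"
    and "iter_vderiv n (\<lambda>t. \<phi> ((t - c) / a)) = (\<lambda>t. (1 / a) ^ n *\<^sub>R iter_vderiv n \<phi> ((t - c) / a))"
proof -
  let ?F = "\<lambda>n t. (1 / a) ^ n *\<^sub>R iter_vderiv n \<phi> ((t - c) / a)"
  have F: "(?F n has_vector_derivative ?F (Suc n) t) (at t)" for n t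
  proof -
    have "((\<lambda>t. (t - c) / a) has_vector_derivative 1 / a) (at t)"
      by (cases "a = 0") (auto intro!: derivative_eq_intros simp flip: has_real_derivative_iff_has_vector_derivative)
    from vector_diff_chain_at[OF this iter_vderiv_has_vector_derivative[OF assms]]
    have "((\<lambda>t. iter_vderiv n \<phi> ((t - c) / a)) has_vector_derivative
        (1 / a) *\<^sub>R iter_vderiv (Suc n) \<phi> ((t - c) / a)) (at t)"
      by (simp add: o_def)
    from bounded_linear.has_vector_derivative[OF bounded_linear_scaleR_right this, of "(1 / a) ^ n"]
    show ?thesis by simp
  qed
  from smooth_funI[of ?F, OF F] show "smooth_fun (\<lambda>t. \<phi> ((t - c) / a))"
    "iter_vderiv n (\<lambda>t. \<phi> ((t - c) / a)) = (\<lambda>t. (1 / a) ^ n *\<^sub>R iter_vderiv n \<phi> ((t - c) / a))"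
    by simp_all
qed

lemma iter_vderiv_eq_0:
  assumes "t \<notin> fsupport \<phi>"
  shows "iter_vderiv n \<phi> t = 0"
  using assms
proof (induction n arbitrary: t)
  case 0
  then show ?case using closure_subset[of "{t. \<phi> t \<noteq> 0}"] by (auto simp: fsupport_def)
next
  case (Suc n)
  have "((\<lambda>t. 0) has_vector_derivative 0) (at t)" by simp
  moreover have "open (- fsupport \<phi>)" by (simp add: fsupport_def open_Compl)
  ultimately have "(iter_vderiv n \<phi> has_vector_derivative 0) (at t)"
    by (rule has_vector_derivative_transform_within_open[OF _ _ _ Suc.IH[symmetric]])
      (use Suc.prems in simp_all)
  then show ?case by (simp add: vector_derivative_at)
qed

lemma fsupport_subset:
  assumes "closed C" "\<And>t. t \<notin> C \<Longrightarrow> \<phi> t = 0"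
  shows "fsupport \<phi> \<subseteq> C"
  unfolding fsupport_def using assms by (intro closure_minimal) auto

lemma test_funsI:
  assumes "smooth_fun \<phi>" "compact C" "C \<subseteq> I" "\<And>t. t \<notin> C \<Longrightarrow> \<phi> t = 0"
  shows "\<phi> \<in> test_funs I"
proof -
  have "fsupport \<phi> \<subseteq> C" using assms compact_imp_closed by (intro fsupport_subset) auto
  moreover have "compact (fsupport \<phi>)"
    using compact_Int_closed[OF assms(2), of "fsupport \<phi>"] calculation
    by (simp add: fsupport_def inf.absorb2)
  ultimately show ?thesis using assms by (auto simp: test_funs_def)
qed

lemma test_funsD:
  assumes "\<phi> \<in> test_funs I"
  shows "smooth_fun \<phi>" "compact (fsupport \<phi>)" "t \<notin> I \<Longrightarrow> iter_vderiv n \<phi> t = 0"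
    "t \<notin> I \<Longrightarrow> \<phi> t = 0"
proof -
  show "smooth_fun \<phi>" "compact (fsupport \<phi>)" using assms by (simp_all add: test_funs_def)
  have "fsupport \<phi> \<subseteq> I" using assms by (simp add: test_funs_def)
  then show *: "iter_vderiv n \<phi> t = 0" if "t \<notin> I" for n
    using that by (intro iter_vderiv_eq_0) auto
  show "\<phi> t = 0" if "t \<notin> I" using *[OF that, of 0] by simp
qed

lemma test_funs_mono: "I \<subseteq> J \<Longrightarrow> test_funs I \<subseteq> test_funs J"
  by (auto simp: test_funs_def)

lemma test_funs_iter_vderiv:
  assumes "\<phi> \<in> test_funs I"
  shows "iter_vderiv k \<phi> \<in> test_funs I"
proof (rule test_funsI)
  show "smooth_fun (iter_vderiv k \<phi>)" "compact (fsupport \<phi>)" "fsupport \<phi> \<subseteq> I"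
    using assms by (simp_all add: test_funs_def smooth_fun_iter_vderiv(1))
qed (rule iter_vderiv_eq_0)

lemma test_funs_lincomb:
  assumes "\<phi> \<in> test_funs I" "\<psi> \<in> test_funs I"
  shows "(\<lambda>t. a * \<phi> t + b * \<psi> t) \<in> test_funs I"
proof (rule test_funsI[of _ "fsupport \<phi> \<union> fsupport \<psi>"])
  show "a * \<phi> t + b * \<psi> t = 0" if "t \<notin> fsupport \<phi> \<union> fsupport \<psi>" for t
    using that iter_vderiv_eq_0[of t \<phi> 0] iter_vderiv_eq_0[of t \<psi> 0] by simp
qed (use assms in \<open>simp_all add: test_funs_def smooth_fun_lincomb compact_Un\<close>)

lemma continuous_on_test_fun:
  assumes "\<phi> \<in> test_funs I"
  shows "continuous_on J \<phi>"
  using continuous_on_iter_vderiv[OF test_funsD(1)[OF assms], of J 0] by simp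

lemma test_fun_bounded:
  assumes "\<phi> \<in> test_funs I"
  obtains B where "0 \<le> B" "\<And>t. cmod (\<phi> t) \<le> B"
proof -
  have "compact (\<phi> ` fsupport \<phi>)"
    by (intro compact_continuous_image continuous_on_test_fun[OF assms] test_funsD(2)[OF assms])
  then obtain B where B: "\<And>t. t \<in> fsupport \<phi> \<Longrightarrow> cmod (\<phi> t) \<le> B"
    using compact_imp_bounded bounded_iff by (metis imageI)
  have "cmod (\<phi> t) \<le> max B 0" for t
    using B[of t] iter_vderiv_eq_0[of t \<phi> 0] by (cases "t \<in> fsupport \<phi>") auto
  then show ?thesis using that[of "max B 0"] by simp
qed

lemma integral_UNIV_eq:
  fixes f :: "real \<Rightarrow> 'b::banach"
  assumes "\<And>t. t \<notin> C \<Longrightarrow> f t = 0"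
  shows "integral UNIV f = integral C f"
  by (subst integral_restrict_UNIV[symmetric]) (rule integral_cong, use assms in auto)

lemma test_fun_integral_by_parts:
  fixes prod :: "complex \<Rightarrow> 'b::real_normed_vector \<Rightarrow> 'c::banach"
  assumes bl: "bounded_bilinear prod"
    and \<phi>: "\<phi> \<in> test_funs {a<..<b}"
    and F: "\<And>t. t \<in> {a..b} \<Longrightarrow> (F has_vector_derivative F' t) (at t)"
    and F': "continuous_on {a..b} F'"
  shows "integral {a..b} (\<lambda>t. prod (iter_vderiv 1 \<phi> t) (F t)) = - integral {a..b} (\<lambda>t. prod (\<phi> t) (F' t))"
proof (cases "a \<le> b")
  case True
  let ?G = "\<lambda>t. prod (\<phi> t) (F' t)"
  have G: "(?G has_integral integral {a..b} ?G) {a..b}"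
    by (intro integrable_integral integrable_continuous_interval F' bounded_bilinear.continuous_on[OF bl]
        continuous_on_test_fun[OF \<phi>])
  have "continuous_on {a..b} F"
    using F by (meson continuous_at_imp_continuous_on has_vector_derivative_continuous)
  then have "((\<lambda>t. prod (iter_vderiv 1 \<phi> t) (F t)) has_integral - integral {a..b} ?G) {a..b}"
    by (rule integration_by_parts[OF bl True continuous_on_test_fun[OF \<phi>] _ _ F])
      (use G iter_vderiv_has_vector_derivative[OF test_funsD(1)[OF \<phi>], of 0] test_funsD(4)[OF \<phi>]
        in \<open>auto simp: bounded_bilinear.zero_left[OF bl]\<close>)
  then show ?thesis by (rule integral_unique)
qed simp

text \<open>
  With \<open>s = 1 / (1 - t\<^sup>2)\<close> the functions \<open>p(t) s\<^sup>k exp (- s)\<close>, \<open>p\<close> a polynomial, extended by zero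
  outside \<open>(-1, 1)\<close>, form a class that is closed under differentiation; at the two end points they
  vanish to every order since \<open>exp (- s)\<close> beats every power of \<open>s\<close>.  The function with \<open>p = 1\<close> and
  \<open>k = 0\<close> is the standard bump function.
\<close>

definition bump :: "real poly \<Rightarrow> nat \<Rightarrow> real \<Rightarrow> real" where
  "bump p k t = (if \<bar>t\<bar> < 1 then poly p t * (1 / (1 - t\<^sup>2)) ^ k * exp (- (1 / (1 - t\<^sup>2))) else 0)"

definition bump_deriv :: "real poly \<Rightarrow> nat \<Rightarrow> real poly" where
  "bump_deriv p k = [:1, 0, -1:]\<^sup>2 * pderiv p + [:0, 2 * of_nat k:] * [:1, 0, -1:] * p - [:0, 2:] * p"

lemma power_times_exp_minus_le:
  fixes s :: real
  assumes "0 \<le> s"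
  shows "s ^ m * exp (- s) \<le> fact m"
proof -
  have "(\<lambda>n. s ^ n /\<^sub>R fact n) sums exp s" by (rule exp_converges)
  then have "(\<Sum>n\<in>{m}. s ^ n /\<^sub>R fact n) \<le> exp s"
    using assms by (intro sum_le_suminf[of _ "{m}", THEN order_trans]) (auto simp: sums_iff)
  then have "s ^ m \<le> exp s * fact m" by (simp add: field_simps)
  then show ?thesis by (simp add: exp_minus field_simps)
qed

lemma bump_quadratic_bound:
  obtains C where "\<And>t t0. \<bar>t0\<bar> = 1 \<Longrightarrow> \<bar>bump p k t\<bar> \<le> C * (t - t0)\<^sup>2"
proof -
  have "compact (poly p ` {-1..1})" by (intro compact_continuous_image continuous_intros) auto
  then obtain B where B': "\<And>t. t \<in> {-1..1} \<Longrightarrow> \<bar>poly p t\<bar> \<le> B"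
    using compact_imp_bounded bounded_iff by (metis imageI real_norm_def)
  then have B: "\<bar>poly p t\<bar> \<le> B" if "\<bar>t\<bar> < 1" for t
    using that B'[of t] by (simp add: abs_less_iff)
  have B0: "0 \<le> B" using B[of 0] by auto
  have "\<bar>bump p k t\<bar> \<le> (B * fact (k + 2) * 4) * (t - t0)\<^sup>2" if t0: "\<bar>t0\<bar> = 1" for t t0
  proof (cases "\<bar>t\<bar> < 1")
    case True
    define s where "s = 1 / (1 - t\<^sup>2)"
    have t2: "t\<^sup>2 < 1" using True by (simp add: abs_square_less_1)
    then have s: "0 < s" by (simp add: s_def)
    have "s ^ k * exp (- s) = s ^ (k + 2) * exp (- s) * (1 - t\<^sup>2)\<^sup>2"
      using t2 by (simp add: s_def power_add power_divide power2_eq_square)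
    also have "\<dots> \<le> fact (k + 2) * (1 - t\<^sup>2)\<^sup>2"
      using power_times_exp_minus_le[of s "k + 2"] s by (intro mult_right_mono) auto
    also have "(1 - t\<^sup>2)\<^sup>2 = (t0 + t)\<^sup>2 * (t - t0)\<^sup>2"
    proof -
      have "t0\<^sup>2 = 1" using t0 by (simp add: abs_square_eq_1)
      then have "1 - t\<^sup>2 = (t0 + t) * (t0 - t)" by (simp add: algebra_simps power2_eq_square)
      then show ?thesis by (simp add: power_mult_distrib power2_commute)
    qed
    also have "fact (k + 2) * ((t0 + t)\<^sup>2 * (t - t0)\<^sup>2) \<le> fact (k + 2) * (4 * (t - t0)\<^sup>2)"
    proof -
      have "\<bar>t0 + t\<bar> \<le> 2" using t0 True by linarith
      then have "(t0 + t)\<^sup>2 \<le> 2\<^sup>2" using power_mono[of "\<bar>t0 + t\<bar>" 2 2] by simp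
      then show ?thesis by (intro mult_left_mono mult_right_mono) auto
    qed
    finally have e: "s ^ k * exp (- s) \<le> fact (k + 2) * 4 * (t - t0)\<^sup>2" by simp
    have "\<bar>bump p k t\<bar> = \<bar>poly p t\<bar> * (s ^ k * exp (- s))"
      using True s by (simp add: bump_def s_def abs_mult)
    also have "\<dots> \<le> B * (fact (k + 2) * 4 * (t - t0)\<^sup>2)"
      by (rule mult_mono[OF B[OF True] e B0]) (use s in auto)
    finally show ?thesis by (simp add: mult.assoc)
  qed (use B0 in \<open>simp add: bump_def\<close>)
  then show ?thesis by (rule that)
qed

lemma bump_has_derivative:
  "(bump p k has_real_derivative bump (bump_deriv p k) (k + 2) t) (at t)"
proof -
  consider "\<bar>t\<bar> < 1" | "\<bar>t\<bar> = 1" | "\<bar>t\<bar> > 1" by linarith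
  then show ?thesis
  proof cases
    case 1
    define s where "s = (\<lambda>t::real. 1 / (1 - t\<^sup>2))"
    let ?q = "1 - t\<^sup>2"
    have q: "?q > 0" using 1 by (simp add: abs_square_less_1)
    have ds: "(s has_real_derivative 2 * t * s t ^ 2) (at t)"
      unfolding s_def using q by (auto intro!: derivative_eq_intros simp: power2_eq_square)
    have sq: "?q * s t = 1" using q by (simp add: s_def)
    have "((\<lambda>t. poly p t * s t ^ k * exp (- s t)) has_real_derivative
        poly (bump_deriv p k) t * s t ^ (k + 2) * exp (- s t)) (at t)"
    proof -
      have "((\<lambda>t. poly p t * s t ^ k * exp (- s t)) has_real_derivative
          (poly (pderiv p) t * s t ^ k + poly p t * (of_nat k * s t ^ (k - 1) * (2 * t * s t ^ 2))
            - poly p t * s t ^ k * (2 * t * s t ^ 2)) * exp (- s t)) (at t)"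
        by (auto intro!: derivative_eq_intros ds poly_DERIV simp: algebra_simps)
      moreover have "poly (pderiv p) t * s t ^ k + poly p t * (of_nat k * s t ^ (k - 1) * (2 * t * s t ^ 2))
            - poly p t * s t ^ k * (2 * t * s t ^ 2) = poly (bump_deriv p k) t * s t ^ (k + 2)"
      proof -
        have "?q\<^sup>2 * s t ^ 2 = 1" by (metis power_mult_distrib power_one sq)
        then have 1: "s t ^ k = ?q\<^sup>2 * s t ^ (k + 2)"
          by (simp only: power_add mult.left_commute[of _ "s t ^ k"] mult_1_right)
        have 2: "of_nat k * s t ^ (k - 1) * s t ^ 2 = of_nat k * ?q * s t ^ (k + 2)"
        proof (cases k)
          case (Suc j)
          have "s t ^ (k + 2) = s t ^ (k - 1) * s t ^ 2 * s t" using Suc by (simp add: power2_eq_square)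
          then have "?q * s t ^ (k + 2) = s t ^ (k - 1) * s t ^ 2 * (?q * s t)"
            by (simp only: mult_ac)
          then show ?thesis by (simp only: sq mult_1_right mult.assoc)
        qed simp
        have "poly (bump_deriv p k) t = ?q\<^sup>2 * poly (pderiv p) t + 2 * of_nat k * t * ?q * poly p t
            - 2 * t * poly p t"
          by (simp add: bump_deriv_def power2_eq_square algebra_simps)
        then have "poly (bump_deriv p k) t * w = poly (pderiv p) t * (?q\<^sup>2 * w)
            + poly p t * 2 * t * (of_nat k * ?q * w) - poly p t * (2 * t * w)" for w
          by (simp only: left_diff_distrib distrib_right right_diff_distrib distrib_left mult_ac)
        then have "poly (bump_deriv p k) t * s t ^ (k + 2) = poly (pderiv p) t * (?q\<^sup>2 * s t ^ (k + 2))
            + poly p t * 2 * t * (of_nat k * ?q * s t ^ (k + 2)) - poly p t * (2 * t * s t ^ (k + 2))" .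
        also have "\<dots> = poly (pderiv p) t * s t ^ k
            + poly p t * (of_nat k * s t ^ (k - 1) * (2 * t * s t ^ 2))
            - poly p t * s t ^ k * (2 * t * s t ^ 2)"
          unfolding 1[symmetric] 2[symmetric] by (simp add: power_add power2_eq_square algebra_simps)
        finally show ?thesis by simp
      qed
      ultimately show ?thesis by simp
    qed
    then have "((\<lambda>t. poly p t * s t ^ k * exp (- s t)) has_real_derivative
        bump (bump_deriv p k) (k + 2) t) (at t)"
      using 1 by (simp add: bump_def s_def)
    then show ?thesis
      by (rule DERIV_cong_ev[THEN iffD1, rotated -1, OF _ refl _ refl])
        (use 1 eventually_nhds_in_open[of "{-1<..<1}" t] in
          \<open>auto simp: bump_def s_def abs_less_iff elim!: eventually_mono\<close>)
  next
    case 2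
    obtain C where C: "\<And>u. \<bar>bump p k u\<bar> \<le> C * (u - t)\<^sup>2"
      using bump_quadratic_bound[of p k] 2 by metis
    have "((\<lambda>u. (bump p k u - bump p k t) / (u - t)) \<longlongrightarrow> 0) (at t)"
    proof (rule Lim_null_comparison)
      show "((\<lambda>u. C * \<bar>u - t\<bar>) \<longlongrightarrow> 0) (at t)" by (auto intro!: tendsto_eq_intros)
      show "\<forall>\<^sub>F u in at t. norm ((bump p k u - bump p k t) / (u - t)) \<le> C * \<bar>u - t\<bar>"
        using eventually_neq_at_within[of t]
      proof eventually_elim
        case (elim u)
        have "\<bar>bump p k u\<bar> \<le> C * \<bar>u - t\<bar> * \<bar>u - t\<bar>"
          using C[of u] by (simp add: power2_eq_square mult.assoc flip: abs_mult)
        then show ?case using elim 2 by (simp add: bump_def[of _ _ t] pos_divide_le_eq)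
      qed
    qed
    then show ?thesis using 2 by (simp add: has_field_derivative_iff bump_def[of "bump_deriv p k"])
  next
    case 3
    have "((\<lambda>t. 0) has_real_derivative bump (bump_deriv p k) (k + 2) t) (at t)"
      using 3 by (simp add: bump_def)
    then show ?thesis
      by (rule DERIV_cong_ev[THEN iffD1, rotated -1, OF _ refl _ refl])
        (use 3 eventually_nhds_in_open[of "- {-1..1}" t] in
          \<open>auto simp: bump_def abs_less_iff abs_if open_Compl elim!: eventually_mono split: if_splits\<close>)
  qed
qed

text \<open>
  The bump has support \<open>[-1, 1]\<close>, a compact subset of \<open>(-2, 2)\<close>, and on \<open>[-1/2, 1/2]\<close> its exponent
  \<open>- 1 / (1 - t\<^sup>2)\<close> is at least \<open>-2\<close>.
\<close>

lemma nonneg_test_fun: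
  obtains \<phi> c where "\<phi> \<in> test_funs {-2<..<2}" "0 < c"
    "\<And>t. \<phi> t = of_real (Re (\<phi> t))" "\<And>t. 0 \<le> Re (\<phi> t)" "\<And>t. \<bar>t\<bar> \<le> 1/2 \<Longrightarrow> c \<le> Re (\<phi> t)"
proof -
  \<comment> \<open>The function \<open>bump (P n) (2 * n)\<close> is the derivative of order \<open>n\<close> of the bump.\<close>
  define P where "P = rec_nat 1 (\<lambda>n p. bump_deriv p (2 * n))"
  let ?F = "\<lambda>n t. complex_of_real (bump (P n) (2 * n) t)"
  have "(?F n has_vector_derivative ?F (Suc n) t) (at t)" for n t
    using bump_has_derivative[of "P n" "2 * n" t]
    by (intro has_vector_derivative_of_real) (simp add: P_def has_real_derivative_iff_has_vector_derivative)
  from smooth_funI(1)[of ?F, OF this] have sm: "smooth_fun (?F 0)" .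
  have F0: "bump (P 0) 0 t = (if \<bar>t\<bar> < 1 then exp (- (1 / (1 - t\<^sup>2))) else 0)" for t
    by (simp add: bump_def P_def)
  show ?thesis
  proof (rule that)
    show "?F 0 \<in> test_funs {-2<..<2}"
      by (rule test_funsI[OF sm, of "{-1..1}"]) (auto simp: bump_def)
    show "(0::real) < exp (-2)" by simp
    show "exp (-2) \<le> Re (?F 0 t)" if "\<bar>t\<bar> \<le> 1/2" for t
    proof -
      have "t\<^sup>2 \<le> (1/2)\<^sup>2" using that by (metis abs_le_square_iff abs_of_nonneg zero_le_divide_1_iff zero_le_numeral)
      then have "1 / (1 - t\<^sup>2) \<le> 2" by (simp add: power2_eq_square field_simps)
      then show ?thesis using that by (simp add: F0)
    qed
  qed (simp_all add: F0)
qed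

lemma rescale_test_fun:
  assumes \<phi>: "\<phi> \<in> test_funs {-r<..<r}" and a: "0 < a"
  shows "(\<lambda>\<xi>. \<phi> ((\<xi> - c) / a)) \<in> test_funs {c - r * a<..<c + r * a}"
proof (rule test_funsI)
  show "smooth_fun (\<lambda>\<xi>. \<phi> ((\<xi> - c) / a))" by (rule smooth_fun_rescale(1)[OF test_funsD(1)[OF \<phi>]])
  show "compact ((\<lambda>t. c + a * t) ` fsupport \<phi>)"
    by (intro compact_continuous_image continuous_intros test_funsD(2)[OF \<phi>])
  have "fsupport \<phi> \<subseteq> {-r<..<r}" using \<phi> by (simp add: test_funs_def)
  moreover have "- r * a < a * t" "a * t < r * a" if "- r < t" "t < r" for t
    using that a mult_strict_left_mono[of "- r" t a] mult_strict_left_mono[of t r a]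
    by (simp_all add: mult.commute)
  ultimately show "(\<lambda>t. c + a * t) ` fsupport \<phi> \<subseteq> {c - r * a<..<c + r * a}" by fastforce
  fix \<xi> assume "\<xi> \<notin> (\<lambda>t. c + a * t) ` fsupport \<phi>"
  moreover have "\<xi> = c + a * ((\<xi> - c) / a)" using a by simp
  ultimately have "(\<xi> - c) / a \<notin> fsupport \<phi>" by blast
  then show "\<phi> ((\<xi> - c) / a) = 0" using iter_vderiv_eq_0[of _ \<phi> 0] by simp
qed

section \<open>The boundary value of the resolvent\<close>

text \<open>
  The singularity \<open>s\<^bsup>-1/2\<^esup>\<close> is integrable at zero, with primitive \<open>2 s\<^bsup>1/2\<^esup>\<close>.
\<close>

lemma inverse_sqrt_derivative_convergent:
  fixes f :: "real \<Rightarrow> 'b::banach"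
  assumes f': "\<And>s. 0 < s \<Longrightarrow> s \<le> 1 \<Longrightarrow> (f has_vector_derivative f' s) (at s)"
    and le: "\<And>s. 0 < s \<Longrightarrow> s \<le> 1 \<Longrightarrow> norm (f' s) \<le> C / sqrt s"
  shows "\<exists>L. (f \<longlongrightarrow> L) (at_right 0)"
proof -
  have "norm (f' 1) \<le> C" using le[of 1] by simp
  then have C: "0 \<le> C" using norm_ge_zero order_trans by blast
  have diff: "norm (f y - f x) \<le> 2 * C * sqrt y" if "0 < x" "x \<le> y" "y \<le> 1" for x y
  proof (cases "x = y")
    case False
    have "norm (f y - f x) \<le> 2 * C * sqrt y - 2 * C * sqrt x"
    proof (rule differentiable_bound_general[of x y f "\<lambda>s. 2 * C * sqrt s" f' "\<lambda>s. C / sqrt s"])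
      show "x < y" using False that by simp
      show "continuous_on {x..y} f"
        using that
        by (intro continuous_at_imp_continuous_on ballI has_vector_derivative_continuous[OF f']) auto
      show "((\<lambda>s. 2 * C * sqrt s) has_vector_derivative C / sqrt s) (at s)" if "x < s" for s
        using that \<open>0 < x\<close>
        by (auto intro!: derivative_eq_intros simp flip: has_real_derivative_iff_has_vector_derivative
            simp: field_simps)
    qed (use f' le that in \<open>auto intro!: continuous_intros\<close>)
    moreover have "0 \<le> 2 * C * sqrt x" using C that by simp
    ultimately show ?thesis by linarith
  qed (use C that in simp)
  define X where "X n = f (inverse (real (Suc n)))" for n
  have lim: "(\<lambda>n. 2 * C * sqrt (inverse (real (Suc n)))) \<longlonglongrightarrow> 0"
    using tendsto_mult_left[OF tendsto_real_sqrt[OF LIMSEQ_inverse_real_of_nat], of "2 * C"] by simp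
  have "Cauchy X"
  proof (rule CauchyI)
    fix e :: real assume "0 < e"
    then obtain N where N: "2 * C * sqrt (inverse (real (Suc N))) < e / 2"
      using order_tendstoD(2)[OF lim, of "e / 2"] by (auto simp: eventually_sequentially)
    have X: "norm (X N - X n) < e / 2" if "N \<le> n" for n
    proof -
      have "norm (X N - X n) \<le> 2 * C * sqrt (inverse (real (Suc N)))"
        unfolding X_def by (rule diff) (use that in \<open>auto simp: field_simps\<close>)
      then show ?thesis using N by simp
    qed
    have "norm (X m - X n) < e" if "N \<le> m" "N \<le> n" for m n
      using norm_triangle_ineq4[of "X N - X n" "X N - X m"] X[of m] X[of n] that by simp
    then show "\<exists>N. \<forall>m\<ge>N. \<forall>n\<ge>N. norm (X m - X n) < e" by blast
  qed
  then obtain L where L: "X \<longlonglongrightarrow> L" using Cauchy_convergent_iff convergent_def by blast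
  have "norm (f s - L) \<le> 2 * C * sqrt s" if s: "0 < s" "s \<le> 1" for s
  proof (rule tendsto_upperbound)
    show "(\<lambda>n. norm (f s - X n)) \<longlonglongrightarrow> norm (f s - L)" by (intro tendsto_intros L)
    have "\<forall>\<^sub>F n in sequentially. inverse (real (Suc n)) < s"
      using order_tendstoD(2)[OF LIMSEQ_inverse_real_of_nat s(1)] .
    then show "\<forall>\<^sub>F n in sequentially. norm (f s - X n) \<le> 2 * C * sqrt s"
      by eventually_elim (use s in \<open>simp add: X_def diff\<close>)
  qed simp
  then have ev: "\<forall>\<^sub>F s in at_right 0. norm (f s - L) \<le> 2 * C * sqrt s"
    unfolding eventually_at_right_field by (intro exI[of _ 1]) auto
  have "((\<lambda>s. 2 * C * sqrt s) \<longlongrightarrow> 2 * C * sqrt 0) (at_right 0)" by (intro tendsto_intros)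
  then have "((\<lambda>s. 2 * C * sqrt s) \<longlongrightarrow> 0) (at_right 0)" by simp
  with ev have "((\<lambda>s. f s - L) \<longlongrightarrow> 0) (at_right 0)" by (rule Lim_null_comparison)
  then show ?thesis using LIM_zero_cancel by blast
qed

context bounded_C0_semigroup begin

abbreviation R :: "real \<Rightarrow> real \<Rightarrow> ('a, 'a) cblinfun" where
  "R \<beta> \<xi> \<equiv> resolvent (of_real \<beta> + \<i> * of_real \<xi>) (generator T)"

lemma R_resolvent_set: "0 < \<beta> \<Longrightarrow> of_real \<beta> + \<i> * of_real \<xi> \<in> resolvent_set (generator T)"
  by (rule half_plane_resolvent) simp

lemma R_norm: "0 < \<beta> \<Longrightarrow> norm (R \<beta> \<xi>) \<le> M / \<beta>"
  using half_plane_resolvent(2)[of "of_real \<beta> + \<i> * of_real \<xi>"] by simp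

lemma continuous_on_R:
  assumes "continuous_on U f" "continuous_on U h" "\<And>x. x \<in> U \<Longrightarrow> 0 < f x"
  shows "continuous_on U (\<lambda>x. R (f x) (h x))"
  by (rule continuous_on_resolvent_comp[OF clinear_op_generator])
    (use assms R_resolvent_set in \<open>auto intro!: continuous_intros\<close>)

lemmas R_derivative_Re = resolvent_derivative_Re[OF clinear_op_generator R_resolvent_set]
lemmas R_derivative_Im = resolvent_derivative_Im[OF clinear_op_generator R_resolvent_set]

text \<open>
  The pairing \<open>J(\<beta>, \<phi>)\<close> of \<open>\<phi>\<close> with the resolvent on the line \<open>Re \<lambda> = \<beta>\<close>, whose limit as
  \<open>\<beta> \<rightarrow> 0\<close> is the boundary value.
\<close>

definition approx_bv :: "(real \<Rightarrow> complex) \<Rightarrow> real \<Rightarrow> ('a, 'a) cblinfun" where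
  "approx_bv \<phi> \<beta> = integral UNIV (\<lambda>\<xi>. \<phi> \<xi> *\<^sub>C R \<beta> \<xi>)"

lemma approx_bv_eq:
  assumes "\<phi> \<in> test_funs {a<..<b}"
  shows "approx_bv \<phi> \<beta> = integral {a..b} (\<lambda>\<xi>. \<phi> \<xi> *\<^sub>C R \<beta> \<xi>)"
  unfolding approx_bv_def
proof (rule integral_UNIV_eq)
  fix t assume "t \<notin> {a..b}"
  then have "t \<notin> {a<..<b}" by auto
  then show "\<phi> t *\<^sub>C R \<beta> t = 0" by (simp add: test_funsD(4)[OF assms])
qed

lemma approx_bv_bound:
  assumes \<phi>: "\<phi> \<in> test_funs {a<..<b}"
  obtains K where "0 \<le> K" "\<And>\<beta>. 0 < \<beta> \<Longrightarrow> norm (approx_bv \<phi> \<beta>) \<le> K / \<beta>"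
proof -
  obtain B where B: "0 \<le> B" "\<And>t. cmod (\<phi> t) \<le> B" using test_fun_bounded[OF \<phi>] by blast
  have "norm (approx_bv \<phi> \<beta>) \<le> B * M * measure lborel {a..b} / \<beta>" if \<beta>: "0 < \<beta>" for \<beta>
  proof -
    have "norm (integral {a..b} (\<lambda>\<xi>. \<phi> \<xi> *\<^sub>C R \<beta> \<xi>)) \<le> integral {a..b} (\<lambda>\<xi>. B * (M / \<beta>))"
    proof (rule integral_norm_bound_integral)
      show "(\<lambda>\<xi>. \<phi> \<xi> *\<^sub>C R \<beta> \<xi>) integrable_on {a..b}"
        by (intro integrable_continuous_interval continuous_intros continuous_on_test_fun[OF \<phi>]
            continuous_on_R \<beta>)
      show "norm (\<phi> \<xi> *\<^sub>C R \<beta> \<xi>) \<le> B * (M / \<beta>)" for \<xi>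
        using mult_mono[OF B(2) R_norm[OF \<beta>]] B(1) by simp
    qed (rule integrable_const_ivl)
    then show ?thesis unfolding approx_bv_eq[OF \<phi>] by (simp add: field_simps)
  qed
  then show ?thesis using that[of "B * M * measure lborel {a..b}"] B M_nonneg by simp
qed

text \<open>
  By the Cauchy-Riemann equations the derivative in \<open>\<beta>\<close> is \<open>- i\<close> times the derivative in \<open>\<xi>\<close>, which
  integration by parts moves onto the test function.
\<close>

lemma approx_bv_has_derivative:
  assumes \<phi>: "\<phi> \<in> test_funs {a<..<b}" and \<beta>: "0 < \<beta>"
  shows "(approx_bv \<phi> has_vector_derivative \<i> *\<^sub>C approx_bv (iter_vderiv 1 \<phi>) \<beta>) (at \<beta>)"
proof -
  let ?D = "\<lambda>\<beta> \<xi>. \<phi> \<xi> *\<^sub>C - (R \<beta> \<xi> o\<^sub>C R \<beta> \<xi>)"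
  have "((\<lambda>\<beta>. integral (cbox a b) (\<lambda>\<xi>. \<phi> \<xi> *\<^sub>C R \<beta> \<xi>)) has_vector_derivative
      integral (cbox a b) (?D \<beta>)) (at \<beta> within {0<..})"
  proof (rule leibniz_rule_vector_derivative)
    fix s t :: real assume "s \<in> {0<..}" "t \<in> cbox a b"
    then show "((\<lambda>s. \<phi> t *\<^sub>C R s t) has_vector_derivative ?D s t) (at s within {0<..})"
      by (intro bounded_linear.has_vector_derivative[OF bounded_linear_scaleC]
          has_vector_derivative_at_within[OF R_derivative_Re]) simp
  next
    fix s :: real assume "s \<in> {0<..}"
    then show "(\<lambda>\<xi>. \<phi> \<xi> *\<^sub>C R s \<xi>) integrable_on cbox a b"
      unfolding cbox_interval
      by (intro integrable_continuous_interval continuous_intros continuous_on_test_fun[OF \<phi>]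
          continuous_on_R) simp
  next
    show "continuous_on ({0<..} \<times> cbox a b) (\<lambda>(s, t). ?D s t)"
      unfolding split_def
      by (intro continuous_intros continuous_on_R
          continuous_on_compose2[OF continuous_on_test_fun[OF \<phi>, of UNIV]]) auto
  qed (use \<beta> in auto)
  moreover have "integral {a..b} (?D \<beta>) = \<i> *\<^sub>C approx_bv (iter_vderiv 1 \<phi>) \<beta>"
  proof -
    let ?S = "\<lambda>\<xi>. \<phi> \<xi> *\<^sub>C ((- \<i>) *\<^sub>C (R \<beta> \<xi> o\<^sub>C R \<beta> \<xi>))"
    have "approx_bv (iter_vderiv 1 \<phi>) \<beta> = - integral {a..b} ?S"
      unfolding approx_bv_eq[OF test_funs_iter_vderiv[OF \<phi>]]
      by (rule test_fun_integral_by_parts[OF bounded_bilinear_scaleC \<phi> R_derivative_Im[OF \<beta>]])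
        (intro continuous_intros continuous_on_R \<beta>)
    then have "\<i> *\<^sub>C approx_bv (iter_vderiv 1 \<phi>) \<beta> = \<i> *\<^sub>C - integral {a..b} ?S"
      by (rule arg_cong)
    also have "\<dots> = integral {a..b} (\<lambda>\<xi>. (- \<i>) *\<^sub>C ?S \<xi>)"
    proof -
      have "?S integrable_on {a..b}"
        by (intro integrable_continuous_interval continuous_intros continuous_on_R
            continuous_on_test_fun[OF \<phi>] \<beta>)
      from integral_linear[OF this bounded_linear_scaleC[of "- \<i>"]] show ?thesis
        by (simp add: o_def scaleC_minus_left scaleC_minus_right)
    qed
    also have "\<dots> = integral {a..b} (?D \<beta>)"
    proof (rule integral_cong)
      fix \<xi>
      have "- \<i> * (\<phi> \<xi> * - \<i>) = - \<phi> \<xi>"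
        using mult.left_commute[of \<i> "\<phi> \<xi>" \<i>] by simp
      then have "(- \<i>) *\<^sub>C ?S \<xi> = (- \<phi> \<xi>) *\<^sub>C (R \<beta> \<xi> o\<^sub>C R \<beta> \<xi>)"
        by (simp only: scaleC_scaleC)
      then show "(- \<i>) *\<^sub>C ?S \<xi> = ?D \<beta> \<xi>"
        by (simp only: scaleC_minus_left scaleC_minus_right)
    qed
    finally show ?thesis by (rule sym)
  qed
  ultimately show ?thesis
    using \<beta> by (simp add: approx_bv_eq[OF \<phi>, abs_def] at_within_open[of \<beta> "{0<..}"])
qed

text \<open>
  The estimate \<open>\<parallel>R(\<beta> + i \<xi>)\<parallel> \<le> M / \<beta>\<close> alone leaves a factor \<open>1 / \<beta>\<close> for every test function.  As the
  derivative in \<open>\<beta>\<close> is again a pairing with a test function, one integration improves this to an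
  integrable singularity, and a second one gives convergence.
\<close>

lemma approx_bv_tendsto:
  assumes \<phi>: "\<phi> \<in> test_funs {a<..<b}"
  shows "(approx_bv \<phi> \<longlongrightarrow> resolvent_bv (generator T) \<phi>) (at_right 0)"
proof -
  let ?\<phi>1 = "iter_vderiv 1 \<phi>" and ?\<phi>2 = "iter_vderiv 1 (iter_vderiv 1 \<phi>)"
  have \<phi>1: "?\<phi>1 \<in> test_funs {a<..<b}" by (rule test_funs_iter_vderiv[OF \<phi>])
  have \<phi>2: "?\<phi>2 \<in> test_funs {a<..<b}" by (rule test_funs_iter_vderiv[OF \<phi>1])
  obtain K where K: "0 \<le> K" "\<And>\<beta>. 0 < \<beta> \<Longrightarrow> norm (approx_bv ?\<phi>2 \<beta>) \<le> K / \<beta>"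
    using approx_bv_bound[OF \<phi>2] by blast
  have le: "norm (approx_bv ?\<phi>1 \<beta>) \<le> (norm (approx_bv ?\<phi>1 1) + 2 * K) / sqrt \<beta>"
    if \<beta>: "0 < \<beta>" "\<beta> \<le> 1" for \<beta>
  proof -
    have "norm (approx_bv ?\<phi>1 1 - approx_bv ?\<phi>1 \<beta>) \<le> 2 * K / sqrt \<beta>"
    proof (cases "\<beta> = 1")
      case False
      \<comment> \<open>The factor \<open>1 / sqrt s \<ge> 1\<close> is given away to obtain a power as primitive instead of a logarithm.\<close>
      have "norm (approx_bv ?\<phi>1 1 - approx_bv ?\<phi>1 \<beta>) \<le> - 2 * K / sqrt 1 - (- 2 * K / sqrt \<beta>)"
      proof (rule differentiable_bound_general[of \<beta> 1 "approx_bv ?\<phi>1" "\<lambda>s. - 2 * K / sqrt s"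
            "\<lambda>s. \<i> *\<^sub>C approx_bv ?\<phi>2 s" "\<lambda>s. K / (s * sqrt s)"])
        show "\<beta> < 1" using False \<beta> by simp
        show "continuous_on {\<beta>..1} (approx_bv ?\<phi>1)"
          using \<beta> by (intro continuous_at_imp_continuous_on ballI
              has_vector_derivative_continuous[OF approx_bv_has_derivative[OF \<phi>1]]) auto
        show "continuous_on {\<beta>..1} (\<lambda>s. - 2 * K / sqrt s)"
          using \<beta> by (intro continuous_intros) auto
        fix s :: real assume s: "\<beta> < s" "s < 1"
        then have s0: "0 < s" using \<beta> by simp
        show "(approx_bv ?\<phi>1 has_vector_derivative \<i> *\<^sub>C approx_bv ?\<phi>2 s) (at s)"
          using s0 by (rule approx_bv_has_derivative[OF \<phi>1])
        show "((\<lambda>s. - 2 * K / sqrt s) has_vector_derivative K / (s * sqrt s)) (at s)"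
          using s0
          by (auto intro!: derivative_eq_intros simp flip: has_real_derivative_iff_has_vector_derivative
              simp: field_simps)
        have "K / s \<le> K / (s * sqrt s)"
          using s0 s K(1) by (intro divide_left_mono) (auto simp: mult_le_cancel_left1)
        then show "norm (\<i> *\<^sub>C approx_bv ?\<phi>2 s) \<le> K / (s * sqrt s)"
          using K(2)[OF s0] by simp
      qed
      then show ?thesis using K(1) by simp
    qed (use K in simp)
    then have "norm (approx_bv ?\<phi>1 \<beta>) \<le> norm (approx_bv ?\<phi>1 1) + 2 * K / sqrt \<beta>"
      using norm_triangle_sub[of "approx_bv ?\<phi>1 \<beta>" "approx_bv ?\<phi>1 1"]
      by (simp add: norm_minus_commute)
    also have "\<dots> \<le> norm (approx_bv ?\<phi>1 1) / sqrt \<beta> + 2 * K / sqrt \<beta>"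
      using \<beta> by (intro add_right_mono) (simp add: pos_le_divide_eq mult_left_le)
    finally show ?thesis by (simp add: add_divide_distrib)
  qed
  have "\<exists>L. (approx_bv \<phi> \<longlongrightarrow> L) (at_right 0)"
    using approx_bv_has_derivative[OF \<phi>] le
    by (intro inverse_sqrt_derivative_convergent[where f' = "\<lambda>s. \<i> *\<^sub>C approx_bv ?\<phi>1 s"]) auto
  then obtain L where L: "(approx_bv \<phi> \<longlongrightarrow> L) (at_right 0)" by blast
  moreover have "resolvent_bv (generator T) \<phi> = L"
    unfolding resolvent_bv_def using tendsto_Lim[OF _ L] by (simp add: approx_bv_def[abs_def])
  ultimately show ?thesis by simp
qed

end

section \<open>Fourier transforms of test functions\<close>

text \<open>
  A Henstock-Kurzweil integral over the line is the limit of integrals over intervals, so it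
  inherits bounds on these; when the integral does not exist, its value is zero by convention.
\<close>

lemma integral_UNIV_norm_le:
  fixes f :: "real \<Rightarrow> 'b::banach"
  assumes "\<And>L. 0 < L \<Longrightarrow> norm (integral {-L..L} f) \<le> K"
  shows "norm (integral UNIV f) \<le> K"
proof (cases "f integrable_on UNIV")
  case True
  show ?thesis
  proof (rule field_le_epsilon)
    fix e :: real assume "0 < e"
    moreover have "(f has_integral integral UNIV f) UNIV" using True by (rule integrable_integral)
    ultimately obtain B where "0 < B"
      and B: "\<And>a b. ball 0 B \<subseteq> cbox a b \<Longrightarrow> norm (integral (cbox a b) f - integral UNIV f) < e"
      unfolding has_integral_alt'[of f] by auto
    have "ball 0 B \<subseteq> cbox (- B) B" by (auto simp: dist_norm)
    from B[OF this] have "norm (integral {-B..B} f - integral UNIV f) < e" by simp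
    then show "norm (integral UNIV f) \<le> K + e"
      using assms[OF \<open>0 < B\<close>] norm_triangle_sub[of "integral UNIV f" "integral {-B..B} f"]
      by (simp add: norm_minus_commute)
  qed
next
  case False
  then show ?thesis using assms[of 1] order_trans[OF norm_ge_zero] by (simp add: not_integrable_integral)
qed

lemma fourier_eq:
  assumes "\<phi> \<in> test_funs {a<..<b}"
  shows "fourier \<phi> t = integral {a..b} (\<lambda>\<xi>. \<phi> \<xi> * exp (- \<i> * of_real t * of_real \<xi>))"
proof -
  have "fourier \<phi> t = integral {a..b} (\<lambda>\<xi>. exp (- \<i> * of_real t * of_real \<xi>) * \<phi> \<xi>)"
    unfolding fourier_def
  proof (rule integral_UNIV_eq)
    fix \<xi> assume "\<xi> \<notin> {a..b}"
    then have "\<xi> \<notin> {a<..<b}" by auto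
    then show "exp (- \<i> * of_real t * of_real \<xi>) * \<phi> \<xi> = 0" by (simp add: test_funsD(4)[OF assms])
  qed
  then show ?thesis by (simp only: mult.commute[of "\<phi> _"])
qed

lemma continuous_on_fourier:
  assumes "\<phi> \<in> test_funs {a<..<b}"
  shows "continuous_on U (fourier \<phi>)"
proof -
  have "continuous_on U (\<lambda>t. integral (cbox a b) (\<lambda>\<xi>. \<phi> \<xi> * exp (- \<i> * of_real t * of_real \<xi>)))"
    by (rule integral_continuous_on_param, unfold split_def)
      (intro continuous_intros continuous_on_compose2[OF continuous_on_test_fun[OF assms, of UNIV]], auto)
  then show ?thesis by (simp add: fourier_eq[OF assms, abs_def])
qed

lemma fourier_derivative:
  assumes "\<phi> \<in> test_funs {a<..<b}"
  shows "fourier (iter_vderiv 1 \<phi>) t = \<i> * of_real t * fourier \<phi> t"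
proof -
  let ?c = "- \<i> * of_real t"
  have "fourier (iter_vderiv 1 \<phi>) t = - integral {a..b} (\<lambda>\<xi>. \<phi> \<xi> * (?c * exp (?c * of_real \<xi>)))"
    unfolding fourier_eq[OF test_funs_iter_vderiv[OF assms]]
  proof (rule test_fun_integral_by_parts[OF bounded_bilinear_mult assms])
    show "((\<lambda>\<xi>. exp (?c * of_real \<xi>)) has_vector_derivative ?c * exp (?c * of_real \<xi>)) (at \<xi>)" for \<xi>
      by (rule has_vector_derivative_real_field) (auto intro!: derivative_eq_intros)
  qed (intro continuous_intros)
  also have "integral {a..b} (\<lambda>\<xi>. \<phi> \<xi> * (?c * exp (?c * of_real \<xi>)))
      = ?c * integral {a..b} (\<lambda>\<xi>. \<phi> \<xi> * exp (?c * of_real \<xi>))"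
    by (subst integral_mult_right[symmetric]) (simp only: mult.left_commute[of ?c])
  finally show ?thesis unfolding fourier_eq[OF assms] by simp
qed

lemma fourier_bound:
  assumes \<phi>: "\<phi> \<in> test_funs {a<..<b}" and ab: "a \<le> b" and B: "\<And>\<xi>. cmod (\<phi> \<xi>) \<le> B"
  shows "cmod (fourier \<phi> t) \<le> B * (b - a)"
proof -
  have "cmod (fourier \<phi> t) \<le> integral {a..b} (\<lambda>\<xi>. B)"
    unfolding fourier_eq[OF \<phi>]
  proof (rule integral_norm_bound_integral)
    show "(\<lambda>\<xi>. \<phi> \<xi> * exp (- \<i> * of_real t * of_real \<xi>)) integrable_on {a..b}"
      by (intro integrable_continuous_interval continuous_intros continuous_on_test_fun[OF \<phi>])
    show "cmod (\<phi> \<xi> * exp (- \<i> * of_real t * of_real \<xi>)) \<le> B" for \<xi>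
      using B by (simp add: norm_mult)
  qed (rule integrable_const_ivl)
  then show ?thesis using ab by (simp add: mult.commute)
qed

lemma fourier_bound_square:
  assumes \<phi>: "\<phi> \<in> test_funs {a<..<b}" and ab: "a \<le> b" and B: "\<And>\<xi>. cmod (iter_vderiv 2 \<phi> \<xi>) \<le> B"
  shows "t\<^sup>2 * cmod (fourier \<phi> t) \<le> B * (b - a)"
proof -
  have "iter_vderiv 2 \<phi> = iter_vderiv 1 (iter_vderiv 1 \<phi>)"
    using smooth_fun_iter_vderiv(2)[OF test_funsD(1)[OF \<phi>], of 1 1] by (simp add: numeral_2_eq_2)
  then have "fourier (iter_vderiv 2 \<phi>) t = \<i> * of_real t * (\<i> * of_real t * fourier \<phi> t)"
    by (simp only: fourier_derivative[OF \<phi>] fourier_derivative[OF test_funs_iter_vderiv[OF \<phi>]])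
  then have "cmod (fourier (iter_vderiv 2 \<phi>) t) = t\<^sup>2 * cmod (fourier \<phi> t)"
    by (simp add: norm_mult power2_eq_square)
  then show ?thesis using fourier_bound[OF test_funs_iter_vderiv[OF \<phi>] ab B, of t] by simp
qed

text \<open>
  A smooth majorant in place of the indicator function of a compact interval: all integrals of
  bounds can then be computed with the arctangent.
\<close>

lemma C0_funs_bound:
  assumes g: "g \<in> C0_funs" and \<epsilon>: "0 < \<epsilon>"
  obtains G where "0 \<le> G" "\<And>t. norm (g t) \<le> \<epsilon> + G / (1 + t\<^sup>2)"
proof -
  have cg: "continuous_on UNIV g" and lim: "(g \<longlongrightarrow> 0) at_infinity"
    using g by (auto simp: C0_funs_def)
  obtain N where N: "\<And>t. N \<le> \<bar>t\<bar> \<Longrightarrow> norm (g t) < \<epsilon>"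
    using tendstoD[OF lim \<epsilon>] unfolding eventually_at_infinity by auto
  have "compact (g ` {-N..N})"
    by (intro compact_continuous_image continuous_on_subset[OF cg]) auto
  then obtain H where H: "\<And>t. t \<in> {-N..N} \<Longrightarrow> norm (g t) \<le> H"
    using compact_imp_bounded bounded_iff by (metis imageI)
  show ?thesis
  proof (rule that)
    show "0 \<le> \<bar>H\<bar> * (1 + N\<^sup>2)" by simp
    fix t
    show "norm (g t) \<le> \<epsilon> + \<bar>H\<bar> * (1 + N\<^sup>2) / (1 + t\<^sup>2)"
    proof (cases "N \<le> \<bar>t\<bar>")
      case True
      then show ?thesis using N[OF True] by (intro add_increasing2) auto
    next
      case False
      then have "t\<^sup>2 \<le> N\<^sup>2" by (intro abs_le_square_iff[THEN iffD1]) auto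
      then have "\<bar>H\<bar> \<le> \<bar>H\<bar> * (1 + N\<^sup>2) / (1 + t\<^sup>2)"
        by (simp add: pos_le_divide_eq add_pos_nonneg mult_left_mono)
      moreover have "norm (g t) \<le> H" using H[of t] False by (simp add: not_le abs_less_iff)
      ultimately show ?thesis using \<epsilon> by linarith
    qed
  qed
qed

text \<open>
  Shrinking the support of a test function to a point spreads out its Fourier transform over the
  whole line, keeping the \<open>L\<^sup>1\<close> norm bounded.  The pairing with a function vanishing at infinity
  therefore tends to zero.  This is where the pseudofunction property is used.
\<close>

lemma regular_distr_rescale_tendsto_0:
  assumes g: "g \<in> C0_funs" and \<phi>: "\<phi> \<in> test_funs {-2<..<2}"
  shows "((\<lambda>a. regular_distr g (fourier (\<lambda>\<xi>. \<phi> ((\<xi> - \<xi>0) / a)))) \<longlongrightarrow> 0) (at_right 0)"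
proof -
  obtain B0 where B0: "0 \<le> B0" "\<And>t. cmod (\<phi> t) \<le> B0" using test_fun_bounded[OF \<phi>] by blast
  obtain B2 where B2: "0 \<le> B2" "\<And>t. cmod (iter_vderiv 2 \<phi> t) \<le> B2"
    using test_fun_bounded[OF test_funs_iter_vderiv[OF \<phi>]] by blast
  define K where "K = 4 * (B0 + B2)"
  have K: "0 \<le> K" using B0 B2 by (simp add: K_def)
  have rescaled: "(\<lambda>\<xi>. \<phi> ((\<xi> - \<xi>0) / a)) \<in> test_funs {\<xi>0 - 2 * a<..<\<xi>0 + 2 * a}" if "0 < a" for a
    by (rule rescale_test_fun[OF \<phi> that])
  have decay: "cmod (fourier (\<lambda>\<xi>. \<phi> ((\<xi> - \<xi>0) / a)) t) \<le> K * (a / (1 + (a * t)\<^sup>2))" if a: "0 < a" for a t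
  proof -
    let ?\<phi> = "\<lambda>\<xi>. \<phi> ((\<xi> - \<xi>0) / a)"
    \<comment> \<open>The support has length \<open>4 a\<close> and the second derivative is of size \<open>a\<^bsup>-2\<^esup>\<close>.\<close>
    have 0: "cmod (fourier ?\<phi> t) \<le> B0 * (4 * a)"
      using fourier_bound[OF rescaled[OF a], of B0 t] a B0 by simp
    have "cmod (iter_vderiv 2 ?\<phi> \<xi>) \<le> B2 / a\<^sup>2" for \<xi>
      using B2(2)[of "(\<xi> - \<xi>0) / a"] a
      by (simp add: smooth_fun_rescale(2)[OF test_funsD(1)[OF \<phi>]] divide_right_mono power_divide)
    then have "t\<^sup>2 * cmod (fourier ?\<phi> t) \<le> B2 / a\<^sup>2 * (4 * a)"
      using fourier_bound_square[OF rescaled[OF a], of "B2 / a\<^sup>2" t] a by simp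
    then have "a\<^sup>2 * (t\<^sup>2 * cmod (fourier ?\<phi> t)) \<le> a\<^sup>2 * (B2 / a\<^sup>2 * (4 * a))"
      by (rule mult_left_mono) simp
    then have "(a * t)\<^sup>2 * cmod (fourier ?\<phi> t) \<le> B2 * (4 * a)"
      using a by (simp add: power_mult_distrib mult.assoc)
    with 0 have "cmod (fourier ?\<phi> t) * (1 + (a * t)\<^sup>2) \<le> K * a"
      by (simp add: K_def algebra_simps)
    then show ?thesis by (simp add: pos_le_divide_eq add_pos_nonneg)
  qed
  have main: "\<exists>D. 0 \<le> D \<and> (\<forall>a>0. norm (regular_distr g (fourier (\<lambda>\<xi>. \<phi> ((\<xi> - \<xi>0) / a)))) \<le> K * pi * \<epsilon> + D * a)"
    if \<epsilon>: "0 < \<epsilon>" for \<epsilon>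
  proof -
    obtain G where G: "0 \<le> G" "\<And>t. norm (g t) \<le> \<epsilon> + G / (1 + t\<^sup>2)" using C0_funs_bound[OF g \<epsilon>] by blast
    have "norm (regular_distr g (fourier (\<lambda>\<xi>. \<phi> ((\<xi> - \<xi>0) / a)))) \<le> K * pi * \<epsilon> + (K * G * pi) * a"
      if a: "0 < a" for a
      unfolding regular_distr_def
    proof (rule integral_UNIV_norm_le)
      fix L :: real assume L: "0 < L"
      let ?f = "fourier (\<lambda>\<xi>. \<phi> ((\<xi> - \<xi>0) / a))"
      let ?h = "\<lambda>t. K * \<epsilon> * (a / (1 + (a * t)\<^sup>2)) + K * G * a * (1 / (1 + t\<^sup>2))"
      let ?H = "\<lambda>t. K * \<epsilon> * arctan (a * t) + K * G * a * arctan t"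
      have h: "(?h has_integral ?H L - ?H (- L)) {-L..L}"
        using L by (intro fundamental_theorem_of_calculus)
          (auto intro!: derivative_eq_intros simp flip: has_real_derivative_iff_has_vector_derivative
            simp: field_simps)
      have split: "K * x * (\<epsilon> + G / y) = K * \<epsilon> * x + K * G * x * (1 / y)" for x y
        by (simp add: distrib_left mult_ac)
      have le: "norm (?f t *\<^sub>C g t) \<le> ?h t" for t
      proof -
        have "norm (?f t *\<^sub>C g t) \<le> K * (a / (1 + (a * t)\<^sup>2)) * (\<epsilon> + G / (1 + t\<^sup>2))"
          unfolding norm_scaleC using decay[OF a] G K a by (intro mult_mono) auto
        also have "\<dots> = K * \<epsilon> * (a / (1 + (a * t)\<^sup>2)) + K * G * (a / (1 + (a * t)\<^sup>2)) * (1 / (1 + t\<^sup>2))"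
          by (rule split)
        also have "\<dots> \<le> K * \<epsilon> * (a / (1 + (a * t)\<^sup>2)) + K * G * a * (1 / (1 + t\<^sup>2))"
          using a K G by (intro add_left_mono mult_right_mono mult_left_mono)
            (auto simp: pos_divide_le_eq add_pos_nonneg mult_le_cancel_left1)
        finally show ?thesis .
      qed
      have cg: "continuous_on UNIV g" using g by (simp add: C0_funs_def)
      have "norm (integral {-L..L} (\<lambda>t. ?f t *\<^sub>C g t)) \<le> integral {-L..L} ?h"
      proof (rule integral_norm_bound_integral[OF _ _ le])
        show "(\<lambda>t. ?f t *\<^sub>C g t) integrable_on {-L..L}"
          by (intro integrable_continuous_interval continuous_on_scaleC
              continuous_on_fourier[OF rescaled[OF a]] continuous_on_subset[OF cg]) auto
      qed (use h in blast)
      also have "\<dots> = K * \<epsilon> * (2 * arctan (a * L)) + K * G * a * (2 * arctan L)"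
        using integral_unique[OF h] by (simp add: arctan_minus algebra_simps)
      also have "\<dots> \<le> K * \<epsilon> * pi + K * G * a * pi"
        using arctan_ubound[of "a * L"] arctan_ubound[of L] K \<epsilon> G a
        by (intro add_mono mult_left_mono) auto
      finally show "norm (integral {-L..L} (\<lambda>t. ?f t *\<^sub>C g t)) \<le> K * pi * \<epsilon> + K * G * pi * a"
        by (simp add: mult_ac)
    qed
    then show ?thesis using K G by (intro exI[of _ "K * G * pi"]) auto
  qed
  show ?thesis
  proof (rule tendstoI)
    fix e :: real assume e: "0 < e"
    define \<epsilon> where "\<epsilon> = e / (2 * (K * pi + 1))"
    have Kp: "0 < K * pi + 1" using K by (simp add: add_nonneg_pos)
    have \<epsilon>: "0 < \<epsilon>" using e Kp by (simp add: \<epsilon>_def)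
    obtain D where D: "0 \<le> D"
      "\<And>a. 0 < a \<Longrightarrow> norm (regular_distr g (fourier (\<lambda>\<xi>. \<phi> ((\<xi> - \<xi>0) / a)))) \<le> K * pi * \<epsilon> + D * a"
      using main[OF \<epsilon>] by blast
    have "K * pi * \<epsilon> < (K * pi + 1) * \<epsilon>" using \<epsilon> by (simp add: algebra_simps)
    also have "P * (e / (2 * P)) = e / 2" if "0 < P" for P using that by simp
    from this[OF Kp] have "(K * pi + 1) * \<epsilon> = e / 2" unfolding \<epsilon>_def .
    finally have 1: "K * pi * \<epsilon> < e / 2" .
    show "\<forall>\<^sub>F a in at_right 0. dist (regular_distr g (fourier (\<lambda>\<xi>. \<phi> ((\<xi> - \<xi>0) / a)))) 0 < e"
      unfolding eventually_at_right_field
    proof (intro exI[of _ "e / (2 * (D + 1))"] conjI allI impI)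
      show "0 < e / (2 * (D + 1))" using e D by simp
      fix a assume a: "0 < a" "a < e / (2 * (D + 1))"
      have "D * a \<le> (D + 1) * a" using a by simp
      also have "\<dots> \<le> e / 2" using a D(1) by (simp add: field_simps)
      finally show "dist (regular_distr g (fourier (\<lambda>\<xi>. \<phi> ((\<xi> - \<xi>0) / a)))) 0 < e"
        using D(2)[OF a(1)] 1 by simp
    qed
  qed
qed

section \<open>Pseudofunction behaviour excludes spectrum\<close>

text \<open>
  The real part of \<open>1 / (b + i (\<xi> - \<xi>\<^sub>0))\<close> is the Poisson kernel \<open>b / (b\<^sup>2 + (\<xi> - \<xi>\<^sub>0)\<^sup>2)\<close>, which is
  at least \<open>1 / (2 b)\<close> on the interval of length \<open>2 b\<close> around \<open>\<xi>\<^sub>0\<close>.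
\<close>

lemma pole_pairing_lower_bound:
  assumes \<phi>: "\<phi> \<in> test_funs {a1<..<b1}" and real: "\<And>\<xi>. \<phi> \<xi> = of_real (Re (\<phi> \<xi>))"
    and nonneg: "\<And>\<xi>. 0 \<le> Re (\<phi> \<xi>)" and b: "0 < b"
    and c: "0 \<le> c" "\<And>\<xi>. \<bar>\<xi> - \<xi>0\<bar> \<le> b \<Longrightarrow> c \<le> Re (\<phi> \<xi>)"
    and sub: "a1 \<le> \<xi>0 - b" "\<xi>0 + b \<le> b1"
  shows "c \<le> cmod (integral {a1..b1} (\<lambda>\<xi>. \<phi> \<xi> / (of_real b + \<i> * of_real (\<xi> - \<xi>0))))"
proof -
  let ?f = "\<lambda>\<xi>. \<phi> \<xi> / (of_real b + \<i> * of_real (\<xi> - \<xi>0))"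
  let ?r = "\<lambda>\<xi>. Re (\<phi> \<xi>) * (b / (b\<^sup>2 + (\<xi> - \<xi>0)\<^sup>2))"
  have nz: "of_real b + \<i> * of_real (\<xi> - \<xi>0) \<noteq> (0::complex)" for \<xi>
    using b by (simp add: complex_eq_iff)
  have int_f: "?f integrable_on {a1..b1}"
    by (intro integrable_continuous_interval continuous_intros continuous_on_test_fun[OF \<phi>] ballI nz)
  have Re_f: "Re (?f \<xi>) = ?r \<xi>" for \<xi>
    using arg_cong[OF real[of \<xi>], of Im] by (simp add: Re_divide)
  have pos: "0 < b\<^sup>2 + (\<xi> - \<xi>0)\<^sup>2" for \<xi> using b by (simp add: add_pos_nonneg)
  have int_r: "?r integrable_on S" if "S = {u..v}" for S u v
    unfolding that using pos
    by (intro integrable_continuous_interval continuous_intros continuous_on_test_fun[OF \<phi>])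
      (metis less_irrefl)
  have "c = integral {\<xi>0 - b..\<xi>0 + b} (\<lambda>\<xi>. c / (2 * b))" using b by simp
  also have "\<dots> \<le> integral {\<xi>0 - b..\<xi>0 + b} ?r"
  proof (rule integral_le[OF integrable_const_ivl int_r[OF refl]])
    fix \<xi> assume "\<xi> \<in> {\<xi>0 - b..\<xi>0 + b}"
    then have u: "\<bar>\<xi> - \<xi>0\<bar> \<le> b" by auto
    then have "(\<xi> - \<xi>0)\<^sup>2 \<le> b\<^sup>2" using power_mono[of "\<bar>\<xi> - \<xi>0\<bar>" b 2] by simp
    then have "b / (b\<^sup>2 + b\<^sup>2) \<le> b / (b\<^sup>2 + (\<xi> - \<xi>0)\<^sup>2)"
      using b pos[of \<xi>] by (intro divide_left_mono) auto
    then have "1 / (2 * b) \<le> b / (b\<^sup>2 + (\<xi> - \<xi>0)\<^sup>2)"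
      using b by (simp add: power2_eq_square)
    from mult_mono[OF c(2)[OF u] this nonneg] show "c / (2 * b) \<le> ?r \<xi>" using b by simp
  qed
  also have "\<dots> \<le> integral {a1..b1} ?r"
    using sub nonneg b pos by (intro integral_subset_le int_r[OF refl]) (auto intro!: mult_nonneg_nonneg divide_nonneg_nonneg)
  also have "\<dots> = Re (integral {a1..b1} ?f)"
    using integral_linear[OF int_f bounded_linear_Re] unfolding o_def Re_f .
  also have "\<dots> \<le> cmod (integral {a1..b1} ?f)" by (rule complex_Re_le_cmod)
  finally show ?thesis .
qed

context bounded_C0_semigroup begin

text \<open>
  The resolvent identity integrated against a test function: up to a term that stays bounded as
  \<open>\<delta> \<rightarrow> 0\<close>, the pairing acts on \<open>R(\<delta> + i \<xi>\<^sub>0)\<close> as a scalar.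
\<close>

lemma approx_bv_resolvent:
  assumes \<phi>: "\<phi> \<in> test_funs {a<..<b}" and \<delta>: "0 < \<delta>" "\<delta> < \<beta>"
  shows "approx_bv \<phi> \<beta> o\<^sub>C R \<delta> \<xi>0 =
    integral {a..b} (\<lambda>\<xi>. \<phi> \<xi> / (of_real (\<beta> - \<delta>) + \<i> * of_real (\<xi> - \<xi>0))) *\<^sub>C R \<delta> \<xi>0
    - integral {a..b} (\<lambda>\<xi>. (\<phi> \<xi> / (of_real (\<beta> - \<delta>) + \<i> * of_real (\<xi> - \<xi>0))) *\<^sub>C R \<beta> \<xi>)"
proof -
  let ?d = "\<lambda>\<xi>. of_real (\<beta> - \<delta>) + \<i> * of_real (\<xi> - \<xi>0) :: complex"
  have \<beta>: "0 < \<beta>" using \<delta> by simp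
  have nz: "?d \<xi> \<noteq> 0" for \<xi> using \<delta> by (simp add: complex_eq_iff)
  note cont = continuous_intros continuous_on_test_fun[OF \<phi>] ballI nz continuous_on_R \<beta>
  have "approx_bv \<phi> \<beta> o\<^sub>C R \<delta> \<xi>0 = integral {a..b} ((\<lambda>X. X o\<^sub>C R \<delta> \<xi>0) \<circ> (\<lambda>\<xi>. \<phi> \<xi> *\<^sub>C R \<beta> \<xi>))"
    unfolding approx_bv_eq[OF \<phi>]
    by (rule integral_linear[symmetric, OF _ bounded_bilinear.bounded_linear_left[OF bounded_bilinear_cblinfun_comp]])
      (intro integrable_continuous_interval cont)
  also have "\<dots> = integral {a..b} (\<lambda>\<xi>. (\<phi> \<xi> / ?d \<xi>) *\<^sub>C R \<delta> \<xi>0 - (\<phi> \<xi> / ?d \<xi>) *\<^sub>C R \<beta> \<xi>)"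
  proof (rule integral_cong)
    fix \<xi>
    have "R \<delta> \<xi>0 - R \<beta> \<xi> = - (R \<beta> \<xi> - R \<delta> \<xi>0)" by simp
    also have "\<dots> = ?d \<xi> *\<^sub>C (R \<beta> \<xi> o\<^sub>C R \<delta> \<xi>0)"
      unfolding resolvent_identity[OF clinear_op_generator R_resolvent_set[OF \<beta>] R_resolvent_set[OF \<delta>(1)]]
        scaleC_minus_left[symmetric]
      by (rule arg_cong[where f = "\<lambda>z. z *\<^sub>C _"]) (simp add: algebra_simps)
    finally have "(\<phi> \<xi> / ?d \<xi>) *\<^sub>C (R \<delta> \<xi>0 - R \<beta> \<xi>) = \<phi> \<xi> *\<^sub>C (R \<beta> \<xi> o\<^sub>C R \<delta> \<xi>0)"
      using nz[of \<xi>] by (simp add: scaleC_scaleC)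
    then show "((\<lambda>X. X o\<^sub>C R \<delta> \<xi>0) \<circ> (\<lambda>\<xi>. \<phi> \<xi> *\<^sub>C R \<beta> \<xi>)) \<xi> =
        (\<phi> \<xi> / ?d \<xi>) *\<^sub>C R \<delta> \<xi>0 - (\<phi> \<xi> / ?d \<xi>) *\<^sub>C R \<beta> \<xi>"
      by (simp only: o_def scaleC_cblinfun_comp scaleC_diff_right)
  qed
  also have "\<dots> = integral {a..b} (\<lambda>\<xi>. (\<phi> \<xi> / ?d \<xi>) *\<^sub>C R \<delta> \<xi>0)
      - integral {a..b} (\<lambda>\<xi>. (\<phi> \<xi> / ?d \<xi>) *\<^sub>C R \<beta> \<xi>)"
    by (intro Henstock_Kurzweil_Integration.integral_diff integrable_continuous_interval cont)
  also have "integral {a..b} (\<lambda>\<xi>. (\<phi> \<xi> / ?d \<xi>) *\<^sub>C R \<delta> \<xi>0) = integral {a..b} (\<lambda>\<xi>. \<phi> \<xi> / ?d \<xi>) *\<^sub>C R \<delta> \<xi>0"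
  proof -
    have "(\<lambda>\<xi>. \<phi> \<xi> / ?d \<xi>) integrable_on {a..b}"
      by (intro integrable_continuous_interval cont)
    from integral_linear[OF this bounded_bilinear.bounded_linear_left[OF bounded_bilinear_scaleC]]
    show ?thesis unfolding o_def .
  qed
  finally show ?thesis .
qed

text \<open>
  Fix \<open>\<beta>\<close> so small that \<open>J(\<beta>, \<phi>)\<close> has norm below \<open>c / 2\<close>, while the scalar in
  \<open>approx_bv_resolvent\<close> has modulus at least \<open>c\<close> for all \<open>\<delta> \<le> \<beta> / 2\<close>.  Then \<open>R(\<delta> + i \<xi>\<^sub>0)\<close> is bounded
  independently of \<open>\<delta>\<close>.
\<close>

lemma resolvent_set_if_small_pairing:
  assumes \<phi>: "\<phi> \<in> test_funs {\<xi>0 - r<..<\<xi>0 + r}"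
    and real: "\<And>\<xi>. \<phi> \<xi> = of_real (Re (\<phi> \<xi>))" "\<And>\<xi>. 0 \<le> Re (\<phi> \<xi>)"
    and c: "0 < c" "0 < s" "s \<le> r" "\<And>\<xi>. \<bar>\<xi> - \<xi>0\<bar> \<le> s \<Longrightarrow> c \<le> Re (\<phi> \<xi>)"
    and small: "norm (resolvent_bv (generator T) \<phi>) < c / 2"
  shows "\<i> * of_real \<xi>0 \<in> resolvent_set (generator T)"
proof -
  have "\<forall>\<^sub>F \<beta> in at_right 0. norm (approx_bv \<phi> \<beta>) < c / 2"
    by (rule order_tendstoD(2)[OF tendsto_norm[OF approx_bv_tendsto[OF \<phi>]] small])
  then obtain d where d: "0 < d" "\<And>\<beta>. 0 < \<beta> \<Longrightarrow> \<beta> < d \<Longrightarrow> norm (approx_bv \<phi> \<beta>) < c / 2"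
    unfolding eventually_at_right_field by blast
  define \<beta> where "\<beta> = min (d / 2) s"
  have \<beta>: "0 < \<beta>" "\<beta> \<le> s" and J: "norm (approx_bv \<phi> \<beta>) < c / 2"
    using d c by (auto simp: \<beta>_def)
  obtain B where B: "0 \<le> B" "\<And>t. cmod (\<phi> t) \<le> B" using test_fun_bounded[OF \<phi>] by blast
  define E where "E = B * (2 / \<beta>) * (M / \<beta>) * (2 * r)"
  have E: "0 \<le> E" using B \<beta> c M_nonneg by (simp add: E_def)
  have bnd: "norm (R \<delta> \<xi>0) \<le> 2 * E / c" if \<delta>: "0 < \<delta>" "\<delta> \<le> \<beta> / 2" for \<delta>
  proof -
    let ?I = "{\<xi>0 - r..\<xi>0 + r}"
    let ?d = "\<lambda>\<xi>. of_real (\<beta> - \<delta>) + \<i> * of_real (\<xi> - \<xi>0) :: complex"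
    let ?\<kappa> = "integral ?I (\<lambda>\<xi>. \<phi> \<xi> / ?d \<xi>)"
    let ?E = "integral ?I (\<lambda>\<xi>. (\<phi> \<xi> / ?d \<xi>) *\<^sub>C R \<beta> \<xi>)"
    have \<delta>\<beta>: "0 < \<beta> - \<delta>" "\<beta> / 2 \<le> \<beta> - \<delta>" "\<beta> - \<delta> \<le> s" using \<delta> \<beta> by auto
    have nz: "?d \<xi> \<noteq> 0" for \<xi> using \<delta>\<beta> by (simp add: complex_eq_iff)
    have "c \<le> cmod ?\<kappa>"
      by (rule pole_pairing_lower_bound[OF \<phi> real \<delta>\<beta>(1)]) (use c \<delta>\<beta> in auto)
    then have "c * norm (R \<delta> \<xi>0) \<le> norm (?\<kappa> *\<^sub>C R \<delta> \<xi>0)"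
      by (simp add: mult_right_mono)
    also have "?\<kappa> *\<^sub>C R \<delta> \<xi>0 = approx_bv \<phi> \<beta> o\<^sub>C R \<delta> \<xi>0 + ?E"
      using approx_bv_resolvent[OF \<phi>, of \<delta> \<beta> \<xi>0] \<delta> \<beta> by simp
    also have "norm \<dots> \<le> norm (approx_bv \<phi> \<beta> o\<^sub>C R \<delta> \<xi>0) + norm ?E" by (rule norm_triangle_ineq)
    also have "norm (approx_bv \<phi> \<beta> o\<^sub>C R \<delta> \<xi>0) \<le> c / 2 * norm (R \<delta> \<xi>0)"
      using J by (intro order_trans[OF norm_cblinfun_comp] mult_right_mono) auto
    also have "norm ?E \<le> integral ?I (\<lambda>\<xi>. B * (2 / \<beta>) * (M / \<beta>))"
    proof (rule integral_norm_bound_integral)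
      show "(\<lambda>\<xi>. (\<phi> \<xi> / ?d \<xi>) *\<^sub>C R \<beta> \<xi>) integrable_on ?I"
        by (intro integrable_continuous_interval continuous_intros continuous_on_test_fun[OF \<phi>] ballI nz
            continuous_on_R \<beta>)
      show "norm ((\<phi> \<xi> / ?d \<xi>) *\<^sub>C R \<beta> \<xi>) \<le> B * (2 / \<beta>) * (M / \<beta>)" for \<xi>
      proof -
        have "\<beta> / 2 \<le> cmod (?d \<xi>)" using complex_Re_le_cmod[of "?d \<xi>"] \<delta>\<beta> by simp
        then have "cmod (\<phi> \<xi>) / cmod (?d \<xi>) \<le> B / (\<beta> / 2)"
          using B \<beta> by (intro frac_le) auto
        then show ?thesis
          using B \<beta> R_norm[OF \<beta>(1)] unfolding norm_scaleC norm_divide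
          by (intro mult_mono) (auto simp: mult.commute)
      qed
    qed (rule integrable_const_ivl)
    also have "\<dots> = E" using c by (simp add: E_def)
    finally have "c / 2 * norm (R \<delta> \<xi>0) \<le> E" by simp
    then show ?thesis using c by (simp add: pos_le_divide_eq mult_ac)
  qed
  \<comment> \<open>With this \<open>\<delta>\<close> the distance to \<open>i \<xi>\<^sub>0\<close> is below the inverse of the norm of \<open>R(\<delta> + i \<xi>\<^sub>0)\<close>.\<close>
  define \<delta> where "\<delta> = min (\<beta> / 2) (1 / (2 * E / c + 1))"
  have p: "0 < 2 * E / c + 1" using E c by (simp add: add_nonneg_pos)
  have \<delta>: "0 < \<delta>" "\<delta> \<le> \<beta> / 2" "\<delta> \<le> 1 / (2 * E / c + 1)" using \<beta> p by (auto simp: \<delta>_def)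
  have "\<delta> * norm (R \<delta> \<xi>0) \<le> 1 / (2 * E / c + 1) * (2 * E / c)"
    using \<delta> bnd[OF \<delta>(1,2)] p by (intro mult_mono) auto
  also have "1 / P * Q < 1" if "0 < P" "Q < P" for P Q :: real using that by simp
  from this[OF p, of "2 * E / c"] have "1 / (2 * E / c + 1) * (2 * E / c) < 1" by (simp only: less_add_one)
  finally have "cmod (\<i> * of_real \<xi>0 - (of_real \<delta> + \<i> * of_real \<xi>0)) * norm (R \<delta> \<xi>0) < 1"
    using \<delta> by simp
  then show ?thesis
    by (rule resolvent_set_near(1)[OF clinear_op_generator R_resolvent_set[OF \<delta>(1)]])
qed

lemma local_pseudofunction_resolvent_set:
  assumes I: "local_pseudofunction I (resolvent_bv (generator T))" and \<xi>0: "\<xi>0 \<in> I"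
  shows "\<i> * of_real \<xi>0 \<in> resolvent_set (generator T)"
proof -
  obtain I' g where I': "open I'" "\<xi>0 \<in> I'" and g: "g \<in> C0_funs"
    and eq: "\<And>\<phi>. \<phi> \<in> test_funs I' \<Longrightarrow> resolvent_bv (generator T) \<phi> = regular_distr g (fourier \<phi>)"
    using I \<xi>0 unfolding local_pseudofunction_def pseudofunctions_def fourier_distr_def by fast
  obtain r where r: "0 < r" "ball \<xi>0 r \<subseteq> I'" using I' openE by blast
  obtain \<phi> c where \<phi>: "\<phi> \<in> test_funs {-2<..<2}" "0 < c" "\<And>t. \<phi> t = of_real (Re (\<phi> t))"
    "\<And>t. 0 \<le> Re (\<phi> t)" "\<And>t. \<bar>t\<bar> \<le> 1/2 \<Longrightarrow> c \<le> Re (\<phi> t)"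
    using nonneg_test_fun by blast
  let ?\<phi> = "\<lambda>a \<xi>. \<phi> ((\<xi> - \<xi>0) / a)"
  have "\<forall>\<^sub>F a in at_right 0. norm (regular_distr g (fourier (?\<phi> a))) < c / 2"
    using tendstoD[OF regular_distr_rescale_tendsto_0[OF g \<phi>(1), of \<xi>0], of "c / 2"] \<phi>(2) by simp
  then obtain d where d: "0 < d" "\<And>a. 0 < a \<Longrightarrow> a < d \<Longrightarrow> norm (regular_distr g (fourier (?\<phi> a))) < c / 2"
    unfolding eventually_at_right_field by blast
  define a where "a = min (d / 2) (r / 2)"
  have a: "0 < a" "a < d" "2 * a \<le> r" using d r by (auto simp: a_def)
  have \<phi>a: "?\<phi> a \<in> test_funs {\<xi>0 - 2 * a<..<\<xi>0 + 2 * a}" by (rule rescale_test_fun[OF \<phi>(1) a(1)])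
  have "{\<xi>0 - 2 * a<..<\<xi>0 + 2 * a} \<subseteq> I'" using a r by (auto simp: subset_iff dist_real_def abs_less_iff)
  then have "?\<phi> a \<in> test_funs I'" using \<phi>a test_funs_mono by blast
  then have small: "norm (resolvent_bv (generator T) (?\<phi> a)) < c / 2" using eq d(2)[OF a(1,2)] by simp
  show ?thesis
  proof (rule resolvent_set_if_small_pairing[OF \<phi>a \<phi>(3,4,2) _ _ _ small])
    show "0 < a / 2" "a / 2 \<le> 2 * a" using a by auto
    show "c \<le> Re (?\<phi> a \<xi>)" if "\<bar>\<xi> - \<xi>0\<bar> \<le> a / 2" for \<xi>
      using that a by (intro \<phi>(5)) (simp add: field_simps abs_if split: if_splits)
  qed
qed

end

section \<open>Fourier inversion\<close>

lemma integral_exp_kernel: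
  assumes N: "0 < N"
  shows "integral {-N..N} (\<lambda>t. exp (\<i> * of_real u * of_real t)) = of_real (2 * N * sinc (N * u))"
proof (cases "u = 0")
  case True
  then show ?thesis using N by (simp add: scaleR_conv_of_real)
next
  case False
  let ?F = "\<lambda>t. exp (\<i> * of_real u * t) / (\<i> * of_real u)"
  have "((\<lambda>t. exp (\<i> * of_real u * of_real t)) has_integral (?F (of_real N) - ?F (of_real (- N)))) {-N..N}"
    using N False
    by (intro fundamental_theorem_of_calculus has_vector_derivative_real_field)
      (auto intro!: derivative_eq_intros)
  moreover have "?F (of_real N) - ?F (of_real (- N)) = of_real (2 * N * sinc (N * u))"
    using False N
    by (simp add: sin_of_real[symmetric] sin_exp_eq field_simps mult_ac)
  ultimately show ?thesis using integral_unique by metis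
qed

lemma Si_scaled_tendsto: "(\<lambda>n. Si (real (Suc n) * v)) \<longlonglongrightarrow> sgn v * pi / 2"
proof -
  have pos: "(\<lambda>n. Si (real (Suc n) * v)) \<longlonglongrightarrow> pi / 2" if "0 < v" for v
  proof (rule filterlim_compose[OF Si_at_top])
    show "filterlim (\<lambda>n. real (Suc n) * v) at_top sequentially" using that by real_asymp
  qed
  consider "v > 0" | "v = 0" | "v < 0" by linarith
  then show ?thesis
  proof cases
    case 3
    have "Si (real (Suc n) * v) = - Si (real (Suc n) * (- v))" for n
      using Si_neg[of "real (Suc n) * (- v)"] 3 by (simp add: mult_nonneg_nonpos)
    then show ?thesis using tendsto_minus[OF pos[of "- v"]] 3 by simp
  qed (use pos Si_neg[of 0] in auto)
qed

text \<open>
  The truncated inversion integral is the convolution of \<open>\<phi>\<close> with the Dirichlet kernel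
  \<open>2 sin (N u) / u\<close>.  Integrating by parts replaces this kernel, which is not bounded in \<open>L\<^sup>1\<close>, by its
  primitive \<open>2 Si (N u)\<close>, which is bounded and converges to \<open>\<pi> sgn u\<close>.
\<close>

lemma partial_inverse_fourier_eq:
  assumes \<phi>: "\<phi> \<in> test_funs {a<..<b}" and N: "0 < N"
  shows "integral {-N..N} (\<lambda>t. fourier \<phi> t * exp (\<i> * of_real \<eta> * of_real t))
    = integral {a..b} (\<lambda>\<xi>. iter_vderiv 1 \<phi> \<xi> * of_real (2 * Si (N * (\<eta> - \<xi>))))"
proof -
  let ?e = "\<lambda>t \<xi>. \<phi> \<xi> * exp (- \<i> * of_real t * of_real \<xi>) * exp (\<i> * of_real \<eta> * of_real t)"
  have "integral {-N..N} (\<lambda>t. fourier \<phi> t * exp (\<i> * of_real \<eta> * of_real t))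
      = integral (cbox (- N) N) (\<lambda>t. integral (cbox a b) (?e t))"
    by (simp add: fourier_eq[OF \<phi>] integral_mult_left)
  also have "\<dots> = integral (cbox a b) (\<lambda>\<xi>. integral (cbox (- N) N) (\<lambda>t. ?e t \<xi>))"
    by (rule integral_swap_continuous, unfold split_def)
      (intro continuous_intros continuous_on_compose2[OF continuous_on_test_fun[OF \<phi>, of UNIV]], auto)
  also have "\<dots> = integral {a..b} (\<lambda>\<xi>. \<phi> \<xi> * of_real (2 * N * sinc (N * (\<eta> - \<xi>))))"
    unfolding cbox_interval
  proof (rule integral_cong)
    fix \<xi>
    have "?e t \<xi> = \<phi> \<xi> * exp (\<i> * of_real (\<eta> - \<xi>) * of_real t)" for t
      by (simp add: mult.assoc algebra_simps flip: exp_add)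
    then show "integral {- N..N} (\<lambda>t. ?e t \<xi>) = \<phi> \<xi> * of_real (2 * N * sinc (N * (\<eta> - \<xi>)))"
      by (simp only: integral_mult_right integral_exp_kernel[OF N])
  qed
  also have "\<dots> = - integral {a..b} (\<lambda>\<xi>. iter_vderiv 1 \<phi> \<xi> * of_real (- 2 * Si (N * (\<eta> - \<xi>))))"
  proof -
    have "integral {a..b} (\<lambda>\<xi>. iter_vderiv 1 \<phi> \<xi> * complex_of_real (- 2 * Si (N * (\<eta> - \<xi>))))
        = - integral {a..b} (\<lambda>\<xi>. \<phi> \<xi> * complex_of_real (2 * N * sinc (N * (\<eta> - \<xi>))))"
    proof (rule test_fun_integral_by_parts[OF bounded_bilinear_mult \<phi>])
      fix \<xi>
      have "((\<lambda>\<xi>. - 2 * Si (N * (\<eta> - \<xi>))) has_real_derivative 2 * N * sinc (N * (\<eta> - \<xi>))) (at \<xi>)"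
        by (rule derivative_eq_intros DERIV_chain2[OF DERIV_Si] refl | simp)+
      then show "((\<lambda>\<xi>. complex_of_real (- 2 * Si (N * (\<eta> - \<xi>)))) has_vector_derivative
          complex_of_real (2 * N * sinc (N * (\<eta> - \<xi>)))) (at \<xi>)"
        by (rule has_vector_derivative_of_real)
    qed (intro continuous_intros)
    then show ?thesis by simp
  qed
  also have "\<dots> = integral {a..b} (\<lambda>\<xi>. iter_vderiv 1 \<phi> \<xi> * of_real (2 * Si (N * (\<eta> - \<xi>))))"
    by (subst integral_neg[symmetric]) simp
  finally show ?thesis .
qed

lemma test_fun_sgn_integral:
  fixes \<phi> :: "real \<Rightarrow> complex"
  assumes \<phi>: "\<phi> \<in> test_funs {a<..<b}" and \<eta>: "\<eta> \<in> {a..b}"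
  shows "integral {a..b} (\<lambda>\<xi>. iter_vderiv 1 \<phi> \<xi> * of_real (2 * (sgn (\<eta> - \<xi>) * pi / 2))) = 2 * pi * \<phi> \<eta>"
proof -
  let ?f = "\<lambda>\<xi>. iter_vderiv 1 \<phi> \<xi> * complex_of_real (2 * (sgn (\<eta> - \<xi>) * pi / 2))"
  have d: "(\<phi> has_vector_derivative iter_vderiv 1 \<phi> \<xi>) (at \<xi> within S)" for \<xi> S
    using iter_vderiv_has_vector_derivative[OF test_funsD(1)[OF \<phi>], of 0 \<xi>]
    by (simp add: has_vector_derivative_at_within)
  have z: "\<phi> a = 0" "\<phi> b = 0" using test_funsD(4)[OF \<phi>] by auto
  have "((\<lambda>\<xi>. iter_vderiv 1 \<phi> \<xi> * of_real pi) has_integral (\<phi> \<eta> - \<phi> a) * of_real pi) {a..\<eta>}"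
    using \<eta> d by (intro has_integral_mult_left fundamental_theorem_of_calculus) auto
  then have 1: "(?f has_integral (\<phi> \<eta> - \<phi> a) * of_real pi) {a..\<eta>}"
    by (rule has_integral_spike_finite[of "{\<eta>}", rotated 2]) (auto simp: sgn_if)
  have "((\<lambda>\<xi>. iter_vderiv 1 \<phi> \<xi> * of_real (- pi)) has_integral (\<phi> b - \<phi> \<eta>) * of_real (- pi)) {\<eta>..b}"
    using \<eta> d by (intro has_integral_mult_left fundamental_theorem_of_calculus) auto
  then have 2: "(?f has_integral (\<phi> b - \<phi> \<eta>) * of_real (- pi)) {\<eta>..b}"
    by (rule has_integral_spike_finite[of "{\<eta>}", rotated 2]) (auto simp: sgn_if)
  have "(?f has_integral (\<phi> \<eta> - \<phi> a) * of_real pi + (\<phi> b - \<phi> \<eta>) * of_real (- pi)) {a..b}"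
    by (rule has_integral_combine[OF _ _ 1 2]) (use \<eta> in auto)
  from integral_unique[OF this]
  have "integral {a..b} ?f = (\<phi> \<eta> - \<phi> a) * of_real pi + (\<phi> b - \<phi> \<eta>) * of_real (- pi)" .
  also have "\<dots> = 2 * pi * \<phi> \<eta>" using z by (simp add: algebra_simps)
  finally show ?thesis .
qed

lemma inverse_fourier_tendsto:
  fixes \<phi> :: "real \<Rightarrow> complex"
  assumes \<phi>: "\<phi> \<in> test_funs {a<..<b}"
  defines "D \<equiv> \<lambda>(n::nat) (\<eta>::real). integral {- real (Suc n)..real (Suc n)}
    (\<lambda>t. fourier \<phi> t * exp (\<i> * complex_of_real \<eta> * complex_of_real t))"
  shows "\<eta> \<in> {a..b} \<Longrightarrow> (\<lambda>n. D n \<eta>) \<longlonglongrightarrow> 2 * pi * \<phi> \<eta>"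
    and "\<exists>C. \<forall>n \<eta>. cmod (D n \<eta>) \<le> C"
proof -
  have D: "D n \<eta> = integral {a..b} (\<lambda>\<xi>. iter_vderiv 1 \<phi> \<xi> * of_real (2 * Si (real (Suc n) * (\<eta> - \<xi>))))" for n \<eta>
    unfolding D_def by (rule partial_inverse_fourier_eq[OF \<phi>]) simp
  obtain B where B: "\<And>x. \<bar>Si x\<bar> \<le> B" using bounded_Si by blast
  obtain B1 where B1: "0 \<le> B1" "\<And>t. cmod (iter_vderiv 1 \<phi> t) \<le> B1"
    using test_fun_bounded[OF test_funs_iter_vderiv[OF \<phi>]] by blast
  have cont: "(\<lambda>\<xi>. iter_vderiv 1 \<phi> \<xi> * complex_of_real (2 * Si (real (Suc n) * (\<eta> - \<xi>)))) integrable_on {a..b}" for n \<eta>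
    by (intro integrable_continuous_interval continuous_intros
        continuous_on_test_fun[OF test_funs_iter_vderiv[OF \<phi>]]
        continuous_on_compose2[OF continuous_at_imp_continuous_on[of UNIV Si]] ballI isCont_Si) auto
  have le: "cmod (iter_vderiv 1 \<phi> \<xi> * of_real (2 * Si (real (Suc n) * (\<eta> - \<xi>)))) \<le> B1 * (2 * B)" for n \<eta> \<xi>
    unfolding norm_mult using B1 B[of "real (Suc n) * (\<eta> - \<xi>)"] by (intro mult_mono) auto
  show "(\<lambda>n. D n \<eta>) \<longlonglongrightarrow> 2 * pi * \<phi> \<eta>" if \<eta>: "\<eta> \<in> {a..b}"
    unfolding D test_fun_sgn_integral[OF \<phi> \<eta>, symmetric]
    by (rule dominated_convergence(2)[OF cont integrable_const_ivl le])
      (intro tendsto_mult tendsto_const tendsto_of_real Si_scaled_tendsto)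
  have "cmod (D n \<eta>) \<le> integral {a..b} (\<lambda>_. B1 * (2 * B))" for n \<eta>
    unfolding D by (rule integral_norm_bound_integral[OF cont integrable_const_ivl le])
  then show "\<exists>C. \<forall>n \<eta>. cmod (D n \<eta>) \<le> C" by blast
qed

text \<open>
  The comparison test with an arctangent: the integrals over intervals containing \<open>[-B, B]\<close> differ
  from that over \<open>[-B, B]\<close> by at most \<open>C (\<pi> - 2 arctan B)\<close>, which is the Cauchy criterion.
\<close>

lemma integrable_UNIV_decay:
  fixes f :: "real \<Rightarrow> 'b::banach"
  assumes f: "continuous_on UNIV f" and le: "\<And>t. norm (f t) \<le> C / (1 + t\<^sup>2)"
  shows "f integrable_on UNIV"
proof -
  have C: "0 \<le> C" using le[of 0] norm_ge_zero[of "f 0"] by (simp del: norm_ge_zero)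
  have int: "f integrable_on {u..v}" for u v
    by (intro integrable_continuous_interval continuous_on_subset[OF f]) auto
  have tail: "norm (integral {u..v} f) \<le> C * (arctan v - arctan u)" if "u \<le> v" for u v
  proof -
    have h: "((\<lambda>t. C / (1 + t\<^sup>2)) has_integral (C * arctan v - C * arctan u)) {u..v}"
      using that by (intro fundamental_theorem_of_calculus)
        (auto intro!: derivative_eq_intros simp flip: has_real_derivative_iff_has_vector_derivative
          simp: field_simps)
    have "norm (integral {u..v} f) \<le> integral {u..v} (\<lambda>t. C / (1 + t\<^sup>2))"
      using h le int by (intro integral_norm_bound_integral) auto
    then show ?thesis using integral_unique[OF h] by (simp add: algebra_simps)
  qed
  have cmp: "norm (integral {u..v} f - integral {-B..B} f) \<le> C * (pi - 2 * arctan B)"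
    if "u \<le> - B" "B \<le> v" "0 < B" for u v B
  proof -
    have "integral {u..v} f = integral {u..-B} f + (integral {-B..B} f + integral {B..v} f)"
      using that int Henstock_Kurzweil_Integration.integral_combine[of u "- B" v f]
        Henstock_Kurzweil_Integration.integral_combine[of "- B" B v f] by simp
    then have "norm (integral {u..v} f - integral {-B..B} f) \<le> norm (integral {u..-B} f) + norm (integral {B..v} f)"
      using norm_triangle_ineq[of "integral {u..-B} f" "integral {B..v} f"] by simp
    also have "\<dots> \<le> C * (arctan (- B) - arctan u) + C * (arctan v - arctan B)"
      using that by (intro add_mono tail) auto
    also have "\<dots> \<le> C * (- arctan B + pi / 2) + C * (pi / 2 - arctan B)"
      using C arctan_lbound[of u] arctan_ubound[of v]
      by (intro add_mono mult_left_mono) (auto simp: arctan_minus)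
    also have "\<dots> = C * (pi - 2 * arctan B)" by (simp add: algebra_simps)
    finally show ?thesis .
  qed
  have "((\<lambda>B. C * (pi - 2 * arctan B)) \<longlongrightarrow> C * (pi - 2 * (pi / 2))) at_top"
    by (intro tendsto_intros tendsto_arctan_at_top)
  then have lim: "((\<lambda>B. C * (pi - 2 * arctan B)) \<longlongrightarrow> 0) at_top" by simp
  show ?thesis
  proof (rule integrable_alt[THEN iffD2], intro conjI allI impI)
    show "(\<lambda>x. if x \<in> UNIV then f x else 0) integrable_on cbox a b" for a b using int by simp
    fix e :: real assume "0 < e"
    then have "\<forall>\<^sub>F B in at_top. C * (pi - 2 * arctan B) < e / 2"
      by (intro order_tendstoD(2)[OF lim]) simp
    then obtain B0 where B0: "\<And>B. B0 \<le> B \<Longrightarrow> C * (pi - 2 * arctan B) < e / 2"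
      unfolding eventually_at_top_linorder by blast
    define B where "B = max B0 1"
    have B: "0 < B" "C * (pi - 2 * arctan B) < e / 2" using B0 by (auto simp: B_def)
    show "\<exists>B>0. \<forall>a b c d. ball 0 B \<subseteq> cbox a b \<and> ball 0 B \<subseteq> cbox c d \<longrightarrow>
        norm (integral (cbox a b) (\<lambda>x. if x \<in> UNIV then f x else 0) -
          integral (cbox c d) (\<lambda>x. if x \<in> UNIV then f x else 0)) < e"
    proof (intro exI[of _ B] conjI allI impI B)
      fix a b c d :: real assume "ball 0 B \<subseteq> cbox a b \<and> ball 0 B \<subseteq> cbox c d"
      then have s: "a \<le> - B" "B \<le> b" "c \<le> - B" "B \<le> d"
        using B(1) by (simp_all add: ball_eq_greaterThanLessThan greaterThanLessThan_subseteq_atLeastAtMost_iff)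
      have "norm (integral {a..b} f - integral {c..d} f) \<le>
          norm (integral {a..b} f - integral {-B..B} f) + norm (integral {c..d} f - integral {-B..B} f)"
        using norm_triangle_ineq4[of "integral {a..b} f - integral {-B..B} f" "integral {c..d} f - integral {-B..B} f"]
        by simp
      also have "\<dots> < e" using cmp[OF s(1,2) B(1)] cmp[OF s(3,4) B(1)] B(2) by linarith
      finally show "norm (integral (cbox a b) (\<lambda>x. if x \<in> UNIV then f x else 0) -
          integral (cbox c d) (\<lambda>x. if x \<in> UNIV then f x else 0)) < e" by simp
    qed
  qed
qed

lemma integral_UNIV_tendsto:
  fixes f :: "real \<Rightarrow> 'b::banach"
  assumes f: "f integrable_on UNIV"
  shows "(\<lambda>n. integral {- real (Suc n)..real (Suc n)} f) \<longlonglongrightarrow> integral UNIV f"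
proof (rule LIMSEQ_I)
  fix e :: real assume "0 < e"
  moreover have "(f has_integral integral UNIV f) UNIV" using f by (rule integrable_integral)
  ultimately obtain B where "0 < B"
    and B: "\<And>a b. ball 0 B \<subseteq> cbox a b \<Longrightarrow> norm (integral (cbox a b) f - integral UNIV f) < e"
    unfolding has_integral_alt'[of f] by auto
  obtain N where N: "B \<le> real N" using real_arch_simple by blast
  have "norm (integral {- real (Suc n)..real (Suc n)} f - integral UNIV f) < e" if "N \<le> n" for n
  proof -
    have "ball 0 B \<subseteq> cbox (- real (Suc n)) (real (Suc n))"
      using N that by (auto simp: dist_real_def abs_less_iff)
    from B[OF this] show ?thesis by simp
  qed
  then show "\<exists>N. \<forall>n\<ge>N. norm (integral {- real (Suc n)..real (Suc n)} f - integral UNIV f) < e" by blast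
qed

lemma fourier_decay:
  assumes \<phi>: "\<phi> \<in> test_funs {a<..<b}"
  obtains C where "0 \<le> C" "\<And>t. cmod (fourier \<phi> t) \<le> C / (1 + t\<^sup>2)"
proof -
  have "{a<..<b} \<subseteq> {a<..<max a b}" by auto
  from test_funs_mono[OF this] \<phi> have \<phi>': "\<phi> \<in> test_funs {a<..<max a b}" by blast
  have ab: "a \<le> max a b" by simp
  obtain B0 where B0: "0 \<le> B0" "\<And>t. cmod (\<phi> t) \<le> B0" using test_fun_bounded[OF \<phi>] by blast
  obtain B2 where B2: "0 \<le> B2" "\<And>t. cmod (iter_vderiv 2 \<phi> t) \<le> B2"
    using test_fun_bounded[OF test_funs_iter_vderiv[OF \<phi>]] by blast
  show ?thesis
  proof (rule that)
    show "0 \<le> (B0 + B2) * (max a b - a)" using B0 B2 by simp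
    fix t
    have "cmod (fourier \<phi> t) * (1 + t\<^sup>2) \<le> (B0 + B2) * (max a b - a)"
      using fourier_bound[OF \<phi>' ab B0(2), of t] fourier_bound_square[OF \<phi>' ab B2(2), of t]
      by (simp add: distrib_left distrib_right mult.commute)
    then show "cmod (fourier \<phi> t) \<le> (B0 + B2) * (max a b - a) / (1 + t\<^sup>2)"
      by (simp add: pos_le_divide_eq add_pos_nonneg)
  qed
qed

text \<open>
  A case of the Riemann-Lebesgue lemma.  Integrating by parts once gives boundary terms of order
  \<open>1 / t\<close> like the rest, so the jumps of the truncated function at \<open>a\<close> and \<open>b\<close> do no harm.
\<close>

lemma oscillatory_integral_C0:
  fixes F :: "real \<Rightarrow> 'z::complex_banach"
  assumes F: "\<And>\<eta>. \<eta> \<in> {a..b} \<Longrightarrow> (F has_vector_derivative F' \<eta>) (at \<eta>)"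
    and F': "continuous_on {a..b} F'" and ab: "a \<le> b"
  shows "(\<lambda>t. integral {a..b} (\<lambda>\<eta>. exp (\<i> * of_real \<eta> * of_real t) *\<^sub>C F \<eta>)) \<in> C0_funs"
proof -
  let ?e = "\<lambda>t \<eta>. exp (\<i> * of_real \<eta> * of_real t)"
  let ?g = "\<lambda>t. integral {a..b} (\<lambda>\<eta>. ?e t \<eta> *\<^sub>C F \<eta>)"
  have cF: "continuous_on {a..b} F"
    by (intro continuous_at_imp_continuous_on ballI has_vector_derivative_continuous[OF F])
  have "continuous_on UNIV (\<lambda>t. integral (cbox a b) (\<lambda>\<eta>. ?e t \<eta> *\<^sub>C F \<eta>))"
    by (rule integral_continuous_on_param, unfold split_def)
      (intro continuous_intros continuous_on_compose2[OF cF], auto)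
  then have cont: "continuous_on UNIV ?g" by simp
  obtain B where B: "\<And>\<eta>. \<eta> \<in> {a..b} \<Longrightarrow> norm (F' \<eta>) \<le> B"
    using compact_imp_bounded[OF compact_continuous_image[OF F' compact_Icc]] bounded_iff
    by (metis imageI)
  define K where "K = norm (F b) + norm (F a) + B * (b - a)"
  have le: "\<bar>t\<bar> * norm (?g t) \<le> K" for t
  proof -
    have 1: "((\<lambda>\<eta>. ?e t \<eta> *\<^sub>C F' \<eta> + (\<i> * of_real t * ?e t \<eta>) *\<^sub>C F \<eta>) has_integral
        (?e t b *\<^sub>C F b - ?e t a *\<^sub>C F a)) {a..b}"
    proof (rule fundamental_theorem_of_calculus[OF ab])
      fix \<eta> assume "\<eta> \<in> {a..b}"
      then show "((\<lambda>\<eta>. ?e t \<eta> *\<^sub>C F \<eta>) has_vector_derivative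
          ?e t \<eta> *\<^sub>C F' \<eta> + (\<i> * of_real t * ?e t \<eta>) *\<^sub>C F \<eta>) (at \<eta> within {a..b})"
        by (intro bounded_bilinear.has_vector_derivative[OF bounded_bilinear_scaleC]
            has_vector_derivative_at_within[OF F])
          (auto intro!: has_vector_derivative_real_field derivative_eq_intros)
    qed
    have i1: "(\<lambda>\<eta>. ?e t \<eta> *\<^sub>C F' \<eta>) integrable_on {a..b}"
      by (intro integrable_continuous_interval continuous_intros F')
    have i2: "(\<lambda>\<eta>. ?e t \<eta> *\<^sub>C F \<eta>) integrable_on {a..b}"
      by (intro integrable_continuous_interval continuous_intros cF)
    have 2: "((\<lambda>\<eta>. ?e t \<eta> *\<^sub>C F' \<eta> + (\<i> * of_real t * ?e t \<eta>) *\<^sub>C F \<eta>) has_integral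
        integral {a..b} (\<lambda>\<eta>. ?e t \<eta> *\<^sub>C F' \<eta>) + (\<i> * of_real t) *\<^sub>C ?g t) {a..b}"
      using has_integral_add[OF integrable_integral[OF i1]
          has_integral_linear[OF integrable_integral[OF i2] bounded_linear_scaleC[of "\<i> * of_real t"]]]
      by (simp add: o_def scaleC_scaleC)
    have eq: "(\<i> * of_real t) *\<^sub>C ?g t = ?e t b *\<^sub>C F b - ?e t a *\<^sub>C F a - integral {a..b} (\<lambda>\<eta>. ?e t \<eta> *\<^sub>C F' \<eta>)"
      using has_integral_unique[OF 1 2] by (simp add: algebra_simps)
    have "norm ((\<i> * of_real t) *\<^sub>C ?g t) \<le>
        norm (?e t b *\<^sub>C F b) + norm (?e t a *\<^sub>C F a) + norm (integral {a..b} (\<lambda>\<eta>. ?e t \<eta> *\<^sub>C F' \<eta>))"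
      unfolding eq
      using norm_triangle_ineq4[of "?e t b *\<^sub>C F b - ?e t a *\<^sub>C F a" "integral {a..b} (\<lambda>\<eta>. ?e t \<eta> *\<^sub>C F' \<eta>)"]
        norm_triangle_ineq4[of "?e t b *\<^sub>C F b" "?e t a *\<^sub>C F a"] by linarith
    moreover have "norm (integral {a..b} (\<lambda>\<eta>. ?e t \<eta> *\<^sub>C F' \<eta>)) \<le> integral {a..b} (\<lambda>\<eta>. B)"
      using B by (intro integral_norm_bound_integral i1) auto
    ultimately show ?thesis using ab by (simp add: K_def norm_mult mult.commute)
  qed
  have "(?g \<longlongrightarrow> 0) at_infinity"
  proof (rule Lim_null_comparison)
    have "\<forall>\<^sub>F t in at_infinity. (1::real) \<le> norm t"
      unfolding eventually_at_infinity by (rule exI[of _ 1]) simp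
    then show "\<forall>\<^sub>F t in at_infinity. norm (?g t) \<le> K * inverse (norm t)"
    proof eventually_elim
      case (elim t)
      then have "norm (?g t) \<le> K / \<bar>t\<bar>" using le[of t] by (simp add: pos_le_divide_eq mult.commute)
      then show ?case by (simp add: divide_inverse)
    qed
    show "((\<lambda>t::real. K * inverse (norm t)) \<longlongrightarrow> 0) at_infinity"
      by (intro tendsto_mult_right_zero tendsto_inverse_0_at_top filterlim_norm_at_top)
  qed
  with cont show ?thesis by (simp add: C0_funs_def)
qed

text \<open>
  Over \<open>[-N, N]\<close> the order of integration may be exchanged, which produces the truncated inversion
  integral of \<open>\<phi>\<close>; it converges boundedly to \<open>2 \<pi> \<phi>\<close>, hence in \<open>L\<^sup>1\<close> by dominated convergence for
  scalar functions, and pairing with the bounded function \<open>F\<close> is continuous in \<open>L\<^sup>1\<close>.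
\<close>

lemma regular_distr_inverse_fourier:
  fixes F :: "real \<Rightarrow> 'z::complex_banach" and \<phi> :: "real \<Rightarrow> complex"
  assumes \<phi>: "\<phi> \<in> test_funs {a<..<b}" and ab: "a \<le> b"
    and F: "\<And>\<eta>. \<eta> \<in> {a..b} \<Longrightarrow> (F has_vector_derivative F' \<eta>) (at \<eta>)"
    and F': "continuous_on {a..b} F'"
  shows "regular_distr (\<lambda>t. integral {a..b} (\<lambda>\<eta>. exp (\<i> * of_real \<eta> * of_real t) *\<^sub>C F \<eta>)) (fourier \<phi>)
    = integral {a..b} (\<lambda>\<eta>. (2 * pi * \<phi> \<eta>) *\<^sub>C F \<eta>)"
proof -
  let ?e = "\<lambda>t \<eta>. exp (\<i> * of_real \<eta> * of_real t)"
  define g where "g t = integral {a..b} (\<lambda>\<eta>. ?e t \<eta> *\<^sub>C F \<eta>)" for t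
  define D where "D n \<eta> = integral {- real (Suc n)..real (Suc n)} (\<lambda>t. fourier \<phi> t * ?e t \<eta>)" for n \<eta>
  have cF: "continuous_on {a..b} F"
    by (intro continuous_at_imp_continuous_on ballI has_vector_derivative_continuous[OF F])
  have "g \<in> C0_funs" unfolding g_def[abs_def] by (rule oscillatory_integral_C0[OF F F' ab])
  then obtain G where G: "0 \<le> G" "\<And>t. norm (g t) \<le> 1 + G / (1 + t\<^sup>2)" and cg: "continuous_on UNIV g"
    using C0_funs_bound[of g 1] by (auto simp: C0_funs_def)
  have gb: "norm (g t) \<le> 1 + G" for t
    using G(2)[of t] divide_left_mono[of 1 "1 + t\<^sup>2" G] G(1) by (simp add: add_pos_nonneg)
  obtain C where C: "0 \<le> C" "\<And>t. cmod (fourier \<phi> t) \<le> C / (1 + t\<^sup>2)" using fourier_decay[OF \<phi>] by blast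
  have "(\<lambda>t. fourier \<phi> t *\<^sub>C g t) integrable_on UNIV"
  proof (rule integrable_UNIV_decay)
    show "continuous_on UNIV (\<lambda>t. fourier \<phi> t *\<^sub>C g t)"
      by (intro continuous_on_scaleC continuous_on_fourier[OF \<phi>] cg)
    show "norm (fourier \<phi> t *\<^sub>C g t) \<le> C * (1 + G) / (1 + t\<^sup>2)" for t
      using mult_mono[OF C(2)[of t] gb[of t]] C(1) by simp
  qed
  from integral_UNIV_tendsto[OF this]
  have lim1: "(\<lambda>n. integral {- real (Suc n)..real (Suc n)} (\<lambda>t. fourier \<phi> t *\<^sub>C g t))
      \<longlonglongrightarrow> regular_distr g (fourier \<phi>)" by (simp only: regular_distr_def)
  have eq: "integral {- real (Suc n)..real (Suc n)} (\<lambda>t. fourier \<phi> t *\<^sub>C g t)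
      = integral {a..b} (\<lambda>\<eta>. D n \<eta> *\<^sub>C F \<eta>)" for n
  proof -
    let ?N = "real (Suc n)"
    have "integral {- ?N..?N} (\<lambda>t. fourier \<phi> t *\<^sub>C g t)
        = integral (cbox (- ?N) ?N) (\<lambda>t. integral (cbox a b) (\<lambda>\<eta>. (fourier \<phi> t * ?e t \<eta>) *\<^sub>C F \<eta>))"
      unfolding cbox_interval
    proof (rule integral_cong)
      fix t
      have "(\<lambda>\<eta>. ?e t \<eta> *\<^sub>C F \<eta>) integrable_on {a..b}"
        by (intro integrable_continuous_interval continuous_intros cF)
      from integral_linear[OF this bounded_linear_scaleC[of "fourier \<phi> t"]]
      show "fourier \<phi> t *\<^sub>C g t = integral {a..b} (\<lambda>\<eta>. (fourier \<phi> t * ?e t \<eta>) *\<^sub>C F \<eta>)"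
        by (simp add: o_def g_def scaleC_scaleC)
    qed
    also have "\<dots> = integral (cbox a b) (\<lambda>\<eta>. integral (cbox (- ?N) ?N) (\<lambda>t. (fourier \<phi> t * ?e t \<eta>) *\<^sub>C F \<eta>))"
      by (rule integral_swap_continuous, unfold split_def)
        (intro continuous_intros continuous_on_compose2[OF cF]
          continuous_on_compose2[OF continuous_on_fourier[OF \<phi>, of UNIV]], auto)
    also have "\<dots> = integral {a..b} (\<lambda>\<eta>. D n \<eta> *\<^sub>C F \<eta>)"
      unfolding cbox_interval
    proof (rule integral_cong)
      fix \<eta>
      have "(\<lambda>t. fourier \<phi> t * ?e t \<eta>) integrable_on {- ?N..?N}"
        by (intro integrable_continuous_interval continuous_intros continuous_on_fourier[OF \<phi>])
      from integral_linear[OF this bounded_bilinear.bounded_linear_left[OF bounded_bilinear_scaleC, of "F \<eta>"]]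
      show "integral {- ?N..?N} (\<lambda>t. (fourier \<phi> t * ?e t \<eta>) *\<^sub>C F \<eta>) = D n \<eta> *\<^sub>C F \<eta>"
        by (simp add: o_def D_def)
    qed
    finally show ?thesis .
  qed
  have lim2: "(\<lambda>n. integral {a..b} (\<lambda>\<eta>. D n \<eta> *\<^sub>C F \<eta>)) \<longlonglongrightarrow> integral {a..b} (\<lambda>\<eta>. (2 * pi * \<phi> \<eta>) *\<^sub>C F \<eta>)"
  proof -
    obtain B where B: "\<And>\<eta>. \<eta> \<in> {a..b} \<Longrightarrow> norm (F \<eta>) \<le> B"
      using compact_imp_bounded[OF compact_continuous_image[OF cF compact_Icc]] bounded_iff
      by (metis imageI)
    obtain K where K: "\<And>n \<eta>. cmod (D n \<eta>) \<le> K"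
      using inverse_fourier_tendsto(2)[OF \<phi>] unfolding D_def by blast
    obtain B0 where B0: "0 \<le> B0" "\<And>t. cmod (\<phi> t) \<le> B0" using test_fun_bounded[OF \<phi>] by blast
    have cD: "continuous_on {a..b} (D n)" for n
    proof -
      have "continuous_on {a..b} (\<lambda>\<eta>. integral (cbox (- real (Suc n)) (real (Suc n))) (\<lambda>t. fourier \<phi> t * ?e t \<eta>))"
        by (rule integral_continuous_on_param, unfold split_def)
          (intro continuous_intros continuous_on_compose2[OF continuous_on_fourier[OF \<phi>, of UNIV]], auto)
      then show ?thesis by (simp only: cbox_interval D_def[abs_def])
    qed
    let ?d = "\<lambda>n \<eta>. cmod (D n \<eta> - 2 * pi * \<phi> \<eta>)"
    have id: "?d n integrable_on {a..b}" for n
      by (intro integrable_continuous_interval continuous_intros cD continuous_on_test_fun[OF \<phi>])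
    have lim: "(\<lambda>n. integral {a..b} (?d n)) \<longlonglongrightarrow> integral {a..b} (\<lambda>_. 0)"
    proof (rule dominated_convergence(2)[where h = "\<lambda>_. K + 2 * pi * B0"])
      show "?d n integrable_on {a..b}" for n by (rule id)
      show "norm (?d n \<eta>) \<le> K + 2 * pi * B0" for n \<eta>
      proof -
        have "cmod (2 * pi * \<phi> \<eta>) \<le> 2 * pi * B0"
          using mult_left_mono[OF B0(2)[of \<eta>], of "2 * pi"] by (simp add: norm_mult)
        then have "?d n \<eta> \<le> K + 2 * pi * B0"
          using norm_triangle_ineq4[of "D n \<eta>" "2 * pi * \<phi> \<eta>"] K[of n \<eta>] by linarith
        then show ?thesis by (simp only: real_norm_def abs_norm_cancel)
      qed
      show "(\<lambda>n. ?d n \<eta>) \<longlonglongrightarrow> 0" if "\<eta> \<in> {a..b}" for \<eta>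
        unfolding D_def by (intro tendsto_norm_zero LIM_zero inverse_fourier_tendsto(1)[OF \<phi> that])
    qed (rule integrable_const_ivl)
    have "(\<lambda>n. integral {a..b} (\<lambda>\<eta>. D n \<eta> *\<^sub>C F \<eta>) - integral {a..b} (\<lambda>\<eta>. (2 * pi * \<phi> \<eta>) *\<^sub>C F \<eta>)) \<longlonglongrightarrow> 0"
    proof (rule Lim_null_comparison)
      show "(\<lambda>n. integral {a..b} (?d n) * B) \<longlonglongrightarrow> 0"
        using tendsto_mult_right[OF lim, of B] by (simp only: integral_0 mult_zero_left)
      show "\<forall>\<^sub>F n in sequentially. norm (integral {a..b} (\<lambda>\<eta>. D n \<eta> *\<^sub>C F \<eta>)
          - integral {a..b} (\<lambda>\<eta>. (2 * pi * \<phi> \<eta>) *\<^sub>C F \<eta>)) \<le> integral {a..b} (?d n) * B"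
      proof (rule always_eventually, rule allI)
        fix n
        have "integral {a..b} (\<lambda>\<eta>. D n \<eta> *\<^sub>C F \<eta>) - integral {a..b} (\<lambda>\<eta>. (2 * pi * \<phi> \<eta>) *\<^sub>C F \<eta>)
            = integral {a..b} (\<lambda>\<eta>. D n \<eta> *\<^sub>C F \<eta> - (2 * pi * \<phi> \<eta>) *\<^sub>C F \<eta>)"
          by (intro Henstock_Kurzweil_Integration.integral_diff[symmetric] integrable_continuous_interval
              continuous_intros cD cF continuous_on_test_fun[OF \<phi>])
        also have "norm \<dots> \<le> integral {a..b} (\<lambda>\<eta>. ?d n \<eta> * B)"
        proof (rule integral_norm_bound_integral)
          show "(\<lambda>\<eta>. D n \<eta> *\<^sub>C F \<eta> - (2 * pi * \<phi> \<eta>) *\<^sub>C F \<eta>) integrable_on {a..b}"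
            by (intro integrable_continuous_interval continuous_intros cD cF continuous_on_test_fun[OF \<phi>])
          show "(\<lambda>\<eta>. ?d n \<eta> * B) integrable_on {a..b}"
            by (intro integrable_continuous_interval continuous_intros cD continuous_on_test_fun[OF \<phi>])
          show "norm (D n \<eta> *\<^sub>C F \<eta> - (2 * pi * \<phi> \<eta>) *\<^sub>C F \<eta>) \<le> ?d n \<eta> * B" if "\<eta> \<in> {a..b}" for \<eta>
            using mult_left_mono[OF B[OF that] norm_ge_zero] by (simp only: norm_scaleC scaleC_diff_left[symmetric])
        qed
        finally show "norm (integral {a..b} (\<lambda>\<eta>. D n \<eta> *\<^sub>C F \<eta>)
            - integral {a..b} (\<lambda>\<eta>. (2 * pi * \<phi> \<eta>) *\<^sub>C F \<eta>)) \<le> integral {a..b} (?d n) * B"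
          by (simp only: integral_mult_left)
      qed
    qed
    then show ?thesis by (rule LIM_zero_cancel)
  qed
  show ?thesis
    using LIMSEQ_unique[OF lim1[unfolded eq] lim2] unfolding g_def[abs_def] .
qed

section \<open>Regular points on the imaginary axis\<close>

text \<open>
  The pairing is bounded by a multiple of the supremum norm, that is, it is a distribution of order
  zero, so the set where it has norm less than \<open>e\<close> is a convex balanced neighbourhood of zero.
\<close>

lemma integral_pairing_distribution:
  fixes F :: "real \<Rightarrow> 'z::complex_banach"
  assumes F: "continuous_on {a..b} F"
    and f: "\<And>\<phi>. \<phi> \<in> test_funs {a<..<b} \<Longrightarrow> f \<phi> = integral {a..b} (\<lambda>\<eta>. \<phi> \<eta> *\<^sub>C F \<eta>)"
  shows "f \<in> distributions {a<..<b}"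
proof -
  let ?I = "{a<..<b}"
  have int: "(\<lambda>\<eta>. \<phi> \<eta> *\<^sub>C F \<eta>) integrable_on {a..b}" if "\<phi> \<in> test_funs ?I" for \<phi>
    by (intro integrable_continuous_interval continuous_intros F continuous_on_test_fun[OF that])
  have lin: "f (\<lambda>t. c * \<phi> t + d * \<psi> t) = c *\<^sub>C f \<phi> + d *\<^sub>C f \<psi>"
    if "\<phi> \<in> test_funs ?I" "\<psi> \<in> test_funs ?I" for c d \<phi> \<psi>
  proof -
    have "f (\<lambda>t. c * \<phi> t + d * \<psi> t)
        = integral {a..b} (\<lambda>\<eta>. c *\<^sub>C (\<phi> \<eta> *\<^sub>C F \<eta>) + d *\<^sub>C (\<psi> \<eta> *\<^sub>C F \<eta>))"
      by (simp add: f test_funs_lincomb that scaleC_add_left scaleC_scaleC)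
    also have "\<dots> = integral {a..b} (\<lambda>\<eta>. c *\<^sub>C (\<phi> \<eta> *\<^sub>C F \<eta>)) + integral {a..b} (\<lambda>\<eta>. d *\<^sub>C (\<psi> \<eta> *\<^sub>C F \<eta>))"
      by (intro integral_add integrable_continuous_interval continuous_intros F
          continuous_on_test_fun[OF that(1)] continuous_on_test_fun[OF that(2)])
    also have "\<dots> = c *\<^sub>C f \<phi> + d *\<^sub>C f \<psi>"
      using integral_linear[OF int[OF that(1)] bounded_linear_scaleC[of c]]
        integral_linear[OF int[OF that(2)] bounded_linear_scaleC[of d]]
      by (simp add: o_def f that)
    finally show ?thesis .
  qed
  obtain B where B: "\<And>\<eta>. \<eta> \<in> {a..b} \<Longrightarrow> norm (F \<eta>) \<le> B"
    using compact_imp_bounded[OF compact_continuous_image[OF F compact_Icc]] bounded_iff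
    by (metis imageI)
  define C where "C = \<bar>B\<bar> * measure lborel {a..b}"
  have C: "0 \<le> C" by (simp add: C_def)
  have bound: "norm (f \<phi>) \<le> C * S" if \<phi>: "\<phi> \<in> test_funs ?I" and S: "\<And>t. cmod (\<phi> t) \<le> S" for \<phi> S
  proof -
    have "norm (f \<phi>) \<le> integral {a..b} (\<lambda>\<eta>. S * \<bar>B\<bar>)"
      unfolding f[OF \<phi>]
    proof (rule integral_norm_bound_integral[OF int[OF \<phi>] integrable_const_ivl])
      fix \<eta> assume "\<eta> \<in> {a..b}"
      then have "norm (F \<eta>) \<le> \<bar>B\<bar>" using B by force
      then show "norm (\<phi> \<eta> *\<^sub>C F \<eta>) \<le> S * \<bar>B\<bar>"
        unfolding norm_scaleC using S[of \<eta>] norm_ge_zero[of "\<phi> \<eta>"] by (intro mult_mono norm_ge_zero) linarith+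
    qed
    then show ?thesis by (simp add: C_def mult_ac)
  qed
  have zero: "(\<lambda>t. 0) \<in> test_funs J" for J
    by (rule test_funsI[of _ "{}"]) (use smooth_funI(1)[of "\<lambda>n t. 0"] in auto)
  have add: "(\<lambda>t. \<phi> t + \<psi> t) \<in> test_funs ?I" "f (\<lambda>t. \<phi> t + \<psi> t) = f \<phi> + f \<psi>"
    if "\<phi> \<in> test_funs ?I" "\<psi> \<in> test_funs ?I" for \<phi> \<psi>
    using test_funs_lincomb[OF that, of 1 1] lin[OF that, of 1 1] by simp_all
  have scale: "(\<lambda>t. c * \<phi> t) \<in> test_funs ?I" "f (\<lambda>t. c * \<phi> t) = c *\<^sub>C f \<phi>" if "\<phi> \<in> test_funs ?I" for \<phi> c
    using test_funs_lincomb[OF that that, of c 0] lin[OF that that, of c 0] by simp_all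
  have nbhd: "{\<psi> \<in> test_funs ?I. norm (f \<psi>) < e} \<in> test_nbhds ?I" (is "?W \<in> _") if e: "0 < e" for e
    unfolding test_nbhds_def
  proof (rule CollectI, intro conjI allI impI ballI)
    show "?W \<subseteq> test_funs ?I" by auto
    show "(\<lambda>t. (1 - complex_of_real u) * \<phi> t + complex_of_real u * \<psi> t) \<in> ?W"
      if "\<phi> \<in> ?W" "\<psi> \<in> ?W" and u': "0 \<le> complex_of_real u \<and> complex_of_real u \<le> 1" for \<phi> \<psi> :: "real \<Rightarrow> complex" and u :: real
    proof -
      have *: "\<phi> \<in> test_funs ?I" "\<psi> \<in> test_funs ?I" "norm (f \<phi>) < e" "norm (f \<psi>) < e" using that by auto
      \<comment> \<open>The order on complex numbers compares real parts and requires equal imaginary parts.\<close>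
      have u: "0 \<le> u" "u \<le> 1" using u' by (auto simp: less_eq_complex_def)
      have e': "1 - complex_of_real u = of_real (1 - u)" by simp
      have "norm (f (\<lambda>t. (1 - of_real u) * \<phi> t + of_real u * \<psi> t))
          \<le> norm (complex_of_real (1 - u) *\<^sub>C f \<phi>) + norm (complex_of_real u *\<^sub>C f \<psi>)"
        unfolding lin[OF *(1,2)] e' by (rule norm_triangle_ineq)
      also have "\<dots> = (1 - u) * norm (f \<phi>) + u * norm (f \<psi>)" using u by (simp del: of_real_diff)
      also have "\<dots> < e" using convex_bound_lt[OF *(3,4), of "1 - u" u] u by simp
      finally show ?thesis using test_funs_lincomb[OF *(1,2)] by simp
    qed
    show "(\<lambda>t. c * \<phi> t) \<in> ?W" if "\<phi> \<in> ?W" "cmod c \<le> 1" for \<phi> c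
    proof -
      have *: "\<phi> \<in> test_funs ?I" "norm (f \<phi>) < e" using that by auto
      have "cmod c * norm (f \<phi>) \<le> 1 * norm (f \<phi>)" using that(2) by (intro mult_right_mono) auto
      then show ?thesis using scale[OF *(1)] *(2) by simp
    qed
    fix K assume K: "compact K \<and> K \<subseteq> ?I"
    then have KI: "test_funs K \<subseteq> test_funs ?I" by (intro test_funs_mono) simp
    have dK: "(\<lambda>t. \<psi> t - \<phi> t) \<in> test_funs K" if "\<psi> \<in> test_funs K" "\<phi> \<in> test_funs K" for \<psi> \<phi>
      using test_funs_lincomb[OF that, of 1 "- 1"] by simp
    show "openin (test_funs_on_topology K) (?W \<inter> test_funs K)"
    proof (subst openin_subopen, intro ballI)
      fix \<phi> assume "\<phi> \<in> ?W \<inter> test_funs K"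
      then have \<phi>: "\<phi> \<in> test_funs K" "\<phi> \<in> test_funs ?I" "norm (f \<phi>) < e" by auto
      define \<epsilon> where "\<epsilon> = (e - norm (f \<phi>)) / (C + 1)"
      have \<epsilon>: "0 < \<epsilon>" using \<phi>(3) C by (simp add: \<epsilon>_def)
      let ?V = "{\<psi> \<in> test_funs K. (SUP t. cmod (iter_vderiv 0 (\<lambda>s. \<psi> s - \<phi> s) t)) < \<epsilon>}"
      have "openin (test_funs_on_topology K) ?V"
        unfolding test_funs_on_topology_def
        by (rule topology_generated_by_Basis) (use \<phi>(1) \<epsilon> in blast)
      moreover have "\<phi> \<in> ?V" using \<phi>(1) \<epsilon> by simp
      moreover have "?V \<subseteq> ?W \<inter> test_funs K"
      proof
        fix \<psi> assume "\<psi> \<in> ?V"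
        then have \<psi>: "\<psi> \<in> test_funs K" and sup: "(SUP t. cmod (\<psi> t - \<phi> t)) < \<epsilon>" by auto
        obtain b where b: "\<And>t. cmod (\<psi> t - \<phi> t) \<le> b" using test_fun_bounded[OF dK[OF \<psi> \<phi>(1)]] by blast
        have "cmod (\<psi> t - \<phi> t) \<le> \<epsilon>" for t
          using cSUP_upper[of t UNIV "\<lambda>t. cmod (\<psi> t - \<phi> t)"] b sup
          by (meson UNIV_I bdd_aboveI2 less_imp_le order_trans)
        then have "norm (f (\<lambda>t. \<psi> t - \<phi> t)) \<le> C * \<epsilon>"
          using dK[OF \<psi> \<phi>(1)] KI by (intro bound) auto
        also have "\<dots> < (C + 1) * \<epsilon>" using \<epsilon> by simp
        also have "\<dots> = e - norm (f \<phi>)" using C by (simp add: \<epsilon>_def)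
        finally have d: "norm (f (\<lambda>t. \<psi> t - \<phi> t)) < e - norm (f \<phi>)" .
        have "f \<psi> = f \<phi> + f (\<lambda>t. \<psi> t - \<phi> t)"
          using add(2)[OF \<phi>(2), of "\<lambda>t. \<psi> t - \<phi> t"] dK[OF \<psi> \<phi>(1)] KI by auto
        then have "norm (f \<psi>) < e" using d norm_triangle_ineq[of "f \<phi>" "f (\<lambda>t. \<psi> t - \<phi> t)"] by simp
        then show "\<psi> \<in> ?W \<inter> test_funs K" using \<psi> KI by auto
      qed
      ultimately show "\<exists>V. openin (test_funs_on_topology K) V \<and> \<phi> \<in> V \<and> V \<subseteq> ?W \<inter> test_funs K" by blast
    qed
  qed
  have top: "topspace (test_topology ?I) \<subseteq> test_funs ?I"
    unfolding test_topology_def topology_generated_by_topspace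
    using add(1) by (auto simp: test_nbhds_def)
  have "continuous_map (test_topology ?I) euclidean f"
    unfolding continuous_map_def
  proof (intro conjI allI impI)
    fix U :: "'z set" assume U: "openin euclidean U"
    show "openin (test_topology ?I) {\<phi> \<in> topspace (test_topology ?I). f \<phi> \<in> U}"
    proof (subst openin_subopen, intro ballI)
      fix \<phi> assume "\<phi> \<in> {\<phi> \<in> topspace (test_topology ?I). f \<phi> \<in> U}"
      then have \<phi>: "\<phi> \<in> test_funs ?I" "f \<phi> \<in> U" using top by auto
      obtain e where e: "0 < e" "ball (f \<phi>) e \<subseteq> U" using U \<phi>(2) by (auto elim: openE)
      let ?W = "{\<psi> \<in> test_funs ?I. norm (f \<psi>) < e}"
      let ?V = "(\<lambda>\<psi> t. \<phi> t + \<psi> t) ` ?W"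
      have op: "openin (test_topology ?I) ?V"
        unfolding test_topology_def
        by (rule topology_generated_by_Basis) (use nbhd[OF e(1)] \<phi>(1) in blast)
      have "f (\<lambda>t. 0) = 0" using scale(2)[OF zero, of 0] by simp
      then have "(\<lambda>t. 0) \<in> ?W" using zero e by simp
      then have mem: "\<phi> \<in> ?V" by (intro image_eqI[of _ _ "\<lambda>t. 0"]) auto
      have "f \<psi> \<in> U" if "\<psi> \<in> ?V" for \<psi>
      proof -
        obtain \<rho> where \<rho>: "\<rho> \<in> test_funs ?I" "norm (f \<rho>) < e" "\<psi> = (\<lambda>t. \<phi> t + \<rho> t)" using \<open>\<psi> \<in> ?V\<close> by auto
        then have "f \<psi> \<in> ball (f \<phi>) e" using add(2)[OF \<phi>(1) \<rho>(1)] by (simp add: dist_norm)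
        then show ?thesis using e by blast
      qed
      then have "?V \<subseteq> {\<phi> \<in> topspace (test_topology ?I). f \<phi> \<in> U}"
        using openin_subset[OF op] by blast
      with op mem show "\<exists>V. openin (test_topology ?I) V \<and> \<phi> \<in> V \<and>
          V \<subseteq> {\<phi> \<in> topspace (test_topology ?I). f \<phi> \<in> U}" by blast
    qed
  qed simp
  then show ?thesis by (simp add: distributions_def add(2) scale(2))
qed

context bounded_C0_semigroup begin

lemma resolvent_set_local_pseudofunction:
  assumes \<xi>0: "\<i> * of_real \<xi>0 \<in> resolvent_set (generator T)"
  shows "\<exists>I. open I \<and> \<xi>0 \<in> I \<and> local_pseudofunction I (resolvent_bv (generator T))"
proof -
  let ?A = "generator T"
  obtain d where d: "0 < d" "ball (\<i> * of_real \<xi>0) d \<subseteq> resolvent_set ?A"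
    using open_resolvent_set[OF clinear_op_generator] \<xi>0 openE by blast
  \<comment> \<open>The rectangle \<open>[0, r] \<times> [\<xi>\<^sub>0 - r, \<xi>\<^sub>0 + r]\<close> fits into the disc of radius \<open>d > 2 r\<close>.\<close>
  define r where "r = d / 3"
  define a where "a = \<xi>0 - r"
  define b where "b = \<xi>0 + r"
  have r: "0 < r" and ab: "a \<le> b" using d by (auto simp: r_def a_def b_def)
  have mem: "of_real \<beta> + \<i> * of_real \<xi> \<in> resolvent_set ?A" if "\<beta> \<in> {0..r}" "\<xi> \<in> {a..b}" for \<beta> \<xi>
  proof -
    have e: "of_real \<beta> + \<i> * of_real \<xi> - \<i> * of_real \<xi>0 = of_real \<beta> + \<i> * of_real (\<xi> - \<xi>0)"
      by (simp add: algebra_simps)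
    have "cmod (of_real \<beta> + \<i> * of_real (\<xi> - \<xi>0)) \<le> \<bar>\<beta>\<bar> + \<bar>\<xi> - \<xi>0\<bar>"
      using norm_triangle_ineq[of "of_real \<beta>" "\<i> * of_real (\<xi> - \<xi>0)"]
      by (simp add: norm_mult del: of_real_diff)
    also have "\<dots> < d" using that r by (auto simp: r_def a_def b_def abs_if)
    finally have "cmod (of_real \<beta> + \<i> * of_real \<xi> - \<i> * of_real \<xi>0) < d" unfolding e .
    then show ?thesis using d(2) by (auto simp: dist_norm norm_minus_commute)
  qed
  have r0: "0 \<in> {0..r}" using r by simp
  \<comment> \<open>The factor compensates for the normalisation of the Fourier transform.\<close>
  define F where "F \<xi> = (1 / (2 * of_real pi)) *\<^sub>C R 0 \<xi>" for \<xi>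
  define F' where "F' \<xi> = (1 / (2 * of_real pi)) *\<^sub>C ((- \<i>) *\<^sub>C (R 0 \<xi> o\<^sub>C R 0 \<xi>))" for \<xi>
  have cR: "continuous_on U (\<lambda>x. R (h x) (k x))"
    if "continuous_on U h" "continuous_on U k" "\<And>x. x \<in> U \<Longrightarrow> h x \<in> {0..r}" "\<And>x. x \<in> U \<Longrightarrow> k x \<in> {a..b}"
    for U :: "'b::topological_space set" and h k
    by (rule continuous_on_resolvent_comp[OF clinear_op_generator])
      (use that mem in \<open>auto intro!: continuous_intros\<close>)
  have dF: "(F has_vector_derivative F' \<xi>) (at \<xi>)" if "\<xi> \<in> {a..b}" for \<xi>
    unfolding F_def[abs_def] F'_def
    by (rule bounded_linear.has_vector_derivative[OF bounded_linear_scaleC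
          resolvent_derivative_Im[OF clinear_op_generator mem[OF r0 that]]])
  have cF': "continuous_on {a..b} F'"
    unfolding F'_def[abs_def] by (intro continuous_intros cR) (use r0 in auto)
  have bv: "resolvent_bv ?A \<phi> = integral {a..b} (\<lambda>\<xi>. \<phi> \<xi> *\<^sub>C R 0 \<xi>)" if \<phi>: "\<phi> \<in> test_funs {a<..<b}" for \<phi>
  proof -
    have "continuous_on {0..r} (\<lambda>\<beta>. integral (cbox a b) (\<lambda>\<xi>. \<phi> \<xi> *\<^sub>C R \<beta> \<xi>))"
      by (rule integral_continuous_on_param, unfold split_def)
        (intro continuous_on_scaleC continuous_on_compose2[OF continuous_on_test_fun[OF \<phi>, of UNIV]] cR
          continuous_intros, auto)
    then have "((\<lambda>\<beta>. integral (cbox a b) (\<lambda>\<xi>. \<phi> \<xi> *\<^sub>C R \<beta> \<xi>)) \<longlongrightarrow> integral (cbox a b) (\<lambda>\<xi>. \<phi> \<xi> *\<^sub>C R 0 \<xi>))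
        (at 0 within {0..r})"
      using r0 unfolding continuous_on_def by blast
    then have "(approx_bv \<phi> \<longlongrightarrow> integral {a..b} (\<lambda>\<xi>. \<phi> \<xi> *\<^sub>C R 0 \<xi>)) (at_right 0)"
      unfolding at_within_Icc_at_right[OF r] by (simp add: approx_bv_eq[OF \<phi>, abs_def])
    then show ?thesis using tendsto_unique[OF trivial_limit_at_right_real approx_bv_tendsto[OF \<phi>]] by blast
  qed
  define g where "g t = integral {a..b} (\<lambda>\<eta>. exp (\<i> * of_real \<eta> * of_real t) *\<^sub>C F \<eta>)" for t
  have g: "g \<in> C0_funs" unfolding g_def[abs_def] by (rule oscillatory_integral_C0[OF dF cF' ab])
  have "resolvent_bv ?A \<phi> = fourier_distr (regular_distr g) \<phi>" if \<phi>: "\<phi> \<in> test_funs {a<..<b}" for \<phi>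
    using regular_distr_inverse_fourier[OF \<phi> ab dF cF'] bv[OF \<phi>]
    unfolding fourier_distr_def g_def[abs_def] by (simp add: F_def scaleC_scaleC)
  moreover have "resolvent_bv ?A \<in> distributions {a<..<b}"
    by (rule integral_pairing_distribution[OF _ bv]) (intro cR continuous_intros, use r0 in auto)
  moreover have "fourier_distr (regular_distr g) \<in> pseudofunctions"
    unfolding pseudofunctions_def using g by (rule imageI)
  ultimately have "local_pseudofunction {a<..<b} (resolvent_bv ?A)"
    unfolding local_pseudofunction_def
    by (intro conjI ballI exI[of _ "{a<..<b}"] bexI[of _ "fourier_distr (regular_distr g)"]) simp_all
  moreover have "open {a<..<b}" "\<xi>0 \<in> {a<..<b}" using r by (auto simp: a_def b_def)
  ultimately show ?thesis by blast
qed

end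

theorem proposition6p2:
  fixes T :: "real \<Rightarrow> ('a::complex_banach, 'a) cblinfun" and A :: "'a \<rightharpoonup> 'a"
  assumes "C0_semigroup T"
    and "bounded_semigroup T"
    and "A = generator T"
  shows "uPF_spectrum A = spectrum A \<inter> range (\<lambda>\<xi>::real. \<i> * of_real \<xi>)"
proof -
  obtain M where "\<And>t. 0 \<le> t \<Longrightarrow> norm (T t) \<le> M"
    using assms(2) unfolding bounded_semigroup_def bounded_iff by auto
  then interpret bounded_C0_semigroup T M
    by (intro bounded_C0_semigroup.intro assms(1))
  have "\<xi> \<in> pf_singsupp (resolvent_bv A) \<longleftrightarrow> \<i> * of_real \<xi> \<in> spectrum A" for \<xi>
    using local_pseudofunction_resolvent_set resolvent_set_local_pseudofunction[of \<xi>]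
    unfolding assms(3) pf_singsupp_def spectrum_def by blast
  then show ?thesis unfolding uPF_spectrum_def by blast
qed

end
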